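(* Let $K$ be any field of characteristic zero and let $A$ be a finitely generated commutative $K$-algebra. If $\sigma: A\to A$ is a $K$-algebra automorphism and $I$ and $J$ are ideals of $A$, then the set $$S = S(I,J) := \{n\in \mathbb{Z} : \sigma^n(I) \supseteq J\}$$ has the two-sided SML property.
   Context: For a subset $I \subseteq A$, $\sigma(I) := \{\sigma(a) : a\in I\}$, and $\sigma^n$ for $n<0$ denotes the iterate $(\sigma^{-1})^{|n|}$. A set $S\subseteq \mathbb{Z}$ has the two-sided SML property if it is a finite union of complete (doubly infinite) arithmetic progressions $\{an+b : n\in\mathbb{Z}\}$ with $a,b \in \mathbb{Z}$, augmented by a finite (possibly empty) set. *)

theory Defs
  imports "HOL-Algebra.Algebra"
begin

definition char_zero :: "('k, 'm) ring_scheme \<Rightarrow> bool" where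
  "char_zero K \<longleftrightarrow> (\<forall>n::nat. 0 < n \<longrightarrow> [n] \<cdot>\<^bsub>K\<^esub> \<one>\<^bsub>K\<^esub> \<noteq> \<zero>\<^bsub>K\<^esub>)"

text \<open>The subalgebra generated by a set \<open>G\<close> is the subring generated by \<open>G\<close> together with
  the scalars, i.e. the image of \<open>K\<close> under the structure map sending \<open>c\<close> to \<open>c\<close> times one.\<close>

definition finitely_generated_algebra ::
  "('k, 'm) ring_scheme \<Rightarrow> ('k, 'a, 'n) module_scheme \<Rightarrow> bool" where
  "finitely_generated_algebra K A \<longleftrightarrow>
     algebra K A \<and>
     (\<exists>G. finite G \<and> G \<subseteq> carrier A \<and>
        generate_ring A ((\<lambda>c. c \<odot>\<^bsub>A\<^esub> \<one>\<^bsub>A\<^esub>) ` carrier K \<union> G) = carrier A)"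

definition algebra_automorphism ::
  "('k, 'm) ring_scheme \<Rightarrow> ('k, 'a, 'n) module_scheme \<Rightarrow> ('a \<Rightarrow> 'a) \<Rightarrow> bool" where
  "algebra_automorphism K A \<sigma> \<longleftrightarrow>
     \<sigma> \<in> ring_iso A A \<and>
     (\<forall>c\<in>carrier K. \<forall>x\<in>carrier A. \<sigma> (c \<odot>\<^bsub>A\<^esub> x) = c \<odot>\<^bsub>A\<^esub> \<sigma> x)"

text \<open>Integer iterates of a bijection \<open>f\<close> of the set \<open>D\<close> onto itself. The inverse has to be
  taken relative to \<open>D\<close>, since \<open>f\<close> is unspecified outside \<open>D\<close>; accordingly the
  iterates are meaningful on \<open>D\<close> only.\<close>

definition int_iterate :: "'a set \<Rightarrow> ('a \<Rightarrow> 'a) \<Rightarrow> int \<Rightarrow> 'a \<Rightarrow> 'a" where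
  "int_iterate D f n = (if 0 \<le> n then f ^^ nat n else inv_into D f ^^ nat (- n))"

text \<open>The pair \<open>(a, b)\<close> encodes the progression of all \<open>a * n + b\<close>. The degenerate case
  \<open>a = 0\<close> only yields a singleton, which the finite exceptional set \<open>F\<close> covers anyway.\<close>

definition two_sided_SML :: "int set \<Rightarrow> bool" where
  "two_sided_SML S \<longleftrightarrow>
     (\<exists>(P :: (int \<times> int) set) F. finite P \<and> finite F \<and>
        S = (\<Union>(a, b)\<in>P. {a * n + b | n. True}) \<union> F)"

end

theory Submission
  imports Defs "HOL-Computational_Algebra.Polynomial"
begin

text \<open>
  The condition \<open>J \<subseteq> \<sigma>\<^sup>n(I)\<close> says that \<open>\<sigma>\<^sup>-\<^sup>n(a) \<in> I\<close> for all \<open>a \<in> J\<close>. As \<open>A\<close> is Noetherian, \<open>J\<close> has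
  finitely many generators, so it is enough to show for a single \<open>a\<close> that there is a modulus
  \<open>N\<close> such that in every residue class modulo \<open>N\<close> the relation \<open>\<sigma>\<^sup>n(a) \<in> I\<close> holds either always or
  only finitely often; this property of a set of integers is \<open>eventually_periodic\<close>. It is stable
  under intersections, and Noetherian induction reduces the claim to primary \<open>I\<close>: if \<open>x y \<in> I\<close>
  but \<open>x \<notin> I\<close> and no power of \<open>y\<close> is in \<open>I\<close>, then \<open>I = (I : y\<^sup>k) \<inter> (I + (y\<^sup>k))\<close> for large \<open>k\<close>, and
  both ideals on the right are strictly larger than \<open>I\<close>.

  The primary case is a \<open>p\<close>-adic interpolation argument, carried out inside finitely generated
  rings. The element \<open>a\<close> lies in a subring \<open>A\<^sub>0\<close>, finitely generated over the integers, that \<open>\<sigma>\<close> maps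
  onto itself. By Zariski's lemma there are an ideal \<open>q\<close> of \<open>A\<^sub>0\<close> containing \<open>I \<inter> A\<^sub>0\<close> and a prime
  \<open>p > 2\<close> such that \<open>A\<^sub>0/q\<close> has no integer torsion, \<open>p\<close> is not a unit in it, and \<open>A\<^sub>0/m\<close> is finite
  for \<open>m = q + p A\<^sub>0\<close> (\<open>exists_finite_specialisation\<close>); geometrically, this is an algebraic point of the
  zero set of \<open>I\<close> with coordinates integral at \<open>p\<close>. Let \<open>B = A\<^sub>0[m/p]\<close>, which amounts to rescaling the
  \<open>p\<close>-adic residue disc of that point to unit size. The ideal \<open>A\<^sub>0 \<inter> p\<^sup>2 B\<close> contains \<open>m\<^sup>2\<close> and so has finite
  index in \<open>A\<^sub>0\<close>. By the pigeonhole principle there is \<open>N > 0\<close> for which \<open>\<tau> = \<sigma>\<^sup>N\<close> is the identity on \<open>A\<^sub>0\<close>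
  modulo this ideal (\<open>iterate_trivial_modulo\<close>), and then \<open>\<tau> - 1\<close> maps \<open>B\<close> into \<open>p B\<close> (\<open>iterate_close\<close>).
  Consequently Newton's formula reads \<open>\<tau>\<^sup>n b = \<Sum>\<^sub>i (n choose i) p\<^sup>i b\<^sub>i\<close> with \<open>b\<^sub>i \<in> B\<close>.
  As \<open>i!\<close> contains at most \<open>i/2\<close> factors \<open>p\<close>, the right-hand side is, up to denominators prime to \<open>p\<close>,
  a polynomial in \<open>n\<close> whose \<open>j\<close>-th coefficient is divisible by a power of \<open>p\<close> that grows with \<open>j\<close>.
  Splitting off the linear factors of \<open>k\<close> zeros modulo \<open>I\<close> shows that all values lie in
  \<open>I + p\<^sup>l B\<close>, where \<open>l\<close> is about \<open>k/2\<close> (\<open>iterate_many_zeros\<close>). Infinitely many zeros therefore put every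
  value \<open>x\<close> into the intersection of all \<open>I + p\<^sup>l B\<close>. Krull's intersection theorem yields
  \<open>s \<in> B\<close> with \<open>(1 - p s) x \<in> I\<close>, and because \<open>I\<close> is primary and \<open>1 \<notin> I + p B\<close> (\<open>p_nonunit_B\<close>), \<open>x \<in> I\<close>.

  The arithmetic is done in a type of class \<open>comm_ring_1\<close>: \<open>A\<close> is a quotient of the free commutative
  algebra over the rationals on the elements of its underlying type, \<open>\<sigma>\<close> lifts to an
  automorphism of that algebra, and the ideals of \<open>A\<close> become the ideals above the kernel \<open>Z\<close> of the
  quotient map. This is the reason why chain conditions are stated between two bounds, with \<open>Z\<close> as
  the lower one.
\<close>

hide_const (open) Divisibility.prime

section \<open>Subrings, submodules and chain conditions\<close>

definition is_subring :: "'r::comm_ring_1 set \<Rightarrow> bool" where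
  "is_subring B \<longleftrightarrow> 1 \<in> B \<and> (\<forall>x\<in>B. \<forall>y\<in>B. x - y \<in> B \<and> x * y \<in> B)"

text \<open>\<open>R\<close> acts by multiplication in the ambient ring, so the ideals of a subring \<open>R\<close> are its submodules
  contained in \<open>R\<close>.\<close>
definition is_submodule :: "'r::comm_ring_1 set \<Rightarrow> 'r set \<Rightarrow> bool" where
  "is_submodule R N \<longleftrightarrow> 0 \<in> N \<and> (\<forall>x\<in>N. \<forall>y\<in>N. x + y \<in> N) \<and> (\<forall>r\<in>R. \<forall>x\<in>N. r * x \<in> N)"

abbreviation is_ideal :: "'r::comm_ring_1 set \<Rightarrow> bool" where
  "is_ideal \<equiv> is_submodule UNIV"

text \<open>For \<open>Z = {0}\<close> this is the usual ascending chain condition for submodules of \<open>W\<close>; in general it is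
  the one for \<open>W/Z\<close>, expressed without forming the quotient.\<close>
definition noetherian_between :: "'r::comm_ring_1 set \<Rightarrow> 'r set \<Rightarrow> 'r set \<Rightarrow> bool" where
  "noetherian_between R W Z \<longleftrightarrow>
     (\<forall>f::nat \<Rightarrow> 'r set. (\<forall>n. is_submodule R (f n) \<and> Z \<subseteq> f n \<and> f n \<subseteq> W \<and> f n \<subseteq> f (Suc n)) \<longrightarrow>
        (\<exists>n. \<forall>m\<ge>n. f m = f n))"

lemma subring_1 [simp]: "is_subring B \<Longrightarrow> 1 \<in> B"
  by (simp add: is_subring_def)

lemma subring_diff: "is_subring B \<Longrightarrow> x \<in> B \<Longrightarrow> y \<in> B \<Longrightarrow> x - y \<in> B"
  by (simp add: is_subring_def)

lemma subring_mult: "is_subring B \<Longrightarrow> x \<in> B \<Longrightarrow> y \<in> B \<Longrightarrow> x * y \<in> B"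
  by (simp add: is_subring_def)

lemma subring_0 [simp]: "is_subring B \<Longrightarrow> 0 \<in> B"
  using subring_diff[of B 1 1] by simp

lemma subring_uminus: "is_subring B \<Longrightarrow> x \<in> B \<Longrightarrow> - x \<in> B"
  using subring_diff[of B 0 x] by simp

lemma subring_add: "is_subring B \<Longrightarrow> x \<in> B \<Longrightarrow> y \<in> B \<Longrightarrow> x + y \<in> B"
  using subring_diff[of B x "- y"] subring_uminus[of B y] by simp

lemma subring_power: "is_subring B \<Longrightarrow> x \<in> B \<Longrightarrow> x ^ n \<in> B"
  by (induction n) (auto intro: subring_mult)

lemma subring_of_nat [simp]: "is_subring B \<Longrightarrow> of_nat n \<in> B"
  by (induction n) (auto intro: subring_add)

lemma subring_of_int [simp]: "is_subring B \<Longrightarrow> of_int k \<in> B"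
  by (cases k) (auto intro: subring_uminus subring_diff simp del: of_nat_Suc)

lemma subring_sum: "is_subring B \<Longrightarrow> (\<And>i. i \<in> I \<Longrightarrow> f i \<in> B) \<Longrightarrow> sum f I \<in> B"
  by (induction I rule: infinite_finite_induct) (auto intro: subring_add)

lemma is_submodule_self: "is_subring R \<Longrightarrow> is_submodule R R"
  by (auto simp: is_submodule_def intro: subring_add subring_mult)

lemma submodule_0 [simp]: "is_submodule R N \<Longrightarrow> 0 \<in> N"
  by (simp add: is_submodule_def)

lemma submodule_add: "is_submodule R N \<Longrightarrow> x \<in> N \<Longrightarrow> y \<in> N \<Longrightarrow> x + y \<in> N"
  by (simp add: is_submodule_def)

lemma submodule_mult: "is_submodule R N \<Longrightarrow> r \<in> R \<Longrightarrow> x \<in> N \<Longrightarrow> r * x \<in> N"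
  by (simp add: is_submodule_def)

lemma submodule_uminus: "is_subring R \<Longrightarrow> is_submodule R N \<Longrightarrow> x \<in> N \<Longrightarrow> - x \<in> N"
  using submodule_mult[of R N "- 1" x] subring_uminus[of R 1] by simp

lemma submodule_diff: "is_subring R \<Longrightarrow> is_submodule R N \<Longrightarrow> x \<in> N \<Longrightarrow> y \<in> N \<Longrightarrow> x - y \<in> N"
  using submodule_add[of R N x "- y"] submodule_uminus[of R N y] by simp

lemma submodule_sum: "is_submodule R N \<Longrightarrow> (\<And>i. i \<in> I \<Longrightarrow> f i \<in> N) \<Longrightarrow> sum f I \<in> N"
  by (induction I rule: infinite_finite_induct) (auto intro: submodule_add)

lemma submodule_anti: "is_submodule R N \<Longrightarrow> R' \<subseteq> R \<Longrightarrow> is_submodule R' N"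
  by (auto simp: is_submodule_def)

lemma submodule_Int: "is_submodule R M \<Longrightarrow> is_submodule R N \<Longrightarrow> is_submodule R (M \<inter> N)"
  by (auto simp: is_submodule_def)

lemma submodule_plus:
  assumes "is_submodule R M" "is_submodule R N"
  shows "is_submodule R {m + n | m n. m \<in> M \<and> n \<in> N}"
  unfolding is_submodule_def
proof (intro conjI ballI)
  show "0 \<in> {m + n | m n. m \<in> M \<and> n \<in> N}"
    using assms by (force intro: exI[of _ 0])
next
  fix x y assume "x \<in> {m + n | m n. m \<in> M \<and> n \<in> N}" "y \<in> {m + n | m n. m \<in> M \<and> n \<in> N}"
  then obtain m n m' n' where "x = m + n" "y = m' + n'" "m \<in> M" "n \<in> N" "m' \<in> M" "n' \<in> N"
    by blast
  then have "x + y = (m + m') + (n + n')" "m + m' \<in> M" "n + n' \<in> N"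
    using assms by (auto intro: submodule_add)
  then show "x + y \<in> {m + n | m n. m \<in> M \<and> n \<in> N}" by blast
next
  fix r x assume "r \<in> R" "x \<in> {m + n | m n. m \<in> M \<and> n \<in> N}"
  then obtain m n where "x = m + n" "m \<in> M" "n \<in> N" by blast
  then have "r * x = r * m + r * n" "r * m \<in> M" "r * n \<in> N"
    using assms \<open>r \<in> R\<close> by (auto intro: submodule_mult simp: distrib_left)
  then show "r * x \<in> {m + n | m n. m \<in> M \<and> n \<in> N}" by blast
qed

lemma submodule_vimage_mult:
  assumes M: "is_submodule R M" shows "is_submodule R {x. u * x \<in> M}"
  unfolding is_submodule_def
  using submodule_0[OF M] submodule_add[OF M] submodule_mult[OF M]
  by (auto simp: distrib_left mult.left_commute[of u])

lemma submodule_image_mult: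
  assumes M: "is_submodule R M" shows "is_submodule R {u * x | x. x \<in> M}"
  unfolding is_submodule_def
proof (intro conjI ballI)
  show "0 \<in> {u * x | x. x \<in> M}" using submodule_0[OF M] by (intro CollectI exI[of _ 0]) simp
next
  fix x y assume "x \<in> {u * x | x. x \<in> M}" "y \<in> {u * x | x. x \<in> M}"
  then show "x + y \<in> {u * x | x. x \<in> M}"
    using submodule_add[OF M] by (auto simp: distrib_left[symmetric])
next
  fix r x assume "r \<in> R" "x \<in> {u * x | x. x \<in> M}"
  then obtain y where "x = u * y" "y \<in> M" by blast
  then have "r * x = u * (r * y)" "r * y \<in> M"
    using submodule_mult[OF M \<open>r \<in> R\<close>] by (simp_all add: mult.left_commute)
  then show "r * x \<in> {u * x | x. x \<in> M}" by blast
qed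

lemma noetherian_betweenD:
  assumes "noetherian_between R W Z"
    and "\<And>n. is_submodule R (f n)" "\<And>n. Z \<subseteq> f n" "\<And>n. f n \<subseteq> W" "\<And>n. f n \<subseteq> f (Suc n)"
  obtains n where "\<And>m. n \<le> m \<Longrightarrow> f m = f n"
  using assms unfolding noetherian_between_def by blast

lemma noetherian_between_maximal:
  assumes "noetherian_between R W Z" "\<F> \<noteq> {}"
    and \<F>: "\<And>L. L \<in> \<F> \<Longrightarrow> is_submodule R L \<and> Z \<subseteq> L \<and> L \<subseteq> W"
  shows "\<exists>M\<in>\<F>. \<forall>L\<in>\<F>. M \<subseteq> L \<longrightarrow> L = M"
proof (rule ccontr)
  assume "\<not> ?thesis"
  then have *: "\<forall>M\<in>\<F>. \<exists>L\<in>\<F>. M \<subset> L" by blast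
  obtain f where f: "\<And>n. f n \<in> \<F>" "\<And>n. f n \<subset> f (Suc n)"
    using dependent_nat_choice[of "\<lambda>_ L. L \<in> \<F>" "\<lambda>_ M L. M \<subset> L"] * assms(2) by (metis ex_in_conv)
  obtain n where "\<And>m. n \<le> m \<Longrightarrow> f m = f n"
    using noetherian_betweenD[OF assms(1), of f] \<F> f by (metis psubset_imp_subset)
  then have "f (Suc n) = f n" using le_Suc_eq by blast
  then show False using f(2)[of n] by simp
qed

text \<open>The base \<open>Q\<close> takes the place of zero, again so that statements about modules modulo \<open>Q\<close> need no
  quotient. A list rather than a set of generators permits induction one generator at a time.\<close>
fun span_over :: "'r::comm_ring_1 set \<Rightarrow> 'r set \<Rightarrow> 'r list \<Rightarrow> 'r set" where
  "span_over R Q [] = Q"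
| "span_over R Q (w # ws) = {t + s * w | t s. t \<in> span_over R Q ws \<and> s \<in> R}"

lemma span_over_submodule:
  assumes "is_subring R" "is_submodule R Q"
  shows "is_submodule R (span_over R Q ws)"
proof (induction ws)
  case (Cons w ws)
  have "is_submodule R {w * s | s. s \<in> R}"
    using submodule_image_mult[OF is_submodule_self[OF assms(1)]] .
  from submodule_plus[OF Cons this] show ?case
    by (rule back_subst[of "is_submodule R"]) (auto simp: mult.commute)
qed (use assms in simp)

lemma span_over_base: "is_subring R \<Longrightarrow> Q \<subseteq> span_over R Q ws"
proof (induction ws)
  case (Cons w ws)
  have "q \<in> span_over R Q (w # ws)" if "q \<in> Q" for q
    unfolding span_over.simps using Cons that by (intro CollectI exI[of _ q] exI[of _ 0]) auto
  then show ?case by auto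
qed simp

lemma span_over_mem: "is_subring R \<Longrightarrow> is_submodule R Q \<Longrightarrow> w \<in> set ws \<Longrightarrow> w \<in> span_over R Q ws"
proof (induction ws)
  case (Cons v ws)
  show ?case
  proof (cases "w = v")
    case True
    then show ?thesis
      unfolding span_over.simps using Cons.prems span_over_submodule[of R Q ws]
      by (intro CollectI exI[of _ 0] exI[of _ 1]) auto
  next
    case False
    then show ?thesis
      unfolding span_over.simps using Cons by (intro CollectI exI[of _ w] exI[of _ 0]) auto
  qed
qed simp

lemma span_over_least:
  assumes "is_submodule R M" "Q \<subseteq> M" "set ws \<subseteq> M"
  shows "span_over R Q ws \<subseteq> M"
  using assms(3) by (induction ws) (use assms in \<open>auto intro!: submodule_add submodule_mult\<close>)

text \<open>A maximal one among the finitely generated submodules of \<open>L\<close> is all of \<open>L\<close>, because adjoining one more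
  generator cannot enlarge it.\<close>
lemma noetherian_between_finitely_generated:
  assumes R: "is_subring R" and Z: "is_submodule R Z"
    and noeth: "noetherian_between R W Z"
    and L: "is_submodule R L" "Z \<subseteq> L" "L \<subseteq> W"
  obtains ws where "set ws \<subseteq> L" "L = span_over R Z ws"
proof -
  let ?\<F> = "{span_over R Z ws | ws. set ws \<subseteq> L}"
  have sub: "span_over R Z ws \<subseteq> L" if "set ws \<subseteq> L" for ws
    using span_over_least[OF L(1,2) that] .
  have "span_over R Z [] \<in> ?\<F>" by fastforce
  then have ne: "?\<F> \<noteq> {}" by blast
  have "is_submodule R N \<and> Z \<subseteq> N \<and> N \<subseteq> W" if "N \<in> ?\<F>" for N
    using that span_over_submodule[OF R Z] span_over_base[OF R, of Z] sub L(3) by blast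
  then have max: "\<exists>M\<in>?\<F>. \<forall>N\<in>?\<F>. M \<subseteq> N \<longrightarrow> N = M"
    by (rule noetherian_between_maximal[OF noeth ne])
  then obtain M where M: "M \<in> ?\<F>" "\<And>N. N \<in> ?\<F> \<Longrightarrow> M \<subseteq> N \<Longrightarrow> N = M"
    by meson
  then obtain ws where ws: "set ws \<subseteq> L" "M = span_over R Z ws" by blast
  have "w \<in> M" if "w \<in> L" for w
  proof -
    have "span_over R Z (w # ws) \<in> ?\<F>" using that ws(1) by (intro CollectI exI[of _ "w # ws"]) auto
    moreover have "M \<subseteq> span_over R Z (w # ws)"
      unfolding ws(2) using span_over_submodule[OF R Z, of "w # ws"] span_over_base[OF R, of Z "w # ws"]
        span_over_mem[OF R Z, of _ "w # ws"] by (intro span_over_least) auto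
    ultimately have "span_over R Z (w # ws) = M" by (rule M(2))
    then show ?thesis using span_over_mem[OF R Z, of w "w # ws"] by simp
  qed
  then have "L = M" using sub[OF ws(1)] ws(2) by blast
  then show ?thesis using that ws by blast
qed

text \<open>Extension step.\<close>
text \<open>If \<open>L\<close> is an ideal, \<open>y\<close> a power of a ring element and \<open>N\<close> consists of the polynomial expressions of lower
  degree in that element, these are the leading coefficients in \<open>L\<close>.\<close>
lemma coefficients_submodule:
  assumes R: "is_subring R" and N: "is_submodule R N" and L: "is_submodule R L"
  shows "is_submodule R {s \<in> R. \<exists>t\<in>N. t + s * y \<in> L}" (is "is_submodule R ?C")
  unfolding is_submodule_def
proof (intro conjI ballI)
  show "0 \<in> ?C" using R by (auto intro!: bexI[of _ 0] submodule_0[OF L] submodule_0[OF N])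
next
  fix s s' assume "s \<in> ?C" "s' \<in> ?C"
  then obtain t t' where *: "s \<in> R" "s' \<in> R" "t \<in> N" "t' \<in> N" "t + s * y \<in> L" "t' + s' * y \<in> L"
    by auto
  have "(t + t') + (s + s') * y \<in> L"
    using submodule_add[OF L *(5,6)] by (simp add: algebra_simps)
  then show "s + s' \<in> ?C" using subring_add[OF R *(1,2)] submodule_add[OF N *(3,4)] by blast
next
  fix r s assume r: "r \<in> R" and "s \<in> ?C"
  then obtain t where *: "s \<in> R" "t \<in> N" "t + s * y \<in> L" by auto
  have "r * t + (r * s) * y \<in> L"
    using submodule_mult[OF L r *(3)] by (simp add: algebra_simps)
  then show "r * s \<in> ?C" using subring_mult[OF R r *(1)] submodule_mult[OF N r *(2)] by blast
qed

text \<open>Extension step for modules: a chain in \<open>N + R y\<close> is controlled by its intersections with \<open>N\<close>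
  and by the ideals of coefficients at \<open>y\<close>. If both sequences stand still between two members of the
  chain, these members are equal.\<close>
lemma noetherian_between_insert:
  assumes R: "is_subring R" and Z: "is_submodule R Z" and N: "is_submodule R N" "Z \<subseteq> N"
    and noethN: "noetherian_between R N Z" and noethR: "noetherian_between R R (Z \<inter> R)"
    and y: "\<And>s. s \<in> Z \<inter> R \<Longrightarrow> s * y \<in> Z"
  shows "noetherian_between R {t + s * y | t s. t \<in> N \<and> s \<in> R} Z"
  unfolding noetherian_between_def
proof (intro allI impI)
  fix f :: "nat \<Rightarrow> 'a set"
  assume "\<forall>n. is_submodule R (f n) \<and> Z \<subseteq> f n \<and> f n \<subseteq> {t + s * y | t s. t \<in> N \<and> s \<in> R} \<and> f n \<subseteq> f (Suc n)"
  then have f: "is_submodule R (f n)" "Z \<subseteq> f n" "f n \<subseteq> {t + s * y | t s. t \<in> N \<and> s \<in> R}" "f n \<subseteq> f (Suc n)"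
    for n by auto
  have mono: "f m \<subseteq> f n" if "m \<le> n" for m n
    using lift_Suc_mono_le[of f, OF f(4) that] .
  define g where "g n = {s \<in> R. \<exists>t\<in>N. t + s * y \<in> f n}" for n
  obtain a where a: "\<And>m. a \<le> m \<Longrightarrow> f m \<inter> N = f a \<inter> N"
    using noetherian_betweenD[OF noethN, of "\<lambda>n. f n \<inter> N"] f N submodule_Int
    by (metis (no_types, lifting) Int_lower2 Int_mono inf.bounded_iff order_refl)
  have "is_submodule R (g n)" for n
    unfolding g_def by (rule coefficients_submodule[OF R N(1) f(1)])
  moreover have "Z \<inter> R \<subseteq> g n" for n
  proof
    fix s assume s: "s \<in> Z \<inter> R"
    then have "0 + s * y \<in> f n" using y f(2) by auto
    then show "s \<in> g n" using s N unfolding g_def by (intro CollectI conjI bexI[of _ 0]) auto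
  qed
  moreover have "g n \<subseteq> R" "g n \<subseteq> g (Suc n)" for n
    using f(4)[of n] by (auto simp: g_def)
  ultimately obtain b where b: "\<And>m. b \<le> m \<Longrightarrow> g m = g b"
    using noetherian_betweenD[OF noethR, of g] by metis
  have "f m = f (max a b)" if m: "max a b \<le> m" for m
  proof
    show "f (max a b) \<subseteq> f m" using mono[OF m] .
    show "f m \<subseteq> f (max a b)"
    proof
      fix x assume x: "x \<in> f m"
      then obtain t s where ts: "x = t + s * y" "t \<in> N" "s \<in> R" using f(3) by blast
      then have "s \<in> g m" using x by (auto simp: g_def)
      then have "s \<in> g (max a b)" using b[of m] b[of "max a b"] m by simp
      then obtain t' where t': "t' \<in> N" "t' + s * y \<in> f (max a b)" by (auto simp: g_def)
      then have "x - (t' + s * y) \<in> f m"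
        using x mono[OF m] submodule_diff[OF R f(1)] by blast
      then have "t - t' \<in> f m \<inter> N" using ts t' submodule_diff[OF R N(1)] by simp
      then have "t - t' \<in> f (max a b)" using a[of m] a[of "max a b"] m by auto
      then have "(t - t') + (t' + s * y) \<in> f (max a b)" using t' f(1) submodule_add by blast
      then show "x \<in> f (max a b)" using ts by simp
    qed
  qed
  then show "\<exists>n. \<forall>m\<ge>n. f m = f n" by blast
qed

lemma noetherian_between_span:
  assumes R: "is_subring R" and Q: "is_submodule R Q"
    and noethR: "noetherian_between R R (Q \<inter> R)"
    and ws: "\<And>w s. w \<in> set ws \<Longrightarrow> s \<in> Q \<Longrightarrow> s * w \<in> Q"
  shows "noetherian_between R (span_over R Q ws) Q"
  using ws
proof (induction ws)
  case Nil
  show ?case unfolding noetherian_between_def span_over.simps by (metis subset_antisym)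
next
  case (Cons w ws)
  then show ?case unfolding span_over.simps
    using noetherian_between_insert[OF R Q span_over_submodule[OF R Q] span_over_base[OF R]] noethR
    by simp
qed

lemma noetherian_between_anti:
  "noetherian_between R W Z \<Longrightarrow> Z \<subseteq> Z' \<Longrightarrow> W' \<subseteq> W \<Longrightarrow> noetherian_between R W' Z'"
  unfolding noetherian_between_def by (meson order_trans)

text \<open>Adjoining\<close>

section \<open>Hilbert's basis theorem\<close>

definition adjoin :: "'r::comm_ring_1 set \<Rightarrow> 'r \<Rightarrow> 'r set" where
  "adjoin R x = {poly P x | P. \<forall>i. coeff P i \<in> R}"

lemma coeffs_in_mult:
  "is_subring R \<Longrightarrow> \<forall>i. coeff P i \<in> R \<Longrightarrow> \<forall>i. coeff Q i \<in> R \<Longrightarrow> \<forall>i. coeff (P * Q) i \<in> R"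
  by (auto simp: coeff_mult intro!: subring_sum subring_mult)

lemma adjoin_subring:
  assumes "is_subring R" shows "is_subring (adjoin R x)"
  unfolding is_subring_def
proof (intro conjI ballI)
  have "poly 1 x \<in> adjoin R x" using assms unfolding adjoin_def by (fastforce simp: coeff_1)
  then show "1 \<in> adjoin R x" by simp
next
  fix a b assume "a \<in> adjoin R x" "b \<in> adjoin R x"
  then obtain P Q where PQ: "\<forall>i. coeff P i \<in> R" "\<forall>i. coeff Q i \<in> R" "a = poly P x" "b = poly Q x"
    by (auto simp: adjoin_def)
  have "poly (P - Q) x \<in> adjoin R x" unfolding adjoin_def
    using PQ assms by (intro CollectI exI[of _ "P - Q"]) (auto intro: subring_diff)
  then show "a - b \<in> adjoin R x" using PQ by simp
  have "poly (P * Q) x \<in> adjoin R x" unfolding adjoin_def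
    using PQ assms coeffs_in_mult by blast
  then show "a * b \<in> adjoin R x" using PQ by simp
qed

lemma adjoin_base: assumes "is_subring R" shows "R \<subseteq> adjoin R x"
proof
  fix a assume "a \<in> R"
  then have "poly [:a:] x \<in> adjoin R x" using assms unfolding adjoin_def
    by (intro CollectI exI[of _ "[:a:]"]) (auto simp: coeff_pCons split: nat.split)
  then show "a \<in> adjoin R x" by simp
qed

lemma adjoin_gen: assumes "is_subring R" shows "x \<in> adjoin R x"
proof -
  have "poly [:0, 1:] x \<in> adjoin R x" using assms unfolding adjoin_def
    by (intro CollectI exI[of _ "[:0,1:]"]) (auto simp: coeff_pCons split: nat.split)
  then show ?thesis by simp
qed

lemma adjoin_least:
  assumes "is_subring B" "R \<subseteq> B" "x \<in> B" shows "adjoin R x \<subseteq> B"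
  using assms by (auto simp: adjoin_def poly_altdef intro!: subring_sum subring_mult subring_power)

text \<open>Hilbert\<close>
lemma poly_values_submodule:
  assumes "is_subring R"
  shows "is_submodule R {poly P x | P. (\<forall>i. coeff P i \<in> R) \<and> (\<forall>i\<ge>n. coeff P i = 0)}" (is "is_submodule R ?T")
  unfolding is_submodule_def
proof (intro conjI ballI)
  show "0 \<in> ?T" using assms by (intro CollectI exI[of _ 0]) auto
next
  fix a b assume "a \<in> ?T" "b \<in> ?T"
  then obtain P Q where "\<forall>i. coeff P i \<in> R" "\<forall>i. coeff Q i \<in> R" "a = poly P x" "b = poly Q x"
    "\<forall>i\<ge>n. coeff P i = 0" "\<forall>i\<ge>n. coeff Q i = 0" by auto
  then show "a + b \<in> ?T" using assms
    by (intro CollectI exI[of _ "P + Q"]) (auto intro: subring_add)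
next
  fix r a assume "r \<in> R" "a \<in> ?T"
  then obtain P where "\<forall>i. coeff P i \<in> R" "a = poly P x" "\<forall>i\<ge>n. coeff P i = 0" by auto
  then show "r * a \<in> ?T" using assms \<open>r \<in> R\<close>
    by (intro CollectI exI[of _ "smult r P"]) (auto intro: subring_mult)
qed

text \<open>Hilbert's argument with leading coefficients works directly in \<open>R[x]\<close>, where \<open>x\<close> need not be
  transcendental: for an ideal \<open>L\<close> and each \<open>n\<close> take the ideal of all \<open>s \<in> R\<close> such that some element of \<open>L\<close>
  has the form \<open>s x\<^sup>n\<close> plus terms of lower degree. It does not matter that an element has several
  such presentations, since ideals \<open>L \<subseteq> L'\<close> with the same leading coefficients in all degrees agree
  by induction on the degree.\<close>
theorem noetherian_between_adjoin:
  assumes R: "is_subring R" and Z: "is_submodule R Z"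
    and noethR: "noetherian_between R R (Z \<inter> R)"
    and Zx: "\<And>s n. s \<in> Z \<inter> R \<Longrightarrow> s * x ^ n \<in> Z"
  shows "noetherian_between (adjoin R x) (adjoin R x) (Z \<inter> adjoin R x)"
  unfolding noetherian_between_def
proof (intro allI impI)
  fix f :: "nat \<Rightarrow> 'a set"
  let ?B = "adjoin R x"
  define T where "T n = {poly P x | P. (\<forall>i. coeff P i \<in> R) \<and> (\<forall>i\<ge>n. coeff P i = 0)}" for n
  assume "\<forall>n. is_submodule ?B (f n) \<and> Z \<inter> ?B \<subseteq> f n \<and> f n \<subseteq> ?B \<and> f n \<subseteq> f (Suc n)"
  then have f: "is_submodule ?B (f n)" "Z \<inter> ?B \<subseteq> f n" "f n \<subseteq> ?B" "f n \<subseteq> f (Suc n)" for n by auto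
  have B: "is_subring ?B" using adjoin_subring[OF R] .
  have xB: "x \<in> ?B" and RB: "R \<subseteq> ?B" using R by (auto intro: adjoin_gen subsetD[OF adjoin_base])
  have mono: "f m \<subseteq> f n" if "m \<le> n" for m n
    using lift_Suc_mono_le[of f, OF f(4) that] .
  have T: "is_submodule R (T n)" for n
    unfolding T_def by (rule poly_values_submodule[OF R])
  have TB: "T n \<subseteq> ?B" for n by (auto simp: T_def adjoin_def)
  have T_Suc: "x * t \<in> T (Suc n)" if t: "t \<in> T n" for t n
  proof -
    obtain P where "\<forall>i. coeff P i \<in> R" "t = poly P x" "\<forall>i\<ge>n. coeff P i = 0" using t by (auto simp: T_def)
    then show ?thesis using R unfolding T_def
      by (intro CollectI exI[of _ "pCons 0 P"]) (auto simp: coeff_pCons split: nat.split)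
  qed
  have T_split: "\<exists>t\<in>T n. \<exists>s\<in>R. a = t + s * x ^ n" if a: "a \<in> T (Suc n)" for a n
  proof -
    obtain P where P: "\<forall>i. coeff P i \<in> R" "a = poly P x" "\<forall>i\<ge>Suc n. coeff P i = 0" using a by (auto simp: T_def)
    let ?P = "P - monom (coeff P n) n"
    have "coeff ?P i = 0" if "n \<le> i" for i
      using P(3) that by (cases "i = n") auto
    moreover have "coeff ?P i \<in> R" for i
      using P(1) R by (auto intro: subring_diff)
    ultimately have "poly ?P x \<in> T n" unfolding T_def by blast
    moreover have "a = poly ?P x + coeff P n * x ^ n" using P by (simp add: poly_monom)
    ultimately show ?thesis using P by blast
  qed
  have T_all: "\<exists>n. a \<in> T n" if a: "a \<in> ?B" for a
  proof -
    obtain P where "\<forall>i. coeff P i \<in> R" "a = poly P x" using a by (auto simp: adjoin_def)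
    then show ?thesis unfolding T_def
      by (intro exI[of _ "Suc (degree P)"] CollectI exI[of _ P]) (auto intro: coeff_eq_0)
  qed
  define lead where "lead j n = {s \<in> R. \<exists>t\<in>T n. t + s * x ^ n \<in> f j}" for j n
  have lead_submodule: "is_submodule R (lead j n)" for j n
    unfolding lead_def by (rule coefficients_submodule[OF R T submodule_anti[OF f(1) RB]])
  have lead_Z: "Z \<inter> R \<subseteq> lead j n" for j n
  proof
    fix s assume s: "s \<in> Z \<inter> R"
    then have "s * x ^ n \<in> ?B" using RB xB B by (auto intro!: subring_mult subring_power)
    then have "0 + s * x ^ n \<in> f j" using Zx[OF s] f(2) by auto
    then show "s \<in> lead j n" using s submodule_0[OF T] unfolding lead_def by (intro CollectI conjI bexI[of _ 0]) auto
  qed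
  have lead_R: "lead j n \<subseteq> R" for j n by (auto simp: lead_def)
  have lead_mono1: "lead j n \<subseteq> lead j' n" if "j \<le> j'" for j j' n
    using mono[OF that] by (auto simp: lead_def)
  have lead_Suc: "lead j n \<subseteq> lead j (Suc n)" for j n
  proof
    fix s assume "s \<in> lead j n"
    then obtain t where t: "s \<in> R" "t \<in> T n" "t + s * x ^ n \<in> f j" by (auto simp: lead_def)
    then have "x * (t + s * x ^ n) \<in> f j" using submodule_mult[OF f(1) xB] by blast
    then have "x * t + s * x ^ Suc n \<in> f j" by (simp add: algebra_simps)
    then show "s \<in> lead j (Suc n)" using t T_Suc unfolding lead_def by blast
  qed
  have lead_mono2: "lead j n \<subseteq> lead j n'" if "n \<le> n'" for j n n'
    using lift_Suc_mono_le[of "lead j", OF lead_Suc that] .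
  have stab: "\<exists>a. \<forall>j\<ge>a. lead j n = lead a n" for n
    using noetherian_betweenD[OF noethR, of "\<lambda>j. lead j n"] lead_submodule lead_Z lead_R lead_mono1
    by (metis Suc_n_not_le_n linorder_le_cases)
  then obtain a where a: "\<And>n j. a n \<le> j \<Longrightarrow> lead j n = lead (a n) n" by metis
  have "lead j j \<subseteq> lead (Suc j) (Suc j)" for j
    using lead_mono1[of j "Suc j" j] lead_mono2[of j "Suc j" "Suc j"] by auto
  then obtain d where d: "\<And>j. d \<le> j \<Longrightarrow> lead j j = lead d d"
    using noetherian_betweenD[OF noethR, of "\<lambda>j. lead j j"] lead_submodule lead_Z lead_R by metis
  \<comment> \<open>From \<open>d\<close> on, the doubly indexed leading ideals are constant along the diagonal and hence for all
     \<open>n \<ge> d\<close>; the finitely many \<open>n < d\<close> are covered by the maximum of their own stopping times.\<close>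
  define c where "c = Max (insert d (a ` {..<d}))"
  have cd: "d \<le> c" by (simp add: c_def)
  have ca: "a n \<le> c" if "n < d" for n using that unfolding c_def by (intro Max_ge) auto
  have lead_eq: "lead j n = lead c n" if j: "c \<le> j" for j n
  proof (cases "n < d")
    case True
    then show ?thesis using a[of n j] a[of n c] ca[OF True] j by simp
  next
    case False
    have "lead i n = lead d d" if "d \<le> i" for i
      using lead_mono1[OF that, of d] lead_mono2[of d n i] False
        lead_mono1[of i "max i n" n] lead_mono2[of n "max i n" "max i n"] d[of "max i n"] that by fastforce
    then show ?thesis using j cd by simp
  qed
  have "a \<in> f c" if "a \<in> f j" "c \<le> j" "a \<in> T n" for a j n
    using that(1,3)
  proof (induction n arbitrary: a)
    case 0
    then obtain P where "a = poly P x" "\<forall>i. coeff P i = 0" by (auto simp: T_def)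
    then have "a = 0" by (simp add: poly_altdef)
    then show ?case using submodule_0[OF f(1)] by simp
  next
    case (Suc n)
    obtain t s where ts: "t \<in> T n" "s \<in> R" "a = t + s * x ^ n" using T_split[OF Suc.prems(2)] by blast
    then have "s \<in> lead c n" using Suc.prems(1) lead_eq[OF that(2), of n] unfolding lead_def by blast
    then obtain t' where t': "t' \<in> T n" "t' + s * x ^ n \<in> f c" by (auto simp: lead_def)
    have "a - (t' + s * x ^ n) \<in> f j"
      using Suc.prems t' mono[OF that(2)] submodule_diff[OF B f(1)] by blast
    then have "t - t' \<in> f j" using ts by simp
    then have "t - t' \<in> f c" using Suc.IH[of "t - t'"] submodule_diff[OF R T] ts t' by blast
    then have "(t - t') + (t' + s * x ^ n) \<in> f c" using t' f(1) submodule_add by blast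
    then show ?case using ts by simp
  qed
  then have "f j = f c" if "c \<le> j" for j
    using mono[OF that] that f(3) T_all by blast
  then show "\<exists>n. \<forall>m\<ge>n. f m = f n" by blast
qed

definition subring_gen :: "'r::comm_ring_1 set \<Rightarrow> 'r set" where
  "subring_gen G = \<Inter>{B. is_subring B \<and> G \<subseteq> B}"

lemma gen_subring: "is_subring (subring_gen G)"
  by (auto simp: is_subring_def subring_gen_def)

lemma gen_base: "x \<in> G \<Longrightarrow> x \<in> subring_gen G"
  by (auto simp: subring_gen_def)

lemma gen_least: "is_subring B \<Longrightarrow> G \<subseteq> B \<Longrightarrow> subring_gen G \<subseteq> B"
  by (auto simp: subring_gen_def)

lemma gen_mono: "G \<subseteq> H \<Longrightarrow> subring_gen G \<subseteq> subring_gen H"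
  by (auto simp: subring_gen_def)

lemma gen_adjoin:
  assumes "is_subring R" shows "subring_gen (adjoin R x \<union> G) = subring_gen (R \<union> insert x G)"
proof (rule antisym)
  have "R \<union> insert x G \<subseteq> subring_gen (R \<union> insert x G)" by (intro subsetI gen_base)
  then have "adjoin R x \<subseteq> subring_gen (R \<union> insert x G)"
    by (intro adjoin_least[OF gen_subring]) auto
  then show "subring_gen (adjoin R x \<union> G) \<subseteq> subring_gen (R \<union> insert x G)"
    by (intro gen_least[OF gen_subring]) (auto intro: gen_base)
  show "subring_gen (R \<union> insert x G) \<subseteq> subring_gen (adjoin R x \<union> G)"
    using adjoin_base[OF assms] adjoin_gen[OF assms] by (intro gen_mono) auto
qed

lemma gen_id: "is_subring R \<Longrightarrow> subring_gen R = R"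
  by (intro antisym gen_least subsetI gen_base) auto

text \<open>Here \<open>Z\<close> is an ideal of the ambient ring, so that it remains an ideal of every subring
  obtained on the way.\<close>
lemma noetherian_between_gen:
  assumes "finite G" "is_subring R" "is_ideal Z" "Z \<subseteq> R" "noetherian_between R R Z"
  shows "noetherian_between (subring_gen (R \<union> G)) (subring_gen (R \<union> G)) Z"
  using assms
proof (induction G arbitrary: R rule: finite_induct)
  case empty
  then show ?case by (simp add: gen_id)
next
  case (insert x G)
  note R = insert.prems(1) and Z = insert.prems(2)
  have Z_adjoin: "Z \<subseteq> adjoin R x"
    using insert.prems(3) adjoin_base[OF R] by blast
  have *: "Z \<inter> R = Z" "Z \<inter> adjoin R x = Z"
    using insert.prems(3) Z_adjoin by auto
  have "s * x ^ n \<in> Z" if "s \<in> Z \<inter> R" for s n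
    using submodule_mult[OF Z UNIV_I, of s "x ^ n"] that by (simp add: mult.commute)
  then have "noetherian_between (adjoin R x) (adjoin R x) Z"
    using noetherian_between_adjoin[OF R submodule_anti[OF Z subset_UNIV], of x] insert.prems(4)
    unfolding * by blast
  then have "noetherian_between (subring_gen (adjoin R x \<union> G)) (subring_gen (adjoin R x \<union> G)) Z"
    by (rule insert.IH[OF adjoin_subring[OF R] Z Z_adjoin])
  then show ?case unfolding gen_adjoin[OF R] .
qed

section \<open>Zariski's lemma over a Noetherian base\<close>

lemma poly_eq_sum_atMost:
  fixes P :: "'r::comm_ring_1 poly"
  assumes "\<forall>k>n. coeff P k = 0" shows "poly P x = (\<Sum>k\<le>n. coeff P k * x ^ k)"
proof -
  have "degree P \<le> n" using assms by (intro degree_le) auto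
  then have "(\<Sum>k\<le>n. coeff P k * x ^ k) = (\<Sum>k\<le>degree P. coeff P k * x ^ k)"
    by (intro sum.mono_neutral_right) (auto intro: le_degree)
  then show ?thesis by (simp only: poly_altdef)
qed

text \<open>The elements that lie in \<open>W\<close> after inverting \<open>c\<close>; a way to speak about localisations without
  constructing them.\<close>
definition saturation :: "'r::comm_ring_1 \<Rightarrow> 'r set \<Rightarrow> 'r set" where
  "saturation c W = {a. \<exists>e. c ^ e * a \<in> W}"

lemma saturation_base: "W \<subseteq> saturation c W"
  by (auto simp: saturation_def intro: exI[of _ 0])

lemma saturation_cancel:
  assumes "c ^ e * a \<in> saturation c W" shows "a \<in> saturation c W"
proof -
  obtain f where "c ^ f * (c ^ e * a) \<in> W" using assms by (auto simp: saturation_def)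
  then have "c ^ (f + e) * a \<in> W" by (simp add: power_add mult.assoc)
  then show ?thesis by (auto simp: saturation_def)
qed

lemma saturation_submodule:
  assumes "is_submodule R W" "is_subring R" "c \<in> R"
  shows "is_submodule R (saturation c W)"
  unfolding is_submodule_def
proof (intro conjI ballI)
  show "0 \<in> saturation c W" using saturation_base assms by fastforce
next
  fix a b assume "a \<in> saturation c W" "b \<in> saturation c W"
  then obtain e f where "c ^ e * a \<in> W" "c ^ f * b \<in> W" by (auto simp: saturation_def)
  then have "c ^ f * (c ^ e * a) + c ^ e * (c ^ f * b) \<in> W"
    using submodule_add[OF assms(1)] submodule_mult[OF assms(1)] subring_power[OF assms(2,3)] by simp
  then have "c ^ (e + f) * (a + b) \<in> W" by (simp add: algebra_simps power_add)
  then show "a + b \<in> saturation c W" unfolding saturation_def by blast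
next
  fix r a assume "r \<in> R" "a \<in> saturation c W"
  then obtain e where "c ^ e * a \<in> W" by (auto simp: saturation_def)
  then have "r * (c ^ e * a) \<in> W" using assms \<open>r \<in> R\<close> submodule_mult by blast
  then show "r * a \<in> saturation c W" unfolding saturation_def
    by (auto simp: algebra_simps intro!: exI[of _ e])
qed

lemma span_over_subset:
  assumes "is_submodule R' M" "Q \<subseteq> M" "\<And>w s. w \<in> set ws \<Longrightarrow> s \<in> R \<Longrightarrow> s * w \<in> M"
  shows "span_over R Q ws \<subseteq> M"
  using assms(3) by (induction ws) (use assms in \<open>auto intro!: submodule_add\<close>)

text \<open>The domain under study is \<open>E/q\<close>. Equality in it is written as membership of a difference in \<open>q\<close>.\<close>
locale prime_ideal_of =
  fixes E q :: "'r::comm_ring_1 set"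
  assumes E: "is_subring E"
    and q: "is_submodule E q" "q \<subseteq> E"
    and one_notin: "1 \<notin> q"
    and prime: "x \<in> E \<Longrightarrow> y \<in> E \<Longrightarrow> x * y \<in> q \<Longrightarrow> x \<in> q \<or> y \<in> q"
begin

lemma q_mult1: "x \<in> q \<Longrightarrow> y \<in> E \<Longrightarrow> x * y \<in> q"
  and q_mult2: "x \<in> q \<Longrightarrow> y \<in> E \<Longrightarrow> y * x \<in> q"
  using submodule_mult[OF q(1), of y x] by (simp_all add: mult.commute)

lemma q_add: "x \<in> q \<Longrightarrow> y \<in> q \<Longrightarrow> x + y \<in> q"
  using submodule_add[OF q(1)] .

lemma q_diff: "x \<in> q \<Longrightarrow> y \<in> q \<Longrightarrow> x - y \<in> q"
  using submodule_diff[OF E q(1)] .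

lemma q_uminus: "x \<in> q \<Longrightarrow> - x \<in> q"
  using submodule_uminus[OF E q(1)] .

lemma q_uminus_iff: "- x \<in> q \<longleftrightarrow> x \<in> q"
  using q_uminus[of x] q_uminus[of "- x"] by auto

lemma q_power: "x \<in> E \<Longrightarrow> x \<notin> q \<Longrightarrow> x ^ n \<notin> q"
  by (induction n) (use one_notin prime subring_power[OF E] in auto)

lemma q_power_cong:
  assumes "a \<in> E" "b \<in> E" "a - b \<in> q" shows "a ^ n - b ^ n \<in> q"
proof (induction n)
  case (Suc n)
  have "a ^ Suc n - b ^ Suc n = a * (a ^ n - b ^ n) + (a - b) * b ^ n" by (simp add: algebra_simps)
  moreover have "a * (a ^ n - b ^ n) \<in> q" using q_mult2[OF Suc assms(1)] .
  moreover have "(a - b) * b ^ n \<in> q" using q_mult1[OF assms(3) subring_power[OF E assms(2)]] .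
  ultimately show ?case using q_add by (simp only:)
qed (use q in simp)

lemma poly_in: "R \<subseteq> E \<Longrightarrow> \<forall>i. coeff P i \<in> R \<Longrightarrow> b \<in> E \<Longrightarrow> poly P b \<in> E"
  unfolding poly_altdef using E by (intro subring_sum subring_mult subring_power) auto

text \<open>Terms whose leading coefficient vanishes modulo \<open>q\<close> can be dropped until the leading coefficient is
  nonzero in the domain.\<close>
lemma leading_coeff_outside:
  assumes R: "is_subring R" "R \<subseteq> E" and x: "x \<in> E" and p: "p \<in> adjoin R x" "p \<notin> q"
  obtains P k where "\<forall>i. coeff P i \<in> R" "coeff P k \<notin> q" "\<forall>i>k. coeff P i = 0" "p - poly P x \<in> q"
proof -
  have "\<exists>P k. (\<forall>i. coeff P i \<in> R) \<and> coeff P k \<notin> q \<and> (\<forall>i>k. coeff P i = 0) \<and> p - poly P x \<in> q"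
    if "\<forall>i. coeff P i \<in> R" "\<forall>i\<ge>n. coeff P i = 0" "p - poly P x \<in> q" for P n
    using that
  proof (induction n arbitrary: P)
    case 0
    then have "poly P x = 0" by (simp add: poly_altdef)
    then show ?case using 0 p by simp
  next
    case (Suc n)
    show ?case
    proof (cases "coeff P n \<in> q")
      case True
      let ?P = "P - monom (coeff P n) n"
      have "p - poly ?P x = (p - poly P x) + coeff P n * x ^ n" by (simp add: poly_monom)
      moreover have "coeff P n * x ^ n \<in> q" using q_mult1[OF True subring_power[OF E x]] .
      ultimately have "p - poly ?P x \<in> q" using Suc.prems(3) q_add by (simp only:)
      moreover have "\<forall>i. coeff ?P i \<in> R" using Suc.prems(1) R by (auto intro: subring_diff)
      moreover have "\<forall>i\<ge>n. coeff ?P i = 0"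
      proof (intro allI impI)
        fix i assume "n \<le> i"
        then show "coeff ?P i = 0" using Suc.prems(2) by (cases "i = n") auto
      qed
      ultimately show ?thesis using Suc.IH by blast
    next
      case False
      then show ?thesis using Suc.prems by (metis Suc_leI)
    qed
  qed
  moreover obtain P where "\<forall>i. coeff P i \<in> R" "p = poly P x" using p by (auto simp: adjoin_def)
  ultimately show ?thesis using that q(1) coeff_eq_0[of P] by (metis Suc_le_lessD diff_self submodule_0)
qed

text \<open>A nonzero algebraic element of a domain divides a nonzero constant: divide its equation by the
  largest power of the element that occurs in it, and isolate the constant term.\<close>
lemma divides_nonzero_constant:
  assumes R: "is_subring R" "R \<subseteq> E" and B: "is_subring B" "R \<subseteq> B" "B \<subseteq> E"
    and t: "t \<in> B" "t \<notin> q"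
    and Q: "\<forall>i. coeff Q i \<in> R" "coeff Q k \<notin> q" "poly Q t \<in> q"
  shows "\<exists>d\<in>R - q. \<exists>w\<in>B. t * w - d \<in> q"
  using Q
proof (induction Q arbitrary: k)
  case 0
  then show ?case using q(1) by simp
next
  case (pCons a Q)
  have a: "a \<in> R" using pCons.prems(1)[rule_format, of 0] by simp
  have Q: "\<forall>i. coeff Q i \<in> R" using pCons.prems(1) by (metis coeff_pCons_Suc)
  have Qt: "poly Q t \<in> B" using Q B t by (auto simp: poly_altdef intro!: subring_sum subring_mult subring_power)
  show ?case
  proof (cases "a \<in> q")
    case True
    have "t * poly Q t = poly (pCons a Q) t - a" by simp
    then have "t * poly Q t \<in> q" using True pCons.prems(3) q_diff by metis
    then have "poly Q t \<in> q" using prime t Qt B by blast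
    moreover obtain k' where "k = Suc k'" using True pCons.prems(2) by (cases k) auto
    ultimately show ?thesis using pCons.IH Q pCons.prems(2) by simp
  next
    case False
    have "t * poly Q t - (- a) \<in> q" using pCons.prems(3) by (simp add: algebra_simps)
    moreover have "- a \<in> R - q" using False a R q_uminus_iff by (auto intro: subring_uminus)
    ultimately show ?thesis using Qt by blast
  qed
qed

end

text \<open>The subring \<open>B\<close> becomes, modulo \<open>q\<close>, part of a finite \<open>R\<close>-module once \<open>c\<close> is inverted. The
  consequences below usually come from determinants; here they follow from the chain condition in the
  module \<open>span_over R q ws\<close>.\<close>
locale generically_finite = prime_ideal_of +
  fixes R B :: "'r::comm_ring_1 set" and c ws
  assumes R: "is_subring R" and noeth: "noetherian_between R R (q \<inter> R)"
    and B: "is_subring B" "R \<subseteq> B" "B \<subseteq> E"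
    and c: "c \<in> R" "c \<notin> q"
    and ws: "set ws \<subseteq> E"
    and fin: "B \<subseteq> saturation c (span_over R q ws)"
begin

text \<open>The submodules generated by \<open>1, b, \<dots>, b\<^sup>i\<close>, saturated at \<open>c\<close>, increase with \<open>i\<close>; where the
  chain stops, a power of \<open>c\<close> times \<open>b\<^sup>i\<^sup>+\<^sup>1\<close> is a combination of the lower powers. It matters later that the
  leading coefficient is a power of \<open>c\<close>.\<close>
lemma algebraic_relation:
  assumes b: "b \<in> B"
  obtains e i P where "\<forall>k. coeff P k \<in> R" "\<forall>k>i. coeff P k = 0" "c ^ e * b ^ Suc i - poly P b \<in> q"
proof -
  let ?W = "span_over R q ws"
  have qR: "is_submodule R q" using submodule_anti[OF q(1)] B by blast
  have W: "is_submodule R ?W" "q \<subseteq> ?W"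
    using span_over_submodule[OF R qR] span_over_base[OF R] by auto
  let ?V = "\<lambda>i. {poly P b | P. (\<forall>k. coeff P k \<in> R) \<and> (\<forall>k\<ge>Suc i. coeff P k = 0)}"
  define M where "M i = {v + z | v z. v \<in> ?V i \<and> z \<in> q}" for i
  have M: "is_submodule R (M i)" for i
    unfolding M_def by (rule submodule_plus[OF poly_values_submodule[OF R] qR])
  have V0: "0 \<in> ?V i" for i using submodule_0[OF poly_values_submodule[OF R]] .
  have qM: "q \<subseteq> M i" for i
  proof
    fix z assume "z \<in> q"
    then have "0 + z \<in> M i" unfolding M_def using V0[of i] by blast
    then show "z \<in> M i" by simp
  qed
  have M_mono: "M i \<subseteq> M (Suc i)" for i
    unfolding M_def by fastforce
  define f where "f i = ?W \<inter> saturation c (M i)" for i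
  obtain n where n: "\<And>m. n \<le> m \<Longrightarrow> f m = f n"
  proof (rule noetherian_betweenD[of R ?W q f])
    show "noetherian_between R ?W q"
      using noetherian_between_span[OF R qR noeth] ws q_mult1 by blast
    show "is_submodule R (f n)" for n
      unfolding f_def using submodule_Int[OF W(1) saturation_submodule[OF M R c(1)]] .
    show "q \<subseteq> f n" for n
      unfolding f_def using W qM saturation_base by blast
    show "f n \<subseteq> f (Suc n)" for n
      using M_mono[of n] unfolding f_def saturation_def by auto
  qed (auto simp: f_def)
  obtain e where e: "c ^ e * b ^ Suc n \<in> ?W"
    using fin subring_power[OF B(1) b, of "Suc n"] by (auto simp: saturation_def)
  have "c ^ e * b ^ Suc n = poly (monom (c ^ e) (Suc n)) b + 0" by (simp add: poly_monom)
  moreover have "poly (monom (c ^ e) (Suc n)) b \<in> ?V (Suc n)"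
    using R c by (intro CollectI exI[of _ "monom (c ^ e) (Suc n)"]) (auto intro: subring_power)
  ultimately have "c ^ e * b ^ Suc n \<in> M (Suc n)"
    unfolding M_def using submodule_0[OF q(1)] by blast
  then have "c ^ e * b ^ Suc n \<in> f (Suc n)" using e saturation_base unfolding f_def by blast
  then have "c ^ e * b ^ Suc n \<in> saturation c (M n)" using n[of "Suc n"] unfolding f_def by auto
  then obtain e' where "c ^ e' * (c ^ e * b ^ Suc n) \<in> M n" unfolding saturation_def by blast
  then obtain P z where P: "c ^ e' * (c ^ e * b ^ Suc n) = poly P b + z"
     "\<forall>k. coeff P k \<in> R" "\<forall>k\<ge>Suc n. coeff P k = 0" "z \<in> q"
    unfolding M_def by blast
  have "c ^ (e' + e) * b ^ Suc n - poly P b \<in> q" using P by (simp add: power_add mult.assoc)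
  then show ?thesis using that[of P n "e' + e"] P(2,3) by (simp add: Suc_le_eq)
qed

text \<open>If \<open>y \<in> R\<close> divides \<open>h \<in> R\<close> in \<open>B\<close>, then it divides a power of \<open>h\<close> in \<open>R\<close>, up to a power of
  \<open>c\<close>: insert \<open>g = h/y\<close> into its equation and clear the denominators \<open>y\<close>. For a field \<open>B\<close> this makes a
  localisation of \<open>R\<close> a field.\<close>
lemma unit_descends:
  assumes y: "y \<in> R" and h: "h \<in> R" and g: "g \<in> B" and ygh: "y * g - h \<in> q"
  shows "\<exists>r\<in>R. \<exists>e i. y * r - c ^ e * h ^ Suc i \<in> q"
proof -
  obtain e i P where P: "\<forall>k. coeff P k \<in> R" "\<forall>k>i. coeff P k = 0" "c ^ e * g ^ Suc i - poly P g \<in> q"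
    by (rule algebraic_relation[OF g])
  have RE: "R \<subseteq> E" using B by auto
  have gE: "g \<in> E" "y \<in> E" "h \<in> E" "c \<in> E" using g B y h c by auto
  define r where "r = (\<Sum>k\<le>i. coeff P k * (y ^ (i - k) * h ^ k))"
  have pg: "poly P g = (\<Sum>k\<le>i. coeff P k * g ^ k)"
    by (rule poly_eq_sum_atMost[OF P(2)])
  have "y * r - y ^ Suc i * poly P g
      = (\<Sum>k\<le>i. y * (coeff P k * (y ^ (i - k) * h ^ k)) - y ^ Suc i * (coeff P k * g ^ k))"
    unfolding r_def pg by (simp add: sum_distrib_left sum_subtractf)
  also have "\<dots> = (\<Sum>k\<le>i. y * coeff P k * y ^ (i - k) * (h ^ k - (y * g) ^ k))"
  proof (intro sum.cong refl)
    fix k assume "k \<in> {..i}"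
    then have "y ^ i = y ^ (i - k) * y ^ k" by (simp flip: power_add)
    then have "y ^ Suc i = y * y ^ (i - k) * y ^ k" by simp
    then show "y * (coeff P k * (y ^ (i - k) * h ^ k)) - y ^ Suc i * (coeff P k * g ^ k)
       = y * coeff P k * y ^ (i - k) * (h ^ k - (y * g) ^ k)"
      by (simp add: algebra_simps power_mult_distrib)
  qed
  also have "\<dots> \<in> q"
  proof (intro submodule_sum[OF q(1)] q_mult2)
    fix k
    show "h ^ k - (y * g) ^ k \<in> q"
      using q_power_cong[of "y * g" h k] gE ygh E q_uminus[of "(y * g) ^ k - h ^ k"]
      by (auto intro: subring_mult)
    show "y * coeff P k * y ^ (i - k) \<in> E"
      using gE E P(1) RE by (intro subring_mult subring_power) auto
  qed
  finally have 1: "y * r - y ^ Suc i * poly P g \<in> q" .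
  have 2: "y ^ Suc i * (c ^ e * g ^ Suc i - poly P g) \<in> q"
    using P(3) gE E by (intro q_mult2 subring_power)
  have 3: "c ^ e * ((y * g) ^ Suc i - h ^ Suc i) \<in> q"
    using gE E ygh by (intro q_mult2 subring_power q_power_cong subring_mult)
  have "y * r - c ^ e * h ^ Suc i = (y * r - y ^ Suc i * poly P g)
     - y ^ Suc i * (c ^ e * g ^ Suc i - poly P g) + c ^ e * ((y * g) ^ Suc i - h ^ Suc i)"
    by (simp add: algebra_simps power_mult_distrib)
  then have "y * r - c ^ e * h ^ Suc i \<in> q" using q_add[OF q_diff[OF 1 2] 3] by (simp only:)
  moreover have "r \<in> R" unfolding r_def
    using R P y h by (intro subring_sum subring_mult subring_power) auto
  ultimately show ?thesis by blast
qed

lemma divides_constant: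
  assumes t: "t \<in> B" "t \<notin> q"
  shows "\<exists>d\<in>R - q. \<exists>w\<in>B. t * w - d \<in> q"
proof -
  obtain e i P where P: "\<forall>k. coeff P k \<in> R" "\<forall>k>i. coeff P k = 0" "c ^ e * t ^ Suc i - poly P t \<in> q"
    by (rule algebraic_relation[OF t(1)])
  let ?Q = "monom (c ^ e) (Suc i) - P"
  have "\<forall>k. coeff ?Q k \<in> R" using P R c by (auto intro: subring_diff subring_power subring_uminus)
  moreover have "coeff ?Q (Suc i) \<notin> q" using P c q_power[of c e] B by auto
  moreover have "poly ?Q t \<in> q" using P by (simp add: poly_monom)
  ultimately show ?thesis using divides_nonzero_constant R B t by (meson order_trans)
qed

end

context prime_ideal_of
begin

text \<open>After inverting the leading coefficient, the equation of \<open>x\<close> reduces every power of \<open>x\<close> to those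
  below \<open>k\<close>.\<close>
lemma adjoin_generically_finite:
  assumes R: "is_subring R" "R \<subseteq> E" and x: "x \<in> E"
    and P: "\<forall>i. coeff P i \<in> R" "\<forall>i>k. coeff P i = 0" "poly P x \<in> q"
  shows "adjoin R x \<subseteq> saturation (coeff P k) (span_over R q (map (\<lambda>i. x ^ i) [0..<k]))" (is "_ \<subseteq> ?S")
proof -
  let ?W = "span_over R q (map (\<lambda>i. x ^ i) [0..<k])" and ?c = "coeff P k"
  have qR: "is_submodule R q" using submodule_anti[OF q(1)] R by blast
  have S: "is_submodule R ?S" using saturation_submodule[OF span_over_submodule[OF R(1) qR] R(1)] P by blast
  have "x ^ n \<in> ?S" for n
  proof (induction n rule: less_induct)
    case (less n)
    show ?case
    proof (cases "n < k")
      case True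
      then have "x ^ n \<in> ?W" using span_over_mem[OF R(1) qR] by auto
      then show ?thesis using saturation_base by blast
    next
      case False
      have "poly P x = (\<Sum>i\<le>k. coeff P i * x ^ i)"
        by (rule poly_eq_sum_atMost[OF P(2)])
      also have "\<dots> = ?c * x ^ k + (\<Sum>i<k. coeff P i * x ^ i)"
        by (simp add: lessThan_Suc_atMost[symmetric])
      finally have "?c * x ^ n = poly P x * x ^ (n - k) - (\<Sum>i<k. coeff P i * x ^ i) * x ^ (n - k)"
        using False by (simp add: algebra_simps power_add[symmetric])
      also have "\<dots> = poly P x * x ^ (n - k) - (\<Sum>i<k. coeff P i * x ^ (i + (n - k)))"
        by (simp add: sum_distrib_right power_add mult.assoc)
      also have "\<dots> \<in> ?S"
      proof (rule submodule_diff[OF R(1) S])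
        show "poly P x * x ^ (n - k) \<in> ?S"
          using q_mult1[OF P(3) subring_power[OF E x]] span_over_base[OF R(1)] saturation_base by blast
        show "(\<Sum>i<k. coeff P i * x ^ (i + (n - k))) \<in> ?S"
          using P False less by (intro submodule_sum[OF S] submodule_mult[OF S]) auto
      qed
      finally show ?thesis using saturation_cancel[of ?c 1] by simp
    qed
  qed
  then show ?thesis unfolding adjoin_def poly_altdef
    by (auto intro!: submodule_sum[OF S] submodule_mult[OF S])
qed

text \<open>Zariski's lemma in relative form. The hypothesis on \<open>E\<close> says that \<open>E/q\<close> becomes a field once the
  positive integers are inverted. The conclusion gives one \<open>t\<close> in the base such that, after inverting
  \<open>t\<close>, the extension is a finite module and, inverting also the positive integers, the base is itself a
  field. The second part is what the induction needs: adjoining the generators one by one, it is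
  used for the intermediate base \<open>R[x]\<close> to see that \<open>x\<close> is algebraic over \<open>R\<close>.\<close>
theorem zariski:
  assumes "is_subring R" "noetherian_between R R (q \<inter> R)" "E = subring_gen (R \<union> set xs)"
    and int_mult: "\<And>y. y \<in> E \<Longrightarrow> y \<notin> q \<Longrightarrow> \<exists>g\<in>E. \<exists>n>0. y * g - of_nat n \<in> q"
    and int_notin: "\<And>n. 0 < n \<Longrightarrow> of_nat n \<notin> q"
  shows "\<exists>t\<in>R - q. \<exists>ws. set ws \<subseteq> E \<and> E \<subseteq> saturation t (span_over R q ws) \<and>
           (\<forall>y\<in>R - q. \<exists>g\<in>R. \<exists>n>0. \<exists>j. y * g - of_nat n * t ^ j \<in> q)"
  using assms(1-3)
proof (induction xs arbitrary: R)
  case Nil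
  then have ER: "E = R" by (simp add: gen_id)
  have qR: "is_submodule R q" using q ER by simp
  have "a = 0 + a * 1 \<and> 0 \<in> q" for a :: 'r using q by simp
  then have "R \<subseteq> span_over R q [1]" unfolding span_over.simps by blast
  then have "E \<subseteq> saturation 1 (span_over R q [1])" using saturation_base ER by blast
  moreover have "\<forall>y\<in>R - q. \<exists>g\<in>R. \<exists>n>0. \<exists>j. y * g - of_nat n * 1 ^ j \<in> q"
    using int_mult ER by simp
  moreover have "1 \<in> R - q" "set [1] \<subseteq> E" using one_notin Nil E by auto
  ultimately show ?case by blast
next
  case (Cons x xs)
  note R = Cons.prems(1)
  let ?B = "adjoin R x"
  have RE: "R \<subseteq> E" and x: "x \<in> E" using Cons.prems(3) by (auto intro: gen_base)
  have qR: "is_submodule R q" using submodule_anti[OF q(1) RE] .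
  have B: "is_subring ?B" "R \<subseteq> ?B" "?B \<subseteq> E" "x \<in> ?B"
    using adjoin_least[OF E RE x] adjoin_subring[OF R] adjoin_base[OF R] adjoin_gen[OF R] by auto
  have qB: "is_submodule ?B q" using submodule_anti[OF q(1) B(3)] .
  have noethB: "noetherian_between ?B ?B (q \<inter> ?B)"
    using x E by (intro noetherian_between_adjoin[OF R qR Cons.prems(2)]) (auto intro!: q_mult1 subring_power)
  have EB: "E = subring_gen (?B \<union> set xs)" using gen_adjoin[OF R] Cons.prems(3) by simp
  obtain t vs where t: "t \<in> ?B" "t \<notin> q" and vs: "set vs \<subseteq> E" "E \<subseteq> saturation t (span_over ?B q vs)"
    and field: "\<And>y. y \<in> ?B \<Longrightarrow> y \<notin> q \<Longrightarrow> \<exists>g\<in>?B. \<exists>n>0. \<exists>j. y * g - of_nat n * t ^ j \<in> q"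
    using Cons.IH[OF B(1) noethB EB] by blast
  have tE: "t \<in> E" using t B by auto
  \<comment> \<open>To see that \<open>x\<close> is algebraic over \<open>R\<close>: as \<open>1 + x t\<close> is prime to \<open>t\<close> but divides an integer times a power
     of \<open>t\<close>, it divides a constant. Written out as polynomials in \<open>x\<close>, this is a nontrivial equation,
     because \<open>1 + x t\<close> has positive degree for every nonzero \<open>t\<close>.\<close>
  have "\<exists>h\<in>?B - q. \<exists>C\<in>R. (1 + x * t) * h - C \<in> q"
  proof (cases "1 + x * t \<in> q")
    case True
    then show ?thesis using one_notin B R by (intro bexI[of _ 1] bexI[of _ 0]) auto
  next
    case False
    have yB: "1 + x * t \<in> ?B" using B t by (auto intro!: subring_add subring_mult)
    then obtain g n j where g: "g \<in> ?B" "0 < n" "(1 + x * t) * g - of_nat n * t ^ j \<in> q"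
      using field False by blast
    obtain w where w: "w \<in> ?B" "(- (x * t)) ^ j = 1 + (1 + x * t) * w"
    proof -
      have "\<exists>w\<in>?B. (- (x * t)) ^ j = 1 + (1 + x * t) * w"
      proof (induction j)
        case 0
        then show ?case using B by (auto intro!: bexI[of _ 0])
      next
        case (Suc j)
        then obtain w where w: "w \<in> ?B" "(- (x * t)) ^ j = 1 + (1 + x * t) * w" by blast
        then have "(- (x * t)) ^ Suc j = 1 + (1 + x * t) * (- 1 - (x * t) * w)" 
          by (simp add: algebra_simps)
        then show ?case using w B t by (intro bexI[of _ "- 1 - (x * t) * w"])
            (auto intro!: subring_diff subring_mult subring_uminus)
      qed
      then show ?thesis using that by blast
    qed
    define h where "h = (- x) ^ j * g - of_nat n * w"
    have "(1 + x * t) * h - of_nat n = (- x) ^ j * ((1 + x * t) * g - of_nat n * t ^ j)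
        + of_nat n * ((- x) ^ j * t ^ j - 1 - (1 + x * t) * w)"
      unfolding h_def by (simp add: algebra_simps)
    also have "(- x) ^ j * t ^ j = (- (x * t)) ^ j" by (simp add: power_mult_distrib[symmetric])
    finally have eq: "(1 + x * t) * h - of_nat n = (- x) ^ j * ((1 + x * t) * g - of_nat n * t ^ j)"
      using w by simp
    have hq: "(1 + x * t) * h - of_nat n \<in> q"
      unfolding eq using g(3) x E by (intro q_mult2 subring_power subring_uminus)
    have hB: "h \<in> ?B" unfolding h_def using g w B
      by (intro subring_diff subring_mult subring_power) (auto intro: subring_uminus)
    have "h \<notin> q"
    proof
      assume "h \<in> q"
      then have "(1 + x * t) * h - ((1 + x * t) * h - of_nat n) \<in> q"
        using yB B by (intro q_diff[OF q_mult2[OF \<open>h \<in> q\<close>] hq]) auto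
      then show False using int_notin g by simp
    qed
    then show ?thesis using hq hB R by (meson DiffI subring_of_nat)
  qed
  then obtain h C where h: "h \<in> ?B" "h \<notin> q" "C \<in> R" "(1 + x * t) * h - C \<in> q" by blast
  obtain P k where P: "\<forall>i. coeff P i \<in> R" "coeff P k \<notin> q" "\<forall>i>k. coeff P i = 0" "t - poly P x \<in> q"
    by (rule leading_coeff_outside[OF R RE x t])
  obtain H l where H: "\<forall>i. coeff H i \<in> R" "coeff H l \<notin> q" "\<forall>i>l. coeff H i = 0" "h - poly H x \<in> q"
    by (rule leading_coeff_outside[OF R RE x h(1,2)])
  define F where "F = (1 + pCons 0 P) * H - [:C:]"
  have cF: "\<forall>i. coeff F i \<in> R"
  proof -
    have "\<forall>i. coeff (1 + pCons 0 P) i \<in> R" using P(1) R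
      by (auto simp: coeff_1 coeff_pCons split: nat.split intro!: subring_add)
    moreover have "\<forall>i. coeff [:C:] i \<in> R" using h R by (auto simp: coeff_pCons split: nat.split)
    ultimately show ?thesis unfolding F_def
      using coeffs_in_mult[OF R, of "1 + pCons 0 P" H] H(1) R by (auto intro!: subring_diff)
  qed
  have ne0: "coeff P k \<noteq> 0" "coeff H l \<noteq> 0"
    using P(2) H(2) submodule_0[OF q(1)] by metis+
  have degP: "degree P = k" "degree H = l"
    using P(3) H(3) ne0 by (auto intro!: antisym degree_le le_degree)
  have deg1: "degree (1 + pCons 0 P) = Suc k"
    using degP ne0 by (subst degree_add_eq_right) auto
  have cF1: "coeff F (Suc k + l) = coeff P k * coeff H l"
  proof -
    have "coeff ((1 + pCons 0 P) * H) (degree (1 + pCons 0 P) + degree H) = coeff P k * coeff H l"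
      unfolding coeff_mult_degree_sum using deg1 degP by simp
    then show ?thesis unfolding F_def deg1 degP(2) by simp
  qed
  have cF0: "\<forall>i>Suc k + l. coeff F i = 0"
  proof (intro allI impI)
    fix i assume i: "Suc k + l < i"
    then have "coeff ((1 + pCons 0 P) * H) i = 0"
      using degree_mult_le[of "1 + pCons 0 P" H] deg1 degP(2) by (intro coeff_eq_0) linarith
    then show "coeff F i = 0" unfolding F_def using i by (cases i) auto
  qed
  have PxE: "poly P x \<in> E" "poly H x \<in> E" "t \<in> E" "h \<in> E"
    using poly_in[OF RE P(1) x] poly_in[OF RE H(1) x] t(1) h(1) B(3) by auto
  have Fx: "poly F x \<in> q"
  proof -
    have "poly F x = ((1 + x * t) * h - C) - (1 + x * poly P x) * (h - poly H x) - (x * (t - poly P x)) * h"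
      unfolding F_def by (simp add: algebra_simps)
    moreover have "(1 + x * poly P x) * (h - poly H x) \<in> q"
      using PxE x E H(4) by (intro q_mult2 subring_add subring_mult subring_1)
    moreover have "(x * (t - poly P x)) * h \<in> q"
      by (intro q_mult1[OF q_mult2[OF P(4) x]] PxE)
    ultimately show ?thesis using h(4) q_diff by metis
  qed
  define c where "c = coeff F (Suc k + l)"
  have "coeff P k \<in> E" "coeff H l \<in> E" using P(1) H(1) RE by (simp_all add: subset_iff)
  then have c: "c \<in> R" "c \<notin> q"
    using cF[rule_format, of "Suc k + l"] P(2) H(2) prime[of "coeff P k" "coeff H l"]
    unfolding c_def cF1 by auto
  define us where "us = map (\<lambda>i. x ^ i) [0..<Suc k + l]"
  have usE: "set us \<subseteq> E" unfolding us_def using x E by (auto intro: subring_power)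
  have finB: "?B \<subseteq> saturation c (span_over R q us)"
    unfolding c_def us_def by (rule adjoin_generically_finite[OF R RE x cF cF0 Fx])
  interpret gf: generically_finite E q R ?B c us
    by unfold_locales (use R Cons.prems(2) B c usE finB in auto)
  obtain d w where d: "d \<in> R" "d \<notin> q" and w: "w \<in> ?B" "t * w - d \<in> q"
    using gf.divides_constant[OF t] by blast
  have wE: "w \<in> E" "d \<in> E" "c \<in> E" using w B d RE c by auto
  have cong: "(t * w) ^ e - d ^ e \<in> q" for e
    using q_power_cong[OF _ _ w(2)] tE wE E by (auto intro: subring_mult)
  \<comment> \<open>Inverting \<open>d\<close> inverts \<open>t\<close>, and inverting \<open>c\<close> makes \<open>R[x]\<close> finite over \<open>R\<close>.\<close>
  let ?t = "c * d"
  have "?t \<in> R - q" using c d RE prime[of c d] subring_mult[OF R c(1) d(1)] by blast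
  moreover have "\<forall>y\<in>R - q. \<exists>g\<in>R. \<exists>n>0. \<exists>j. y * g - of_nat n * ?t ^ j \<in> q"
  proof
    fix y assume y: "y \<in> R - q"
    then have yE: "y \<in> E" using RE by auto
    obtain g n j where g: "g \<in> ?B" "0 < n" "y * g - of_nat n * t ^ j \<in> q"
      using field[of y] y B by blast
    have "y * (g * w ^ j) - of_nat n * d ^ j
        = (y * g - of_nat n * t ^ j) * w ^ j + of_nat n * ((t * w) ^ j - d ^ j)"
      by (simp add: algebra_simps power_mult_distrib)
    then have "y * (g * w ^ j) - of_nat n * d ^ j \<in> q"
      using q_add[OF q_mult1[OF g(3) subring_power[OF E wE(1)]] q_mult2[OF cong subring_of_nat[OF E]]]
      by (simp only:)
    moreover have "g * w ^ j \<in> ?B" using g w B by (auto intro!: subring_mult subring_power)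
    moreover have "of_nat n * d ^ j \<in> R" using d R by (auto intro!: subring_mult subring_power)
    ultimately obtain r e i where r: "r \<in> R" "y * r - c ^ e * (of_nat n * d ^ j) ^ Suc i \<in> q"
      using gf.unit_descends[of y "of_nat n * d ^ j" "g * w ^ j"] y by blast
    let ?m = "j * Suc i"
    have "y * (r * (c ^ ?m * d ^ e)) - of_nat (n ^ Suc i) * ?t ^ (e + ?m)
       = (y * r - c ^ e * (of_nat n * d ^ j) ^ Suc i) * (c ^ ?m * d ^ e)"
      unfolding power_mult_distrib power_add power_mult of_nat_power by (simp add: algebra_simps)
    also have "\<dots> \<in> q" using r wE E by (intro q_mult1 subring_mult subring_power)
    finally have "y * (r * (c ^ ?m * d ^ e)) - of_nat (n ^ Suc i) * ?t ^ (e + ?m) \<in> q" .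
    moreover have "r * (c ^ ?m * d ^ e) \<in> R" using r c d R by (intro subring_mult subring_power)
    moreover have "0 < n ^ Suc i" using g(2) by simp
    ultimately show "\<exists>g\<in>R. \<exists>n>0. \<exists>j. y * g - of_nat n * ?t ^ j \<in> q" by blast
  qed
  moreover
  \<comment> \<open>generators of the tower: products of generators of the two layers\<close>
  define ws where "ws = concat (map (\<lambda>v. map (\<lambda>u. u * v) us) vs)"
  let ?W = "span_over R q ws"
  have W: "is_submodule R ?W" "q \<subseteq> ?W"
    using span_over_submodule[OF R qR] span_over_base[OF R] by auto
  have "set ws \<subseteq> E" unfolding ws_def using usE vs(1) E by (auto intro!: subring_mult)
  moreover have "E \<subseteq> saturation ?t ?W"
  proof
    fix a assume a: "a \<in> E"
    have 1: "s * v \<in> ?W" if "s \<in> span_over R q us" "v \<in> set vs" for s v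
    proof -
      have "is_submodule R {s. s * v \<in> ?W}"
        using submodule_vimage_mult[OF W(1), of v] by (simp add: mult.commute)
      moreover have "q \<subseteq> {s. s * v \<in> ?W}" using q_mult1 vs(1) W(2) that(2) by blast
      moreover have "set us \<subseteq> {s. s * v \<in> ?W}"
        using span_over_mem[OF R qR, of _ ws] that(2) unfolding ws_def by auto
      ultimately show ?thesis using span_over_least that(1) by blast
    qed
    have 2: "s * v \<in> saturation c ?W" if s: "s \<in> ?B" and v: "v \<in> set vs" for v s
    proof -
      obtain e where "c ^ e * s \<in> span_over R q us" using finB s by (auto simp: saturation_def)
      from 1[OF this v] show ?thesis by (auto simp: saturation_def mult.assoc)
    qed
    have S: "is_submodule R (saturation c ?W)" using saturation_submodule W R c by blast
    have qS: "q \<subseteq> saturation c ?W" using W(2) saturation_base by blast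
    have 3: "span_over ?B q vs \<subseteq> saturation c ?W"
      using span_over_subset[OF S qS 2] .
    obtain e where "t ^ e * a \<in> span_over ?B q vs" using vs(2) a by (auto simp: saturation_def)
    then have "w ^ e * (t ^ e * a) \<in> span_over ?B q vs"
      using submodule_mult[OF span_over_submodule[OF B(1) qB]] subring_power[OF B(1) w(1)] by blast
    then have "(t * w) ^ e * a \<in> saturation c ?W" using 3 by (auto simp: power_mult_distrib algebra_simps)
    moreover have "((t * w) ^ e - d ^ e) * a \<in> saturation c ?W" using cong a q_mult1 qS by blast
    ultimately have "(t * w) ^ e * a - ((t * w) ^ e - d ^ e) * a \<in> saturation c ?W"
      by (rule submodule_diff[OF R S])
    then have "d ^ e * a \<in> saturation c ?W" by (simp add: algebra_simps)
    then obtain e' where "c ^ e' * (d ^ e * a) \<in> ?W" by (auto simp: saturation_def)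
    then have "(c ^ e * d ^ e') * (c ^ e' * (d ^ e * a)) \<in> ?W"
      by (rule submodule_mult[OF W(1) subring_mult[OF R subring_power[OF R c(1)] subring_power[OF R d(1)]]])
    also have "(c ^ e * d ^ e') * (c ^ e' * (d ^ e * a)) = ?t ^ (e + e') * a"
      by (simp add: power_add power_mult_distrib algebra_simps)
    finally show "a \<in> saturation ?t ?W" by (auto simp: saturation_def)
  qed
  ultimately show ?case by blast
qed

end

section \<open>Specialisation to a finite residue ring\<close>

text \<open>Invertibility of the positive integers makes every ideal of such a ring closed under division by
  nonzero integers.\<close>
class rat_algebra = comm_ring_1 +
  assumes of_nat_Suc_invertible: "\<exists>u. of_nat (Suc n) * u = 1"

lemma of_nat_invertible: "0 < n \<Longrightarrow> \<exists>u::'r::rat_algebra. of_nat n * u = 1"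
  using of_nat_Suc_invertible[of "n - 1"] by simp

lemma ideal_cancel_of_nat:
  fixes I :: "'r::rat_algebra set"
  assumes "is_ideal I" "0 < n" "of_nat n * x \<in> I"
  shows "x \<in> I"
proof -
  obtain u :: 'r where "of_nat n * u = 1" using of_nat_invertible[OF assms(2)] by blast
  then have "x = u * (of_nat n * x)" by (simp add: mult.assoc[symmetric] mult.commute)
  then show ?thesis using submodule_mult[OF assms(1), of u "of_nat n * x"] assms(3) by simp
qed

lemma ideal_cancel_of_int:
  fixes I :: "'r::rat_algebra set"
  assumes I: "is_ideal I" and k: "k \<noteq> 0" "of_int k * x \<in> I"
  shows "x \<in> I"
proof -
  have "of_int (sgn k) * (of_int k * x) \<in> I"
    by (rule submodule_mult[OF I UNIV_I k(2)])
  also have "of_int (sgn k) * (of_int k * x) = of_int (sgn k * k) * x"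
    by (simp add: mult.assoc)
  also have "sgn k * k = int (nat \<bar>k\<bar>)" by (simp add: sgn_if)
  finally show ?thesis using ideal_cancel_of_nat[OF I, of "nat \<bar>k\<bar>" x] k(1) by simp
qed

lemma is_subring_UNIV: "is_subring UNIV"
  by (simp add: is_subring_def)

text \<open>The preimage of the image of the integers in the quotient by \<open>Z\<close>.\<close>
definition ints_plus :: "'r::comm_ring_1 set \<Rightarrow> 'r set" where
  "ints_plus Z = {of_int k + z | k z. z \<in> Z}"

lemma ints_plus_subring:
  assumes Z: "is_ideal Z" shows "is_subring (ints_plus Z)"
  unfolding is_subring_def
proof (intro conjI ballI)
  show "1 \<in> ints_plus Z" unfolding ints_plus_def
    using submodule_0[OF Z] by (intro CollectI exI[of _ 1] exI[of _ 0]) auto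
  fix x y assume "x \<in> ints_plus Z" "y \<in> ints_plus Z"
  then obtain k z l w where *: "x = of_int k + z" "y = of_int l + w" "z \<in> Z" "w \<in> Z"
    by (auto simp: ints_plus_def)
  have "z - w \<in> Z" using submodule_diff[OF is_subring_UNIV Z] * by blast
  then show "x - y \<in> ints_plus Z" unfolding ints_plus_def *
    by (intro CollectI exI[of _ "k - l"] exI[of _ "z - w"]) auto
  have "of_int k * w + (of_int l + w) * z \<in> Z"
    using * by (intro submodule_add[OF Z] submodule_mult[OF Z]) auto
  then show "x * y \<in> ints_plus Z" unfolding ints_plus_def *
    by (intro CollectI exI[of _ "k * l"] exI[of _ "of_int k * w + (of_int l + w) * z"]) (auto simp: algebra_simps)
qed

lemma ints_plus_base: "Z \<subseteq> ints_plus Z"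
  unfolding ints_plus_def by (force intro: exI[of _ 0])

lemma int_subgroup_principal:
  fixes U :: "int set"
  assumes U: "0 \<in> U" "\<And>k l. k \<in> U \<Longrightarrow> l \<in> U \<Longrightarrow> k - l \<in> U" and mult: "\<And>k l. k \<in> U \<Longrightarrow> l * k \<in> U"
  shows "\<exists>g\<in>U. \<forall>k\<in>U. g dvd k"
proof (cases "U \<subseteq> {0}")
  case True
  then show ?thesis using U by auto
next
  case False
  then obtain k where k: "k \<in> U" "k \<noteq> 0" by blast
  have "\<exists>n>0. int n \<in> U"
  proof (intro exI[of _ "nat \<bar>k\<bar>"] conjI)
    show "0 < nat \<bar>k\<bar>" using k by simp
    show "int (nat \<bar>k\<bar>) \<in> U" using mult[OF k(1), of "sgn k"] by (simp add: sgn_if split: if_splits)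
  qed
  define g where "g = (LEAST n. 0 < n \<and> int n \<in> U)"
  have g: "0 < g" "int g \<in> U" unfolding g_def using LeastI_ex[OF \<open>\<exists>n>0. int n \<in> U\<close>] by auto
  have "int g dvd l" if "l \<in> U" for l
  proof (rule ccontr)
    assume "\<not> int g dvd l"
    then have pos: "0 < l mod int g" using g by (metis dvd_eq_mod_eq_0 of_nat_0_less_iff pos_mod_sign order_less_le)
    have "l - (l div int g) * int g \<in> U" using that g mult U by blast
    then have "int (nat (l mod int g)) \<in> U" using pos by (simp add: minus_div_mult_eq_mod)
    then have "(LEAST n. 0 < n \<and> int n \<in> U) \<le> nat (l mod int g)" using pos by (intro Least_le) auto
    then have "g \<le> nat (l mod int g)" by (simp add: g_def)
    then show False using pos_mod_bound[of "int g" l] g pos by linarith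
  qed
  then show ?thesis using g by blast
qed

lemma noetherian_between_ints_plus:
  assumes Z: "is_ideal Z"
  shows "noetherian_between (ints_plus Z) (ints_plus Z) Z"
  unfolding noetherian_between_def
proof (intro allI impI)
  fix f :: "nat \<Rightarrow> 'a set"
  let ?R = "ints_plus Z"
  assume "\<forall>n. is_submodule ?R (f n) \<and> Z \<subseteq> f n \<and> f n \<subseteq> ?R \<and> f n \<subseteq> f (Suc n)"
  then have f: "is_submodule ?R (f n)" "Z \<subseteq> f n" "f n \<subseteq> ?R" "f n \<subseteq> f (Suc n)" for n by auto
  have R: "is_subring ?R" using ints_plus_subring[OF Z] .
  have mono: "f m \<subseteq> f n" if "m \<le> n" for m n
    using lift_Suc_mono_le[of f, OF f(4) that] .
  define U where "U = {k. \<exists>n. of_int k \<in> f n}"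
  have "\<exists>g\<in>U. \<forall>k\<in>U. g dvd k"
  proof (rule int_subgroup_principal)
    show "0 \<in> U" unfolding U_def using submodule_0[OF f(1)] by simp
  next
    fix k l assume "k \<in> U" "l \<in> U"
    then obtain m n where "of_int k \<in> f m" "of_int l \<in> f n" by (auto simp: U_def)
    then have "of_int k \<in> f (max m n)" "of_int l \<in> f (max m n)"
      using mono[of m "max m n"] mono[of n "max m n"] by auto
    then have "of_int k - of_int l \<in> f (max m n)" using submodule_diff[OF R f(1)] by blast
    then show "k - l \<in> U" unfolding U_def by auto
  next
    fix k l assume "k \<in> U"
    then obtain m where "of_int k \<in> f m" by (auto simp: U_def)
    then have "of_int l * of_int k \<in> f m" using submodule_mult[OF f(1)] subring_of_int[OF R] by blast
    then show "l * k \<in> U" unfolding U_def by auto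
  qed
  then obtain g n where g: "of_int g \<in> f n" "\<And>k. k \<in> U \<Longrightarrow> g dvd k" unfolding U_def by blast
  have "f m = f n" if m: "n \<le> m" for m
  proof
    show "f n \<subseteq> f m" using mono[OF m] .
    show "f m \<subseteq> f n"
    proof
      fix x assume x: "x \<in> f m"
      then obtain k z where kz: "x = of_int k + z" "z \<in> Z" using f(3) by (force simp: ints_plus_def)
      then have "x - z \<in> f m" using submodule_diff[OF R f(1) x] f(2) by blast
      then have "k \<in> U" using kz unfolding U_def by auto
      then obtain l where "k = g * l" using g(2) by (auto elim: dvdE)
      then have "of_int k \<in> f n"
        using submodule_mult[OF f(1) subring_of_int[OF R, of l] g(1)] by (simp add: mult.commute)
      then show "x \<in> f n" using submodule_add[OF f(1)] kz f(2) by blast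
    qed
  qed
  then show "\<exists>n. \<forall>m\<ge>n. f m = f n" by blast
qed

text \<open>Finiteness of \<open>W/N\<close> in terms of representatives.\<close>
definition finite_index :: "'r::comm_ring_1 set \<Rightarrow> 'r set \<Rightarrow> bool" where
  "finite_index W N \<longleftrightarrow> (\<exists>F. finite F \<and> (\<forall>a\<in>W. \<exists>f\<in>F. a - f \<in> N))"

lemma finite_index_trans:
  assumes "finite_index W M" "finite_index M N"
  shows "finite_index W N"
proof -
  obtain F where F: "finite F" "\<forall>a\<in>W. \<exists>f\<in>F. a - f \<in> M" using assms(1) unfolding finite_index_def by blast
  obtain H where H: "finite H" "\<forall>a\<in>M. \<exists>h\<in>H. a - h \<in> N" using assms(2) unfolding finite_index_def by blast
  let ?F = "(\<lambda>(f, h). f + h) ` (F \<times> H)"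
  have "\<exists>k\<in>?F. a - k \<in> N" if a: "a \<in> W" for a
  proof -
    obtain f where f: "f \<in> F" "a - f \<in> M" using bspec[OF F(2) a] by blast
    obtain h where h: "h \<in> H" "a - f - h \<in> N" using bspec[OF H(2) f(2)] by blast
    have "a - (f + h) \<in> N" using h by (simp add: algebra_simps)
    then show ?thesis using f h by force
  qed
  moreover have "finite ?F" using F(1) H(1) by simp
  ultimately show ?thesis unfolding finite_index_def by blast
qed

text \<open>Changing a coefficient of \<open>w\<close> by an element of \<open>M\<close> changes the combination by an element of \<open>T\<close>, so
  finitely many coefficients have to be considered. For an ideal \<open>M = (w\<^sub>1, \<dots>, w\<^sub>r)\<close> of finite index and \<open>T\<close>
  containing \<open>M\<^sup>2\<close> this is the finiteness of \<open>M/T\<close>.\<close>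
lemma finite_index_span:
  assumes M: "finite_index R M" and T: "is_submodule A T" "Q \<subseteq> T"
    and ws: "\<And>x w. x \<in> M \<Longrightarrow> w \<in> set ws \<Longrightarrow> x * w \<in> T"
  shows "finite_index (span_over R Q ws) T"
  using ws
proof (induction ws)
  case Nil
  have "finite {0}" "\<forall>a\<in>Q. \<exists>f\<in>{0}. a - f \<in> T" using T by auto
  then show ?case unfolding finite_index_def span_over.simps by blast
next
  case (Cons w ws)
  obtain F where F: "finite F" "\<forall>a\<in>span_over R Q ws. \<exists>f\<in>F. a - f \<in> T"
    using Cons unfolding finite_index_def by auto
  obtain H where H: "finite H" "\<forall>a\<in>R. \<exists>h\<in>H. a - h \<in> M" using M unfolding finite_index_def by blast
  let ?F = "(\<lambda>(f, h). f + h * w) ` (F \<times> H)"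
  have "\<exists>k\<in>?F. a - k \<in> T" if a: "a \<in> span_over R Q (w # ws)" for a
  proof -
    obtain b s where bs: "a = b + s * w" "b \<in> span_over R Q ws" "s \<in> R" using a by auto
    obtain f where f: "f \<in> F" "b - f \<in> T" using bspec[OF F(2) bs(2)] by blast
    obtain h where h: "h \<in> H" "s - h \<in> M" using bspec[OF H(2) bs(3)] by blast
    have "(s - h) * w \<in> T" using Cons.prems h(2) by simp
    then have "(b - f) + (s - h) * w \<in> T" using f(2) submodule_add[OF T(1)] by blast
    then have "a - (f + h * w) \<in> T" unfolding bs(1) by (simp add: algebra_simps)
    then show ?thesis using f(1) h(1) by force
  qed
  moreover have "finite ?F" using F(1) H(1) by simp
  ultimately show ?case unfolding finite_index_def by blast
qed

lemma plus_multiples_submodule: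
  assumes "is_subring A" "is_submodule A q"
  shows "is_submodule A {x + p * v | x v. x \<in> q \<and> v \<in> A}"
  using submodule_plus[OF assms(2) submodule_image_mult[OF is_submodule_self[OF assms(1)], of p]]
  by (rule back_subst[of "is_submodule A"]) auto

text \<open>The ideal \<open>q\<close> is chosen maximal among the ideals of \<open>A\<close> that contain \<open>I \<inter> A\<close> and no positive
  integer. Then \<open>q\<close> is prime and every nonzero element of \<open>A/q\<close> divides a positive integer, so
  Zariski's lemma applies: after inverting some integer \<open>d\<close>, the quotient is a finite module over the
  integers. Any prime \<open>p\<close> not dividing \<open>d\<close> therefore leaves finitely many classes modulo \<open>q + p A\<close>, and
  \<open>p\<close> is no unit, since otherwise it would divide a power of \<open>d\<close>.\<close>
theorem exists_finite_specialisation: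
  fixes Z I :: "'r::rat_algebra set"
  assumes Z: "is_ideal Z" and I: "is_ideal I" "Z \<subseteq> I" "1 \<notin> I"
    and G: "finite G" and A: "A = subring_gen (ints_plus Z \<union> G)"
  shows "\<exists>(p::nat) q. prime p \<and> 2 < p \<and> is_submodule A q \<and> q \<subseteq> A \<and> I \<inter> A \<subseteq> q \<and>
    (\<forall>n>0. \<forall>x\<in>A. of_nat n * x \<in> q \<longrightarrow> x \<in> q) \<and> (\<forall>v\<in>A. 1 - of_nat p * v \<notin> q) \<and>
    finite_index A {x + of_nat p * v | x v. x \<in> q \<and> v \<in> A}"
proof -
  let ?R = "ints_plus Z"
  have R: "is_subring ?R" using ints_plus_subring[OF Z] .
  have subA: "is_subring A" unfolding A by (rule gen_subring)
  have RA: "?R \<subseteq> A" unfolding A by (auto intro: gen_base)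
  have ZA: "Z \<subseteq> A" using RA ints_plus_base by blast
  have noethA: "noetherian_between A A Z" unfolding A
    by (rule noetherian_between_gen[OF G R Z ints_plus_base noetherian_between_ints_plus[OF Z]])
  have IA: "is_submodule A I" using submodule_anti[OF I(1)] by simp
  let ?\<F> = "{L. is_submodule A L \<and> I \<inter> A \<subseteq> L \<and> L \<subseteq> A \<and> (\<forall>n>0. of_nat n \<notin> L)}"
  have nI: "of_nat n \<notin> I" if "0 < n" for n
    using ideal_cancel_of_nat[OF I(1) that, of 1] I(3) by auto
  then have "I \<inter> A \<in> ?\<F>" using submodule_Int[OF IA is_submodule_self[OF subA]] by simp
  then have "?\<F> \<noteq> {}" by blast
  then have "\<exists>M\<in>?\<F>. \<forall>L\<in>?\<F>. M \<subseteq> L \<longrightarrow> L = M"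
    using I(2) ZA by (intro noetherian_between_maximal[OF noethA]) auto
  then obtain q where q: "is_submodule A q" "I \<inter> A \<subseteq> q" "q \<subseteq> A" and int_notin: "\<And>n. 0 < n \<Longrightarrow> of_nat n \<notin> q"
    and max: "\<And>L. is_submodule A L \<Longrightarrow> I \<inter> A \<subseteq> L \<Longrightarrow> L \<subseteq> A \<Longrightarrow> (\<forall>n>0. of_nat n \<notin> L) \<Longrightarrow> q \<subseteq> L \<Longrightarrow> L = q"
    by auto
  note IAq = q(2)
  have Zq: "Z \<subseteq> q" using I(2) ZA q(2) by blast
  have int_mult: "\<exists>g\<in>A. \<exists>n>0. y * g - of_nat n \<in> q" if y: "y \<in> A" "y \<notin> q" for y
  proof -
    let ?L = "span_over A q [y]"
    have L: "is_submodule A ?L" "q \<subseteq> ?L" "y \<in> ?L" "?L \<subseteq> A"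
      using y by (intro span_over_submodule[OF subA q(1)] span_over_base[OF subA]
          span_over_mem[OF subA q(1)] span_over_least[OF is_submodule_self[OF subA] q(3)]; simp)+
    then have "?L \<noteq> q" using y by blast
    then have "\<exists>n>0. of_nat n \<in> ?L" using max[OF L(1)] L q(2) by blast
    then obtain n where n: "0 < n" "of_nat n \<in> ?L" by blast
    then obtain x g where "of_nat n = x + g * y" "x \<in> q" "g \<in> A" by auto
    then have "y * g - of_nat n = - x" by (simp add: algebra_simps)
    then have "y * g - of_nat n \<in> q" using submodule_uminus[OF subA q(1) \<open>x \<in> q\<close>] by simp
    then show ?thesis using n(1) \<open>g \<in> A\<close> by blast
  qed
  have prime_q: "x \<in> q \<or> y \<in> q" if xy: "x \<in> A" "y \<in> A" "x * y \<in> q" for x y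
  proof (rule ccontr)
    assume "\<not> ?thesis"
    then obtain g n h m where *: "g \<in> A" "h \<in> A" "0 < n" "0 < m" "x * g - of_nat n \<in> q" "y * h - of_nat m \<in> q"
      using int_mult xy(1,2) by metis
    have "of_nat (n * m) = (g * h) * (x * y) - (y * h) * (x * g - of_nat n) - of_nat n * (y * h - of_nat m)"
      by (simp add: algebra_simps)
    also have "\<dots> \<in> q"
      by (intro submodule_diff[OF subA q(1)] submodule_mult[OF q(1) _ xy(3)] submodule_mult[OF q(1) _ *(5)]
          submodule_mult[OF q(1) _ *(6)] subring_mult[OF subA] subring_of_nat[OF subA] * xy)
    finally show False using int_notin[of "n * m"] * by simp
  qed
  interpret prime_ideal_of A q
    using subA q prime_q int_notin[of 1] by unfold_locales auto
  have noethR: "noetherian_between ?R ?R (q \<inter> ?R)"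
    using noetherian_between_anti[OF noetherian_between_ints_plus[OF Z], of "q \<inter> ?R" ?R] Zq ints_plus_base by blast
  obtain G' where "G = set G'" using finite_list[OF G] by blast
  then have "A = subring_gen (?R \<union> set G')" using A by simp
  from zariski[OF R noethR this int_mult int_notin]
  obtain t ws where t: "t \<in> ?R" "t \<notin> q" and ws: "set ws \<subseteq> A" and fin: "A \<subseteq> saturation t (span_over ?R q ws)"
    by blast
  let ?W = "span_over ?R q ws"
  obtain d z where tdz: "t = of_int d + z" "z \<in> Z" using t(1) by (auto simp: ints_plus_def)
  have d0: "d \<noteq> 0" using t(2) tdz Zq by auto
  have intA: "of_int k \<in> A" for k using subA by simp
  have tA: "t \<in> A" using t RA by blast
  have t_cong: "t ^ e - of_int d ^ e \<in> q" for e
    using tdz Zq by (intro q_power_cong[OF tA intA]) auto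
  have int_q: "k = 0" if "of_int k \<in> q" for k
  proof (rule ccontr)
    assume "k \<noteq> 0"
    have "of_int (sgn k) * of_int k \<in> q" using submodule_mult[OF q(1) intA that] .
    moreover have "sgn k * k = int (nat \<bar>k\<bar>)" by (simp add: sgn_if)
    then have "of_int (sgn k) * of_int k = (of_nat (nat \<bar>k\<bar>) :: 'r)"
      by (metis of_int_mult of_int_of_nat_eq)
    ultimately show False using int_notin[of "nat \<bar>k\<bar>"] \<open>k \<noteq> 0\<close> by simp
  qed
  \<comment> \<open>\<open>p > \<bar>d\<bar>\<close> ensures that \<open>p\<close> does not divide \<open>d\<close>; \<open>p > 2\<close> is for the growth of factorials.\<close>
  obtain p :: nat where p: "prime p" "max 2 (nat \<bar>d\<bar>) < p" using bigger_prime by blast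
  have pd: "\<not> int p dvd d" using p(2) d0 zdvd_imp_le[of "int p" "\<bar>d\<bar>"] by auto
  have pp: "prime (int p)" using p(1) by simp
  interpret gf: generically_finite A q ?R A t ws
    using R noethR subA RA t ws fin by unfold_locales auto
  have notin: "1 - of_nat p * v \<notin> q" if v: "v \<in> A" for v
  proof
    assume "1 - of_nat p * v \<in> q"
    then have "of_nat p * v - 1 \<in> q" using q_uminus_iff[of "1 - of_nat p * v"] by simp
    then obtain r e i where "r \<in> ?R" "of_nat p * r - t ^ e * 1 ^ Suc i \<in> q"
      using gf.unit_descends[of "of_nat p" 1 v] v R by auto
    then obtain k z' where kz: "of_nat p * (of_int k + z') - t ^ e \<in> q" "z' \<in> Z"
      by (auto simp: ints_plus_def)
    have "of_nat p * z' \<in> q" using kz(2) Zq q_mult2[of z' "of_nat p"] subA by auto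
    then have "(of_nat p * (of_int k + z') - t ^ e) - of_nat p * z' + (t ^ e - of_int d ^ e) \<in> q"
      by (rule q_add[OF q_diff[OF kz(1)] t_cong])
    then have "of_int (int p * k - d ^ e) \<in> q" by (simp add: algebra_simps)
    then have "int p * k - d ^ e = 0" by (rule int_q)
    then have "d ^ e = int p * k" by simp
    then have "int p dvd d ^ e" by simp
    then show False using pd pp prime_dvd_power by blast
  qed
  let ?m = "{x + of_nat p * v | x v. x \<in> q \<and> v \<in> A}"
  have m: "is_submodule A ?m" using plus_multiples_submodule[OF subA q(1)] .
  have qm: "q \<subseteq> ?m" using subA by (force intro: exI[of _ 0])
  have pm: "of_nat p * v \<in> ?m" if "v \<in> A" for v
    using that q(1) by (force intro: exI[of _ 0])
  have "\<exists>f\<in>of_int ` {0..<int p}. \<forall>w\<in>A. (s - f) * w \<in> ?m" if s: "s \<in> ?R" for s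
  proof -
    obtain k z' where kz: "s = of_int k + z'" "z' \<in> Z" using s by (auto simp: ints_plus_def)
    have "of_int k = of_int (int p * (k div int p) + k mod int p)" by simp
    then have k: "(of_int k :: 'r) = of_nat p * of_int (k div int p) + of_int (k mod int p)"
      by (simp only: of_int_add of_int_mult of_int_of_nat_eq)
    have "(s - of_int (k mod int p)) * w \<in> ?m" if w: "w \<in> A" for w
    proof -
      have "(s - of_int (k mod int p)) * w = of_nat p * (of_int (k div int p) * w) + z' * w"
        unfolding kz(1) by (subst k) (simp add: algebra_simps)
      also have "\<dots> \<in> ?m"
        by (rule submodule_add[OF m pm[OF subring_mult[OF subA intA w]]
              subsetD[OF qm q_mult1[OF subsetD[OF Zq kz(2)] w]]])
      finally show ?thesis .
    qed
    moreover have "k mod int p \<in> {0..<int p}" using p(2) by simp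
    ultimately show ?thesis by blast
  qed
  then have "finite_index ?R {s. \<forall>w\<in>A. s * w \<in> ?m}" unfolding finite_index_def
    by (intro exI[of _ "of_int ` {0..<int p}"]) simp
  then have "finite_index ?W ?m"
    by (rule finite_index_span[OF _ m qm]) (use ws in blast)
  then obtain F where F: "finite F" "\<And>a. a \<in> ?W \<Longrightarrow> \<exists>f\<in>F. a - f \<in> ?m"
    unfolding finite_index_def by meson
  have W: "is_submodule ?R ?W" "q \<subseteq> ?W"
    using span_over_submodule[OF R submodule_anti[OF q(1) RA]] span_over_base[OF R] by auto
  have "\<exists>f\<in>F. a - f \<in> ?m" if a: "a \<in> A" for a
  proof -
    obtain e where "t ^ e * a \<in> ?W" using fin a by (auto simp: saturation_def)
    moreover have "(t ^ e - of_int d ^ e) * a \<in> ?W" using q_mult1[OF t_cong a] W(2) by blast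
    ultimately have "t ^ e * a - (t ^ e - of_int d ^ e) * a \<in> ?W" by (rule submodule_diff[OF R W(1)])
    then have dW: "of_int (d ^ e) * a \<in> ?W" by (simp add: algebra_simps)
    have "coprime (d ^ e) (int p)"
      using prime_imp_coprime[OF pp pd] by (simp add: coprime_commute)
    then obtain x y where xy: "x * d ^ e + y * int p = 1"
      using bezout_int[of "d ^ e" "int p"] coprime_imp_gcd_eq_1 by metis
    have "of_int x * (of_int (d ^ e) * a) \<in> ?W"
      by (rule submodule_mult[OF W(1) subring_of_int[OF R] dW])
    then obtain f where f: "f \<in> F" "of_int x * (of_int (d ^ e) * a) - f \<in> ?m" using F(2) by blast
    have "a = of_int (x * d ^ e + y * int p) * a" using xy by simp
    then have "a - f = (of_int x * (of_int (d ^ e) * a) - f) + of_nat p * (of_int y * a)"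
      by (simp add: algebra_simps)
    also have "\<dots> \<in> ?m"
      by (rule submodule_add[OF m f(2) pm[OF subring_mult[OF subA intA a]]])
    finally show ?thesis using f(1) by blast
  qed
  then have FI: "finite_index A ?m" unfolding finite_index_def using F(1) by blast
  have "x \<in> q" if "0 < n" "x \<in> A" "of_nat n * x \<in> q" for n x
    using that prime_q[of "of_nat n" x] int_notin[of n] subA by auto
  moreover have "2 < p" using p(2) by simp
  ultimately show ?thesis
    using p(1) q IAq notin FI by (intro exI[of _ p] exI[of _ q]) simp
qed

section \<open>Zeros of the interpolating polynomial\<close>

text \<open>Legendre's recursion: writing \<open>n = p k + r\<close>, the multiples of \<open>p\<close> up to \<open>n\<close> contribute \<open>k\<close> factors \<open>p\<close>
  and those of \<open>k!\<close>. As \<open>p\<close> is at least \<open>3\<close>, the bound \<open>k + k/2\<close> is at most \<open>n/2\<close>; for \<open>p = 2\<close> the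
  statement fails.\<close>
lemma multiplicity_fact_le:
  fixes p n :: nat
  assumes p: "prime p" "2 < p"
  shows "2 * multiplicity p (fact n :: nat) \<le> n"
proof (induction n rule: less_induct)
  case (less n)
  have p1: "1 < p" using p by simp
  have pe: "prime_elem p" using p by simp
  have step: "multiplicity p (fact (Suc k) :: nat) = multiplicity p (Suc k) + multiplicity p (fact k :: nat)" for k
    using pe by (simp only: fact_Suc of_nat_id) (rule prime_elem_multiplicity_mult_distrib, auto)
  have r: "multiplicity p (fact (p * k + r) :: nat) = multiplicity p (fact (p * k) :: nat)" if "r < p" for k r
    using that
  proof (induction r)
    case (Suc r)
    then have "\<not> p dvd Suc (p * k + r)"
      by (metis Suc_lessD add_Suc_right dvd_add_right_iff dvd_triv_left nat_dvd_not_less zero_less_Suc)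
    then show ?case using Suc step[of "p * k + r"] by (simp add: not_dvd_imp_multiplicity_0)
  qed simp
  have k: "multiplicity p (fact (p * k) :: nat) = k + multiplicity p (fact k :: nat)" for k
  proof (induction k)
    case (Suc k)
    have "Suc (p * k + (p - 1)) = p * Suc k" using p1 by simp
    then have "multiplicity p (fact (p * Suc k) :: nat)
        = multiplicity p (p * Suc k) + multiplicity p (fact (p * k + (p - 1)) :: nat)"
      using step[of "p * k + (p - 1)"] by (simp only:)
    also have "multiplicity p (p * Suc k) = Suc (multiplicity p (Suc k))"
      using p1 by (intro multiplicity_times_same) auto
    also have "multiplicity p (fact (p * k + (p - 1)) :: nat) = k + multiplicity p (fact k :: nat)"
      using r[of "p - 1" k] p1 Suc by simp
    finally show ?case using step[of k] by simp
  qed simp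
  show ?case
  proof (cases "n div p < n")
    case True
    have "multiplicity p (fact n :: nat) = n div p + multiplicity p (fact (n div p) :: nat)"
      using r[of "n mod p" "n div p"] k[of "n div p"] p1 by simp
    then have "2 * multiplicity p (fact n :: nat) \<le> 3 * (n div p)" using less[OF True] by simp
    also have "\<dots> \<le> p * (n div p)" using p by (intro mult_right_mono) auto
    also have "\<dots> \<le> n" by simp
    finally show ?thesis .
  next
    case False
    then have "n = 0" using p1 by (metis div_less_dividend gr0I)
    then show ?thesis by simp
  qed
qed

text \<open>The number \<open>D\<close> is the part of \<open>L!\<close> prime to \<open>p\<close>. Multiplication by it turns each \<open>p\<^sup>i/i!\<close> into an
  integer divisible by \<open>p\<close> to the power \<open>i - i div 2\<close>, that is, half of \<open>i\<close> rounded up.\<close>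
lemma clear_factorials:
  fixes p L :: nat
  assumes p: "prime p" "2 < p"
  shows "\<exists>D. coprime D p \<and> (\<forall>i\<le>L. \<exists>e. D * p ^ i = p ^ (i - i div 2) * fact i * e)"
proof -
  have fct: "\<exists>v d. v \<le> i div 2 \<and> fact i = p ^ v * d \<and> coprime d p" for i
  proof -
    have "fact i \<noteq> (0::nat)" "\<not> is_unit p" using p by auto
    then obtain d where "fact i = p ^ multiplicity p (fact i :: nat) * d" "\<not> p dvd d"
      using multiplicity_decompose'[of "fact i :: nat" p] by blast
    moreover from this have "coprime d p" using p prime_imp_coprime coprime_commute by blast
    moreover have "multiplicity p (fact i :: nat) \<le> i div 2" using multiplicity_fact_le[OF p, of i] by linarith
    ultimately show ?thesis by blast
  qed
  obtain v D where D: "fact L = p ^ v * D" "coprime D p" using fct by blast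
  have "\<exists>e. D * p ^ i = p ^ (i - i div 2) * fact i * e" if "i \<le> L" for i
  proof -
    obtain w d where d: "w \<le> i div 2" "fact i = p ^ w * d" "coprime d p" using fct by blast
    have "d dvd fact L" using fact_dvd[OF that, where 'a = nat] d(2) by (metis dvd_mult_right dvd_trans dvd_triv_right)
    then have "d dvd D" using D(1) d(3) by (simp add: coprime_dvd_mult_right_iff)
    then obtain e where e: "D = d * e" by blast
    have "p ^ i = p ^ (i - i div 2) * p ^ (i div 2 - w) * p ^ w"
      using d(1) by (simp add: power_add[symmetric])
    then have "D * p ^ i = p ^ (i - i div 2) * fact i * (e * p ^ (i div 2 - w))"
      unfolding e d(2) by simp
    then show ?thesis by blast
  qed
  then show ?thesis using D(2) by blast
qed

text \<open>The sets \<open>C j\<close> here and below are a descending filtration by additive groups; it will be given by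
  divisibility by powers of \<open>p\<close>.\<close>
lemma poly_in_filtration:
  fixes C :: "nat \<Rightarrow> 'r::comm_ring_1 set"
  assumes C: "\<And>j. is_submodule (range of_int) (C j)" "\<And>j. C (Suc j) \<subseteq> C j"
    and P: "\<And>j. coeff P j \<in> C j"
  shows "poly P (of_int c) \<in> C 0"
  unfolding poly_altdef
proof (rule submodule_sum[OF C(1)])
  fix i
  have "C i \<subseteq> C 0" using lift_Suc_antimono_le[of C, OF C(2), of 0 i] by simp
  then have "coeff P i \<in> C 0" using P by blast
  then have "of_int (c ^ i) * coeff P i \<in> C 0" using submodule_mult[OF C(1)] by blast
  then show "coeff P i * of_int c ^ i \<in> C 0" by (simp add: mult.commute)
qed

text \<open>Each coefficient of the quotient by \<open>X - c\<close> combines coefficients of \<open>P\<close> of higher degree, so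
  division moves one step down in the filtration.\<close>
lemma coeff_synthetic_div_in_filtration:
  fixes C :: "nat \<Rightarrow> 'r::comm_ring_1 set"
  assumes "\<And>j. is_submodule (range of_int) (C j)" "\<And>j. C (Suc j) \<subseteq> C j"
    and "\<And>j. coeff P j \<in> C j"
  shows "coeff (synthetic_div P (of_int c)) j \<in> C (Suc j)"
  using assms
proof (induction P arbitrary: C j)
  case 0
  then show ?case using submodule_0[OF 0(1)] by simp
next
  case (pCons a P)
  have P: "coeff P j \<in> C (Suc j)" for j using pCons.prems(3)[of "Suc j"] by simp
  show ?case
  proof (cases j)
    case 0
    then show ?thesis using poly_in_filtration[of "\<lambda>j. C (Suc j)" P c] pCons.prems P by simp
  next
    case (Suc i)
    then show ?thesis using pCons.IH[of "\<lambda>j. C (Suc j)" i] pCons.prems P by simp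
  qed
qed

text \<open>An algebraic substitute for Strassman's theorem: every root modulo \<open>I\<close> splits off a linear factor and
  pushes the remaining coefficients one step down in the filtration. Differences of roots are nonzero
  integers and can be cancelled modulo \<open>I\<close>.\<close>
lemma poly_many_roots:
  fixes C :: "nat \<Rightarrow> 'r::rat_algebra set"
  assumes "finite S"
    and I: "is_ideal I"
    and C: "\<And>j. is_submodule (range of_int) (C j)" "\<And>j. C (Suc j) \<subseteq> C j"
    and P: "\<And>j. coeff P j \<in> C j" "\<And>s. s \<in> S \<Longrightarrow> poly P (of_int s) \<in> I"
  shows "\<exists>x\<in>C (card S). poly P (of_int m) - x \<in> I"
  using assms(1) C P
proof (induction S arbitrary: C P rule: finite_induct)
  case empty
  have "poly P (of_int m) \<in> C 0" using poly_in_filtration empty by blast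
  then show ?case using submodule_0[OF I] by (intro bexI[of _ "poly P (of_int m)"]) auto
next
  case (insert s S)
  define Q where "Q = synthetic_div P (of_int s)"
  have P_eq: "poly P (of_int n) = of_int (n - s) * poly Q (of_int n) + poly P (of_int s)" for n
  proof -
    have "P = [:- of_int s, 1:] * Q + [:poly P (of_int s):]"
      unfolding Q_def using synthetic_div_correct'[of "of_int s" P] by simp
    from arg_cong[OF this, of "\<lambda>F. poly F (of_int n)"]
    show ?thesis by (simp add: algebra_simps)
  qed
  have Ps: "poly P (of_int s) \<in> I" using insert.prems(4) by simp
  have "\<exists>x\<in>C (Suc (card S)). poly Q (of_int m) - x \<in> I"
  proof (rule insert.IH[of "\<lambda>j. C (Suc j)" Q])
    show "coeff Q j \<in> C (Suc j)" for j
      unfolding Q_def using insert.prems by (intro coeff_synthetic_div_in_filtration) auto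
    fix n assume n: "n \<in> S"
    then have "poly P (of_int n) - poly P (of_int s) \<in> I"
      using submodule_diff[OF is_subring_UNIV I _ Ps] insert.prems(4) by simp
    then have "of_int (n - s) * poly Q (of_int n) \<in> I" using P_eq[of n] by simp
    then show "poly Q (of_int n) \<in> I" using ideal_cancel_of_int[OF I, of "n - s"] n insert.hyps(2) by auto
  qed (use insert.prems in auto)
  then obtain x where x: "x \<in> C (Suc (card S))" "poly Q (of_int m) - x \<in> I" by blast
  have "of_int (m - s) * (poly Q (of_int m) - x) + poly P (of_int s) \<in> I"
    by (rule submodule_add[OF I submodule_mult[OF I UNIV_I x(2)] Ps])
  then have "poly P (of_int m) - of_int (m - s) * x \<in> I"
    unfolding P_eq[of m] by (simp add: algebra_simps)
  moreover have "of_int (m - s) * x \<in> C (Suc (card S))"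
    by (rule submodule_mult[OF insert.prems(1) rangeI x(1)])
  ultimately show ?case using insert.hyps by auto
qed

lemma falling_product:
  "(\<Prod>l<i. (of_nat n - of_nat l :: 'r::comm_ring_1)) = of_nat (fact i * (n choose i))"
proof (induction i)
  case (Suc i)
  have "fact (Suc i) * (n choose Suc i) = fact i * (Suc i * (n choose Suc i))" by (simp add: algebra_simps)
  also have "Suc i * (n choose Suc i) = (n - i) * (n choose i)"
    using binomial_absorb_comp[of n i] Suc_times_binomial_eq[of "n - 1" i] by (cases n) auto
  finally have *: "fact (Suc i) * (n choose Suc i) = fact i * (n choose i) * (n - i)" by simp
  have "(of_nat (n choose i) :: 'r) * (of_nat n - of_nat i) = of_nat ((n choose i) * (n - i))"
    by (cases "i \<le> n") (auto simp: of_nat_diff binomial_eq_0)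
  then show ?case using Suc unfolding * by (simp add: mult.assoc)
qed simp

lemma coeff_falling_poly:
  "\<exists>k. coeff (\<Prod>l<i. [:- of_nat l, 1:] :: 'r::comm_ring_1 poly) j = of_int k \<and> (i < j \<longrightarrow> k = 0)"
proof (induction i arbitrary: j)
  case 0
  show ?case by (cases j) (auto intro: exI[of _ 1] exI[of _ 0])
next
  case (Suc i)
  obtain f where f: "\<And>j. coeff (\<Prod>l<i. [:- of_nat l, 1:] :: 'r poly) j = of_int (f j)" "\<And>j. i < j \<Longrightarrow> f j = 0"
    using Suc by metis
  show ?case
    using f by (intro exI[of _ "(if j = 0 then 0 else f (j - 1)) - int i * f j"])
      (auto simp: coeff_pCons mult.commute split: nat.split)
qed

text \<open>The values of an orbit of \<open>\<tau>\<close> under Newton's formula. With \<open>\<Delta> = \<tau> - 1\<close> and \<open>\<Delta>\<^sup>i b = p\<^sup>i c\<^sub>i\<close>, the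
  polynomial with values \<open>\<Sum>\<^sub>i (n choose i) p\<^sup>i c\<^sub>i\<close> has, after multiplication by an integer prime to \<open>p\<close>, its
  \<open>j\<close>-th coefficient divisible by \<open>p\<close> to the power \<open>j - j div 2\<close>. The bound depends only on the
  number of zeros, not on their size, which will make it applicable to negative exponents after a shift.\<close>
theorem iterate_many_zeros:
  fixes B I :: "'r::rat_algebra set"
  assumes p: "prime p" "2 < p" and B: "is_subring B" and I: "is_ideal I"
    and add: "\<And>x y. \<tau> (x + y) = \<tau> x + \<tau> y" and mult: "\<And>x y. \<tau> (x * y) = \<tau> x * \<tau> y" and one: "\<tau> 1 = 1"
    and \<tau>: "\<And>x. x \<in> B \<Longrightarrow> \<exists>y\<in>B. \<tau> x = x + of_nat p * y"
    and b: "b \<in> B" and S: "finite S" "\<And>s. s \<in> S \<Longrightarrow> (\<tau> ^^ s) b \<in> I"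
  shows "\<exists>x\<in>B. (\<tau> ^^ m) b - of_nat p ^ (card S - card S div 2) * x \<in> I"
proof -
  define \<Delta> where "\<Delta> x = \<tau> x - x" for x
  have \<tau>0: "\<tau> 0 = 0" using add[of 0 0] by simp
  have \<tau>_nat: "\<tau> (of_nat k) = of_nat k" for k
    by (induction k) (auto simp: add one \<tau>0)
  have \<tau>_sum: "\<tau> (sum f T) = (\<Sum>i\<in>T. \<tau> (f i))" for f and T :: "nat set"
    by (induction T rule: infinite_finite_induct) (auto simp: add \<tau>0)
  have \<Delta>_nat: "\<Delta> (of_nat k * x) = of_nat k * \<Delta> x" for k x
    unfolding \<Delta>_def mult \<tau>_nat by (simp add: algebra_simps)
  have newton: "(\<tau> ^^ n) x = (\<Sum>i\<le>n. of_nat (n choose i) * (\<Delta> ^^ i) x)" for n x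
  proof (induction n arbitrary: x)
    case (Suc n)
    have "(\<tau> ^^ Suc n) x = \<tau> (\<Sum>i\<le>n. of_nat (n choose i) * (\<Delta> ^^ i) x)" using Suc by simp
    also have "\<dots> = (\<Sum>i\<le>n. of_nat (n choose i) * ((\<Delta> ^^ i) x + (\<Delta> ^^ Suc i) x))"
      unfolding \<tau>_sum mult \<tau>_nat by (simp add: \<Delta>_def)
    also have "\<dots> = (\<Sum>i\<le>n. of_nat (n choose i) * (\<Delta> ^^ i) x) + (\<Sum>i\<le>n. of_nat (n choose i) * (\<Delta> ^^ Suc i) x)"
      by (simp add: distrib_left sum.distrib)
    also have "(\<Sum>i\<le>n. of_nat (n choose i) * (\<Delta> ^^ i) x) = x + (\<Sum>i\<le>n. of_nat (n choose Suc i) * (\<Delta> ^^ Suc i) x)"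
    proof -
      have "(\<Sum>i\<le>n. of_nat (n choose i) * (\<Delta> ^^ i) x) = (\<Sum>i\<le>Suc n. of_nat (n choose i) * (\<Delta> ^^ i) x)"
        by (simp add: binomial_eq_0)
      also have "\<dots> = x + (\<Sum>i\<le>n. of_nat (n choose Suc i) * (\<Delta> ^^ Suc i) x)"
        by (subst sum.atMost_Suc_shift) simp
      finally show ?thesis .
    qed
    also have "x + (\<Sum>i\<le>n. of_nat (n choose Suc i) * (\<Delta> ^^ Suc i) x) + (\<Sum>i\<le>n. of_nat (n choose i) * (\<Delta> ^^ Suc i) x)
       = x + (\<Sum>i\<le>n. of_nat (Suc n choose Suc i) * (\<Delta> ^^ Suc i) x)"
      by (simp add: sum.distrib[symmetric] algebra_simps)
    also have "\<dots> = (\<Sum>i\<le>Suc n. of_nat (Suc n choose i) * (\<Delta> ^^ i) x)"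
      by (subst sum.atMost_Suc_shift) simp
    finally show ?case .
  qed simp
  have "\<forall>x\<in>B. \<exists>y\<in>B. \<Delta> x = of_nat p * y" using \<tau> unfolding \<Delta>_def by (metis add_diff_cancel_left')
  then obtain \<delta> where \<delta>: "\<And>x. x \<in> B \<Longrightarrow> \<delta> x \<in> B" "\<And>x. x \<in> B \<Longrightarrow> \<Delta> x = of_nat p * \<delta> x" by metis
  define c where "c i = (\<delta> ^^ i) b" for i
  have cB: "c i \<in> B" for i unfolding c_def by (induction i) (use b \<delta> in auto)
  have \<Delta>_pow: "(\<Delta> ^^ i) b = of_nat p ^ i * c i" for i
  proof (induction i)
    case (Suc i)
    have "(\<Delta> ^^ Suc i) b = \<Delta> (of_nat (p ^ i) * c i)" using Suc by simp
    also have "\<dots> = of_nat p ^ i * (of_nat p * c (Suc i))" unfolding \<Delta>_nat using \<delta>(2)[OF cB] by (simp add: c_def)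
    finally show ?case by (simp add: algebra_simps)
  qed (simp add: c_def)
  have \<tau>B: "(\<tau> ^^ n) b \<in> B" for n
    unfolding newton \<Delta>_pow using cB B by (intro subring_sum subring_mult subring_power subring_of_nat)
  define L where "L = Max (insert m S)"
  have L: "m \<le> L" "\<And>s. s \<in> S \<Longrightarrow> s \<le> L" unfolding L_def using S(1) by auto
  let ?g = "\<lambda>i::nat. i - i div 2"
  obtain D e where D: "coprime D p" "\<And>i. i \<le> L \<Longrightarrow> D * p ^ i = p ^ ?g i * fact i * e i"
    using clear_factorials[OF p, of L] by metis
  define P where "P = (\<Sum>i\<le>L. smult (of_nat p ^ ?g i * (of_nat (e i) * c i)) (\<Prod>l<i. [:- of_nat l, 1:]))"
  have poly_P: "poly P (of_nat n) = of_nat D * (\<tau> ^^ n) b" if n: "n \<le> L" for n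
  proof -
    have "poly P (of_nat n) = (\<Sum>i\<le>L. of_nat D * (of_nat (n choose i) * (of_nat p ^ i * c i)))"
      unfolding P_def poly_sum poly_smult poly_prod
    proof (intro sum.cong refl)
      fix i assume "i \<in> {..L}"
      then have "D * p ^ i = p ^ ?g i * fact i * e i" using D(2) by simp
      then have *: "(of_nat D * of_nat p ^ i :: 'r) = of_nat p ^ ?g i * of_nat (fact i) * of_nat (e i)"
        by (metis of_nat_mult of_nat_power)
      have "(\<Prod>l<i. poly [:- of_nat l, 1:] (of_nat n :: 'r)) = of_nat (fact i * (n choose i))"
        unfolding falling_product[symmetric] by simp
      then have "of_nat p ^ ?g i * (of_nat (e i) * c i) * (\<Prod>l<i. poly [:- of_nat l, 1:] (of_nat n))
          = (of_nat p ^ ?g i * of_nat (fact i) * of_nat (e i)) * (of_nat (n choose i) * c i)"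
        by (simp only: of_nat_mult) (simp only: ac_simps)
      also have "\<dots> = of_nat D * (of_nat (n choose i) * (of_nat p ^ i * c i))"
        unfolding *[symmetric] by (simp only: ac_simps)
      finally show "of_nat p ^ ?g i * (of_nat (e i) * c i) * (\<Prod>l<i. poly [:- of_nat l, 1:] (of_nat n))
          = of_nat D * (of_nat (n choose i) * (of_nat p ^ i * c i))" .
    qed
    also have "\<dots> = (\<Sum>i\<le>n. of_nat D * (of_nat (n choose i) * (of_nat p ^ i * c i)))"
      using n by (intro sum.mono_neutral_right) (auto simp: binomial_eq_0)
    finally show ?thesis unfolding newton \<Delta>_pow by (simp add: sum_distrib_left)
  qed
  define C where "C j = {of_nat p ^ ?g j * x | x. x \<in> B}" for j
  have C_sub: "is_submodule (range of_int) (C j)" for j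
    unfolding C_def using B
    by (intro submodule_image_mult[OF submodule_anti[OF is_submodule_self[OF B]]]) auto
  have C_le: "C i \<subseteq> C j" if "j \<le> i" for i j
  proof
    fix x assume "x \<in> C i"
    then obtain y where y: "x = of_nat p ^ ?g i * y" "y \<in> B" unfolding C_def by auto
    have "?g i = ?g j + (?g i - ?g j)" using that by linarith
    then have "x = of_nat p ^ ?g j * (of_nat p ^ (?g i - ?g j) * y)"
      unfolding y(1) by (metis mult.assoc power_add)
    moreover have "of_nat p ^ (?g i - ?g j) * y \<in> B" using y B by (intro subring_mult subring_power) auto
    ultimately show "x \<in> C j" unfolding C_def by blast
  qed
  have coeff_P: "coeff P j \<in> C j" for j
    unfolding P_def coeff_sum coeff_smult
  proof (rule submodule_sum[OF C_sub])
    fix i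
    obtain k where k: "coeff (\<Prod>l<i. [:- of_nat l, 1:] :: 'r poly) j = of_int k" "i < j \<longrightarrow> k = 0"
      using coeff_falling_poly by blast
    have "of_nat (e i) * c i * of_int k \<in> B" using B cB by (intro subring_mult) auto
    then have "of_nat p ^ ?g i * (of_nat (e i) * c i) * of_int k \<in> C i"
      unfolding C_def by (auto simp: mult.assoc)
    then show "of_nat p ^ ?g i * (of_nat (e i) * c i) * coeff (\<Prod>l<i. [:- of_nat l, 1:]) j \<in> C j"
      using k C_le[of j i] submodule_0[OF C_sub] by (cases "i < j") auto
  qed
  have "\<exists>x\<in>C (card (int ` S)). poly P (of_int (int m)) - x \<in> I"
  proof (rule poly_many_roots[OF _ I C_sub _ coeff_P])
    show "finite (int ` S)" using S by simp
    show "C (Suc j) \<subseteq> C j" for j using C_le by simp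
    fix s assume "s \<in> int ` S"
    then obtain n where "s = int n" "n \<in> S" by blast
    then show "poly P (of_int s) \<in> I" using poly_P[of n] L S submodule_mult[OF I UNIV_I] by simp
  qed
  then obtain x where x: "x \<in> B" "of_nat D * (\<tau> ^^ m) b - of_nat p ^ ?g (card S) * x \<in> I"
    using poly_P[OF L(1)] unfolding C_def by (auto simp: card_image)
  \<comment> \<open>Remove the factor \<open>D\<close>, which is invertible modulo powers of \<open>p\<close>.\<close>
  let ?q = "p ^ ?g (card S)"
  have "coprime (int D) (int ?q)" using D(1) by simp
  then obtain u v where uv: "u * int D + v * int ?q = 1"
    using bezout_int[of "int D" "int ?q"] coprime_imp_gcd_eq_1 by metis
  have "(\<tau> ^^ m) b = of_int (u * int D + v * int ?q) * (\<tau> ^^ m) b" unfolding uv by simp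
  then have "(\<tau> ^^ m) b - of_nat p ^ ?g (card S) * (of_int u * x + of_int v * (\<tau> ^^ m) b)
    = of_int u * (of_nat D * (\<tau> ^^ m) b - of_nat p ^ ?g (card S) * x)"
    by (simp add: algebra_simps)
  then have "(\<tau> ^^ m) b - of_nat p ^ ?g (card S) * (of_int u * x + of_int v * (\<tau> ^^ m) b) \<in> I"
    using submodule_mult[OF I UNIV_I x(2), of "of_int u"] by simp
  moreover have "of_int u * x + of_int v * (\<tau> ^^ m) b \<in> B"
    using x \<tau>B B by (intro subring_add subring_mult) auto
  ultimately show ?thesis by blast
qed

section \<open>Rescaling at a finite residue ring\<close>

text \<open>Krull's theorem for a principal ideal generated by a non-zero-divisor. Dividing \<open>x\<close> repeatedly by \<open>p\<close>
  modulo \<open>I\<close> gives \<open>y\<^sub>0, y\<^sub>1, \<dots>\<close> with \<open>p y\<^sub>k\<^sub>+\<^sub>1 \<equiv> y\<^sub>k\<close>. The ideals \<open>I + (y\<^sub>k)\<close> increase, and where they stop,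
  \<open>y\<^sub>k\<^sub>+\<^sub>1\<close> is a multiple \<open>s y\<^sub>k \<equiv> s p y\<^sub>k\<^sub>+\<^sub>1\<close>.\<close>
lemma krull_intersection:
  fixes I B :: "'r::rat_algebra set"
  assumes B: "is_subring B" and noeth: "noetherian_between B B (I \<inter> B)"
    and I: "is_ideal I" and p: "0 < p"
    and x: "\<And>k. \<exists>y\<in>B. x - of_nat p ^ k * y \<in> I"
  shows "\<exists>s\<in>B. (1 - of_nat p * s) * x \<in> I"
proof -
  have IB: "is_submodule B (I \<inter> B)"
    using submodule_Int[OF submodule_anti[OF I subset_UNIV] is_submodule_self[OF B]] .
  obtain y where y: "\<And>k. y k \<in> B" "\<And>k. x - of_nat p ^ k * y k \<in> I" using x by metis
  have y_Suc: "of_nat p * y (Suc k) - y k \<in> I" for k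
  proof -
    have "(x - of_nat p ^ k * y k) - (x - of_nat p ^ Suc k * y (Suc k)) \<in> I"
      using submodule_diff[OF is_subring_UNIV I y(2) y(2)] .
    then have "of_nat (p ^ k) * (of_nat p * y (Suc k) - y k) \<in> I" by (simp add: algebra_simps)
    then show ?thesis using ideal_cancel_of_nat[OF I, of "p ^ k"] p by auto
  qed
  let ?L = "\<lambda>k. span_over B (I \<inter> B) [y k]"
  have L: "is_submodule B (?L k)" "I \<inter> B \<subseteq> ?L k" "?L k \<subseteq> B" for k
    using y(1) by (intro span_over_submodule[OF B IB] span_over_base[OF B]
       span_over_least[OF is_submodule_self[OF B]]; simp)+
  have "?L k \<subseteq> ?L (Suc k)" for k
  proof (rule span_over_least[OF L(1,2)])
    have "y k - of_nat p * y (Suc k) \<in> I \<inter> B"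
      using submodule_uminus[OF is_subring_UNIV I y_Suc[of k]] y(1) B
      by (auto intro!: subring_diff subring_mult)
    then have "(y k - of_nat p * y (Suc k)) + of_nat p * y (Suc k) \<in> ?L (Suc k)"
      unfolding span_over.simps using subring_of_nat[OF B] by blast
    then show "set [y k] \<subseteq> ?L (Suc k)" by simp
  qed
  then obtain n where n: "\<And>m. n \<le> m \<Longrightarrow> ?L m = ?L n"
    using noetherian_betweenD[OF noeth, of ?L] L by metis
  have "y (Suc n) \<in> ?L (Suc n)" by (rule span_over_mem[OF B IB]) simp
  then have "y (Suc n) \<in> ?L n" using n[OF le_SucI[OF order_refl]] by (simp only:)
  then obtain i s where i_s: "y (Suc n) = i + s * y n" "i \<in> I" "s \<in> B" by auto
  have "(1 - of_nat p * s) * y (Suc n) = i - s * (of_nat p * y (Suc n) - y n)"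
    using i_s(1) by (simp add: algebra_simps)
  also have "\<dots> \<in> I"
    by (rule submodule_diff[OF is_subring_UNIV I i_s(2) submodule_mult[OF I UNIV_I y_Suc]])
  finally have *: "(1 - of_nat p * s) * y (Suc n) \<in> I" .
  have "(1 - of_nat p * s) * x = (1 - of_nat p * s) * (x - of_nat p ^ Suc n * y (Suc n))
      + of_nat p ^ Suc n * ((1 - of_nat p * s) * y (Suc n))"
    by (simp add: algebra_simps)
  also have "\<dots> \<in> I"
    by (rule submodule_add[OF I submodule_mult[OF I UNIV_I y(2)] submodule_mult[OF I UNIV_I *]])
  finally show ?thesis using i_s(3) by blast
qed

text \<open>The ideal \<open>q\<close> and the prime \<open>p\<close> are those supplied by \<open>exists_finite_specialisation\<close>.\<close>
locale padic_scale =
  fixes A q Z I :: "'r::rat_algebra set" and p :: nat and u :: 'r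
  assumes A: "is_subring A" and q: "is_submodule A q" "q \<subseteq> A"
    and Z: "is_ideal Z" "Z \<subseteq> q"
    and I: "is_ideal I" "Z \<subseteq> I" "I \<inter> A \<subseteq> q"
    and q_cancel: "x \<in> A \<Longrightarrow> 0 < n \<Longrightarrow> of_nat n * x \<in> q \<Longrightarrow> x \<in> q"
    and p_nonunit: "v \<in> A \<Longrightarrow> 1 - of_nat p * v \<notin> q"
    and pu: "of_nat p * u = 1" and p_pos: "0 < p"
    and noeth: "noetherian_between A A Z"
begin

definition m where "m = {x + of_nat p * v | x v. x \<in> q \<and> v \<in> A}"
definition B where "B = subring_gen (A \<union> (\<lambda>x. u * x) ` m)"
text \<open>The elements of \<open>A\<close> divisible by \<open>p\<^sup>2\<close> in \<open>B\<close>. This ideal contains \<open>m\<^sup>2\<close>, has the same use, and spares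
  a definition of the product of ideals.\<close>
definition T where "T = {x \<in> A. u * (u * x) \<in> B}"

lemma p_u: "of_nat p * (u * x) = x"
  using pu by (simp add: mult.assoc[symmetric])

lemma q_m: "q \<subseteq> m"
  unfolding m_def using A by (force intro: exI[of _ 0])

lemma m_A: "m \<subseteq> A"
  unfolding m_def using A q by (auto intro!: subring_add subring_mult)

lemma m_submodule: "is_submodule A m"
  unfolding m_def using plus_multiples_submodule[OF A q(1)] .

lemma B: "is_subring B" "A \<subseteq> B" "\<And>x. x \<in> m \<Longrightarrow> u * x \<in> B"
  unfolding B_def by (auto intro: gen_subring gen_base)

lemma m_generators: obtains ws where "set ws \<subseteq> m" "m = span_over A Z ws"
  using noetherian_between_finitely_generated[OF A submodule_anti[OF Z(1) subset_UNIV] noeth m_submodule]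
    Z(2) q_m m_A by blast

text \<open>Finitely many generators of \<open>m\<close> suffice to generate \<open>B\<close> over \<open>A\<close>, so Hilbert's theorem applies.\<close>
lemma noeth_B: "noetherian_between B B Z"
proof -
  obtain ws where ws: "set ws \<subseteq> m" "m = span_over A Z ws" by (rule m_generators)
  let ?B = "subring_gen (A \<union> set (map ((*) u) ws))"
  have B': "is_subring ?B" "A \<subseteq> ?B" by (auto intro: gen_subring gen_base)
  have "span_over A Z ws \<subseteq> {x. u * x \<in> ?B}"
  proof (rule span_over_least)
    show "is_submodule A {x. u * x \<in> ?B}"
      using submodule_vimage_mult[OF submodule_anti[OF is_submodule_self[OF B'(1)] B'(2)]] .
    have "u * z \<in> ?B" if "z \<in> Z" for z
      using submodule_mult[OF Z(1) UNIV_I that, of u] Z(2) q(2) B'(2) by blast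
    then show "Z \<subseteq> {x. u * x \<in> ?B}" by blast
    show "set ws \<subseteq> {x. u * x \<in> ?B}" by (auto intro!: gen_base)
  qed
  then have "B \<subseteq> ?B" unfolding B_def ws(2)[symmetric] using B' by (intro gen_least) auto
  moreover have "?B \<subseteq> B" unfolding B_def using ws(1) by (intro gen_mono) auto
  ultimately have "B = ?B" by blast
  then show ?thesis
    using noetherian_between_gen[OF _ A Z(1) _ noeth, of "set (map ((*) u) ws)"] Z(2) q(2) by auto
qed

lemma T_submodule: "is_submodule A T"
proof -
  have "is_submodule A B" using submodule_anti[OF is_submodule_self[OF B(1)] B(2)] .
  then have "is_submodule A {x. u * (u * x) \<in> B}"
    using submodule_vimage_mult[OF submodule_vimage_mult, of A B u u] by simp
  from submodule_Int[OF is_submodule_self[OF A] this] show ?thesis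
    unfolding T_def by (rule back_subst[of "is_submodule A"]) auto
qed

lemma Z_T: "Z \<subseteq> T"
proof
  fix z assume "z \<in> Z"
  then have "u * (u * z) \<in> Z" by (intro submodule_mult[OF Z(1)]) auto
  then show "z \<in> T" unfolding T_def using \<open>z \<in> Z\<close> Z(2) q(2) B(2) by blast
qed

lemma m_m_T: "x \<in> m \<Longrightarrow> y \<in> m \<Longrightarrow> x * y \<in> T"
  unfolding T_def using subring_mult[OF B(1) B(3)[of x] B(3)[of y]] subring_mult[OF A, of x y] m_A
  by (auto simp: ac_simps)

lemma finite_index_T: assumes "finite_index A m" shows "finite_index A T"
proof -
  obtain ws where ws: "set ws \<subseteq> m" "m = span_over A Z ws" by (rule m_generators)
  have "finite_index (span_over A Z ws) T"
    by (rule finite_index_span[OF assms T_submodule Z_T]) (use m_m_T ws(1) in blast)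
  then have "finite_index m T" using ws(2) by simp
  then show ?thesis using finite_index_trans assms by blast
qed

text \<open>Each \<open>a \<in> B\<close> satisfies \<open>p\<^sup>k a \<in> q + p\<^sup>k A\<close> for some \<open>k\<close>: this holds for the generators and is preserved by
  the ring operations. In other words, the map from \<open>A\<close> to \<open>A/q\<close> extends to \<open>B\<close>, and \<open>p\<close> is not a unit in
  \<open>A/q\<close>.\<close>
lemma p_nonunit_B:
  assumes y: "y \<in> B" shows "1 - of_nat p * y \<notin> I"
proof
  assume i: "1 - of_nat p * y \<in> I"
  let ?P = "of_nat p :: 'r"
  define B' where "B' = {a. \<exists>k. \<exists>x\<in>q. \<exists>c\<in>A. ?P ^ k * a = x + ?P ^ k * c}"
  have PA: "?P ^ k \<in> A" for k using A by (intro subring_power) auto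
  have "is_subring B'"
    unfolding is_subring_def
  proof (intro conjI ballI)
    show "1 \<in> B'" unfolding B'_def using q(1) A
      by (intro CollectI exI[of _ 0] bexI[of _ 0] bexI[of _ 1]) auto
  next
    fix a b assume "a \<in> B'" "b \<in> B'"
    then obtain k x c l y d where a: "x \<in> q" "c \<in> A" "?P ^ k * a = x + ?P ^ k * c"
      and b: "y \<in> q" "d \<in> A" "?P ^ l * b = y + ?P ^ l * d"
      unfolding B'_def by blast
    have "?P ^ (k + l) * (a - b) = ?P ^ l * (?P ^ k * a) - ?P ^ k * (?P ^ l * b)"
      by (simp add: power_add algebra_simps)
    also have "\<dots> = (?P ^ l * x - ?P ^ k * y) + ?P ^ (k + l) * (c - d)"
      unfolding a b by (simp add: power_add algebra_simps)
    finally have eq: "?P ^ (k + l) * (a - b) = (?P ^ l * x - ?P ^ k * y) + ?P ^ (k + l) * (c - d)" .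
    have "?P ^ l * x - ?P ^ k * y \<in> q"
      by (rule submodule_diff[OF A q(1) submodule_mult[OF q(1) PA a(1)] submodule_mult[OF q(1) PA b(1)]])
    then show "a - b \<in> B'" unfolding B'_def using eq subring_diff[OF A a(2) b(2)] by blast
    have "?P ^ (k + l) * (a * b) = (?P ^ k * a) * (?P ^ l * b)"
      by (simp add: power_add algebra_simps)
    also have "\<dots> = (y * x + (?P ^ l * d) * x + (?P ^ k * c) * y) + ?P ^ (k + l) * (c * d)"
      unfolding a b by (simp add: power_add algebra_simps)
    finally have eq: "?P ^ (k + l) * (a * b) = (y * x + (?P ^ l * d) * x + (?P ^ k * c) * y) + ?P ^ (k + l) * (c * d)" .
    have "y * x + (?P ^ l * d) * x + (?P ^ k * c) * y \<in> q"
      using a b q(2) by (intro submodule_add[OF q(1)] submodule_mult[OF q(1)] subring_mult[OF A] PA) auto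
    then show "a * b \<in> B'" unfolding B'_def using eq subring_mult[OF A a(2) b(2)] by blast
  qed
  moreover have "A \<subseteq> B'"
  proof
    fix a assume "a \<in> A"
    then show "a \<in> B'" unfolding B'_def using q(1)
      by (intro CollectI exI[of _ 0] bexI[of _ 0] bexI[of _ a]) auto
  qed
  moreover have "(\<lambda>x. u * x) ` m \<subseteq> B'"
  proof
    fix a assume "a \<in> (\<lambda>x. u * x) ` m"
    then obtain x v where "a = u * (x + ?P * v)" "x \<in> q" "v \<in> A" unfolding m_def by blast
    then show "a \<in> B'" unfolding B'_def
      by (intro CollectI exI[of _ 1] bexI[of _ x] bexI[of _ v]) (auto simp: p_u)
  qed
  ultimately have "B \<subseteq> B'" unfolding B_def by (intro gen_least) auto
  then obtain k x c where x: "x \<in> q" "c \<in> A" "?P ^ k * y = x + ?P ^ k * c"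
    using y unfolding B'_def by blast
  have "?P ^ k * (1 - ?P * y) = ?P ^ k - ?P * (?P ^ k * y)" by (simp add: algebra_simps)
  then have eq: "?P ^ k * (1 - ?P * y) = ?P ^ k * (1 - ?P * c) - ?P * x" unfolding x(3) by (simp add: algebra_simps)
  have xA: "x \<in> A" using x(1) q(2) by blast
  have PA1: "?P \<in> A" using A by simp
  have "?P ^ k * (1 - ?P * c) - ?P * x \<in> A"
    by (intro subring_diff[OF A] subring_mult[OF A] PA PA1 subring_1[OF A] x(2) xA)
  then have "?P ^ k * (1 - ?P * y) \<in> I \<inter> A" unfolding eq using submodule_mult[OF I(1) UNIV_I i, of "?P ^ k"] eq by simp
  then have "?P ^ k * (1 - ?P * c) - ?P * x \<in> q" using I(3) unfolding eq by blast
  then have "(?P ^ k * (1 - ?P * c) - ?P * x) + ?P * x \<in> q"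
    by (rule submodule_add[OF q(1) _ submodule_mult[OF q(1) PA1 x(1)]])
  then have "of_nat (p ^ k) * (1 - ?P * c) \<in> q" by simp
  moreover have "1 - ?P * c \<in> A" by (intro subring_diff[OF A] subring_mult[OF A] PA1 subring_1[OF A] x(2))
  ultimately have "1 - ?P * c \<in> q" using q_cancel[of "1 - ?P * c" "p ^ k"] p_pos by simp
  then show False using p_nonunit[OF x(2)] by simp
qed

text \<open>The elements \<open>x\<close> of \<open>B\<close> with \<open>\<tau> x - x \<in> p B\<close> form a subring. It contains \<open>A\<close> because \<open>T \<subseteq> p\<^sup>2 B\<close>, and
  \<open>m/p\<close> because one factor \<open>p\<close> is left after division by \<open>p\<close>.\<close>
lemma iterate_close:
  assumes add: "\<And>x y. \<tau> (x + y) = \<tau> x + \<tau> y" and mult: "\<And>x y. \<tau> (x * y) = \<tau> x * \<tau> y" and one: "\<tau> 1 = 1"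
    and \<tau>T: "\<And>a. a \<in> A \<Longrightarrow> \<tau> a - a \<in> T"
    and x: "x \<in> B"
  shows "\<exists>y\<in>B. \<tau> x = x + of_nat p * y"
proof -
  let ?P = "of_nat p :: 'r"
  have \<tau>0: "\<tau> 0 = 0" using add[of 0 0] by simp
  have \<tau>_nat: "\<tau> (of_nat k) = of_nat k" for k
    by (induction k) (auto simp: add one \<tau>0)
  have \<tau>_diff: "\<tau> (x - y) = \<tau> x - \<tau> y" for x y using add[of "x - y" y] by (simp add: algebra_simps)
  \<comment> \<open>\<open>\<tau>\<close> fixes \<open>p\<close>, hence its inverse \<open>u\<close>.\<close>
  have "\<tau> u = ?P * (u * \<tau> u)" by (simp only: p_u)
  also have "\<dots> = u * (?P * \<tau> u)" by (simp only: mult.left_commute)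
  also have "?P * \<tau> u = \<tau> (?P * u)" unfolding mult \<tau>_nat ..
  finally have \<tau>u: "\<tau> u = u" by (simp add: pu one)
  let ?B = "{x \<in> B. \<exists>y\<in>B. \<tau> x = x + ?P * y}"
  have PB: "?P \<in> B" using B(1) by simp
  have "is_subring ?B"
    unfolding is_subring_def
  proof (intro conjI ballI)
    show "1 \<in> ?B" using B(1) one by (auto intro!: bexI[of _ 0])
  next
    fix a b assume "a \<in> ?B" "b \<in> ?B"
    then obtain c d where *: "a \<in> B" "b \<in> B" "c \<in> B" "d \<in> B" "\<tau> a = a + ?P * c" "\<tau> b = b + ?P * d" by auto
    have "\<tau> (a - b) = (a - b) + ?P * (c - d)" unfolding \<tau>_diff *(5,6) by (simp add: algebra_simps)
    then show "a - b \<in> ?B" using subring_diff[OF B(1)] * by blast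
    have "\<tau> (a * b) = a * b + ?P * (a * d + c * b + ?P * (c * d))" unfolding mult *(5,6) by (simp add: algebra_simps)
    moreover have "a * d + c * b + ?P * (c * d) \<in> B"
      by (intro subring_add[OF B(1)] subring_mult[OF B(1)] PB *)
    ultimately show "a * b \<in> ?B" using subring_mult[OF B(1)] *(1,2) by blast
  qed
  moreover have "A \<subseteq> ?B"
  proof
    fix a assume a: "a \<in> A"
    then have t: "u * (u * (\<tau> a - a)) \<in> B" using \<tau>T unfolding T_def by blast
    have "\<tau> a = a + ?P * (?P * (u * (u * (\<tau> a - a))))" by (simp add: p_u)
    then show "a \<in> ?B" using subring_mult[OF B(1) PB t] a B(2) by blast
  qed
  moreover have "(\<lambda>x. u * x) ` m \<subseteq> ?B"
  proof
    fix a assume "a \<in> (\<lambda>x. u * x) ` m"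
    then obtain b where b: "a = u * b" "b \<in> m" by blast
    then have t: "u * (u * (\<tau> b - b)) \<in> B" using \<tau>T m_A unfolding T_def by blast
    have "\<tau> a = a + ?P * (u * (u * (\<tau> b - b)))"
      unfolding b(1) mult \<tau>u p_u by (simp add: algebra_simps)
    then show "a \<in> ?B" using t B(3) b by blast
  qed
  ultimately have "B \<subseteq> ?B" unfolding B_def[symmetric] by (subst B_def) (intro gen_least, auto)
  then show ?thesis using x by blast
qed

end

section \<open>Eventually periodic sets of integers\<close>

text \<open>One modulus for all classes. Unlike a presentation as a union of progressions and a finite set, this
  form passes to intersections at once.\<close>
definition eventually_periodic :: "int set \<Rightarrow> bool" where
  "eventually_periodic S \<longleftrightarrow> (\<exists>N>0. \<forall>r. finite {k. r + N * k \<in> S} \<or> (\<forall>k. r + N * k \<in> S))"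

text \<open>The full residue classes are the progressions, the others contribute finitely many integers.\<close>
lemma eventually_periodic_SML:
  assumes "eventually_periodic S" shows "two_sided_SML S"
proof -
  obtain N where N: "0 < N" "\<And>r. finite {k. r + N * k \<in> S} \<or> (\<forall>k. r + N * k \<in> S)"
    using assms unfolding eventually_periodic_def by blast
  define Full where "Full = {r \<in> {0..<N}. \<forall>k. r + N * k \<in> S}"
  define F where "F = (\<Union>r\<in>{0..<N} - Full. (\<lambda>k. r + N * k) ` {k. r + N * k \<in> S})"
  have "finite Full" unfolding Full_def by (rule finite_subset[of _ "{0..<N}"]) auto
  moreover have "finite F" unfolding Full_def F_def using N(2) by auto
  ultimately have fin: "finite Full" "finite F" .
  have "S = (\<Union>(a, b)\<in>Pair N ` Full. {a * n + b | n. True}) \<union> F"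
  proof (intro equalityI subsetI)
    fix n assume n: "n \<in> S"
    have r: "n mod N \<in> {0..<N}" "n = n mod N + N * (n div N)" using N(1) by auto
    show "n \<in> (\<Union>(a, b)\<in>Pair N ` Full. {a * n + b | n. True}) \<union> F"
    proof (cases "n mod N \<in> Full")
      case True
      have "n = N * (n div N) + n mod N" by simp
      then show ?thesis using True by blast
    next
      case False
      then have "n mod N \<in> {0..<N} - Full" "n div N \<in> {k. n mod N + N * k \<in> S}" using r n by auto
      then have "n mod N + N * (n div N) \<in> F" unfolding F_def by blast
      then show ?thesis using r(2) by simp
    qed
  next
    fix n assume "n \<in> (\<Union>(a, b)\<in>Pair N ` Full. {a * n + b | n. True}) \<union> F"
    then consider r k where "r \<in> Full" "n = N * k + r" | "n \<in> F" by auto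
    then show "n \<in> S"
    proof cases
      case 1
      then have "r + N * k \<in> S" unfolding Full_def by blast
      then show ?thesis using 1(2) by (simp add: add.commute)
    next
      case 2
      then show ?thesis unfolding F_def by auto
    qed
  qed
  then show ?thesis unfolding two_sided_SML_def
    using fin by (intro exI[of _ "Pair N ` Full"] exI[of _ F] conjI finite_imageI)
qed

lemma eventually_periodic_Int:
  assumes "eventually_periodic S" "eventually_periodic S'" shows "eventually_periodic (S \<inter> S')"
proof -
  obtain N where N: "0 < N" "\<And>r. finite {k. r + N * k \<in> S} \<or> (\<forall>k. r + N * k \<in> S)"
    using assms(1) unfolding eventually_periodic_def by blast
  obtain M where M: "0 < M" "\<And>r. finite {k. r + M * k \<in> S'} \<or> (\<forall>k. r + M * k \<in> S')"
    using assms(2) unfolding eventually_periodic_def by blast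
  have pull: "finite {k. L * k \<in> U}" if "0 < L" "finite U" for L :: int and U
    using finite_vimageI[OF that(2), of "(*) L"] that(1) by (simp add: vimage_def inj_on_def)
  have "finite {k. r + (N * M) * k \<in> S \<inter> S'} \<or> (\<forall>k. r + (N * M) * k \<in> S \<inter> S')" for r
  proof (cases "(\<forall>k. r + N * k \<in> S) \<and> (\<forall>k. r + M * k \<in> S')")
    case True
    then have "r + N * (M * k) \<in> S" "r + M * (N * k) \<in> S'" for k by blast+
    then show ?thesis by (simp add: ac_simps)
  next
    case False
    then consider "finite {k. r + N * k \<in> S}" | "finite {k. r + M * k \<in> S'}" using N(2) M(2) by blast
    then have "finite {k. M * k \<in> {k. r + N * k \<in> S}} \<or> finite {k. N * k \<in> {k. r + M * k \<in> S'}}"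
      using pull N(1) M(1) by metis
    then have "finite {k. r + (N * M) * k \<in> S \<inter> S'}"
      by (elim disjE) (erule rev_finite_subset, force simp: ac_simps)+
    then show ?thesis by blast
  qed
  then show ?thesis unfolding eventually_periodic_def using N(1) M(1) by (intro exI[of _ "N * M"]) simp
qed

lemma eventually_periodic_UNIV: "eventually_periodic UNIV"
  unfolding eventually_periodic_def by (auto intro: exI[of _ 1])

lemma eventually_periodic_uminus:
  assumes "eventually_periodic S" shows "eventually_periodic {n. - n \<in> S}"
proof -
  obtain N where N: "0 < N" "\<And>r. finite {k. r + N * k \<in> S} \<or> (\<forall>k. r + N * k \<in> S)"
    using assms unfolding eventually_periodic_def by blast
  have "finite {k. r + N * k \<in> {n. - n \<in> S}} \<or> (\<forall>k. r + N * k \<in> {n. - n \<in> S})" for r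
  proof (cases "\<forall>k. - r + N * k \<in> S")
    case True
    have "- (r + N * k) \<in> S" for k using True[rule_format, of "- k"] by simp
    then show ?thesis by simp
  next
    case False
    then have "finite (uminus ` {k. - r + N * k \<in> S})" using N(2) by blast
    then have "finite {k. r + N * k \<in> {n. - n \<in> S}}"
    proof (rule rev_finite_subset, intro subsetI)
      fix k assume "k \<in> {k. r + N * k \<in> {n. - n \<in> S}}"
      moreover have "- (r + N * k) = - r + N * (- k)" by simp
      ultimately have "- r + N * (- k) \<in> S" by (metis mem_Collect_eq)
      then have "- k \<in> {k. - r + N * k \<in> S}" by (rule CollectI)
      then show "k \<in> uminus ` {k. - r + N * k \<in> S}" by (intro image_eqI[of _ uminus "- k"]) simp
    qed
    then show ?thesis by blast
  qed
  then show ?thesis unfolding eventually_periodic_def using N(1) by blast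
qed

section \<open>Orbits under an automorphism\<close>

text \<open>The subring \<open>K\<close> is a field modulo \<open>Z\<close>, and a field has only two ideals.\<close>
lemma noetherian_between_field:
  assumes K: "is_subring K" and Z: "is_ideal Z" and inv: "\<And>b. b \<in> K \<Longrightarrow> b \<notin> Z \<Longrightarrow> \<exists>c\<in>K. b * c - 1 \<in> Z"
  shows "noetherian_between K K Z"
  unfolding noetherian_between_def
proof (intro allI impI)
  fix f :: "nat \<Rightarrow> 'a set"
  assume "\<forall>n. is_submodule K (f n) \<and> Z \<subseteq> f n \<and> f n \<subseteq> K \<and> f n \<subseteq> f (Suc n)"
  then have f: "is_submodule K (f n)" "Z \<subseteq> f n" "f n \<subseteq> K" "f n \<subseteq> f (Suc n)" for n by auto
  have full: "f n = K" if n: "\<not> f n \<subseteq> Z" for n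
  proof -
    obtain b where b: "b \<in> f n" "b \<notin> Z" using n by blast
    then obtain c where c: "c \<in> K" "b * c - 1 \<in> Z" using inv f(3) by blast
    have "c * b - (b * c - 1) \<in> f n"
      using submodule_diff[OF K f(1) submodule_mult[OF f(1) c(1) b(1)] subsetD[OF f(2) c(2)]] .
    then have one: "1 \<in> f n" by (simp add: mult.commute)
    have "x \<in> f n" if "x \<in> K" for x using submodule_mult[OF f(1) that one] by simp
    then show ?thesis using f(3) by blast
  qed
  show "\<exists>n. \<forall>m\<ge>n. f m = f n"
  proof (cases "\<exists>n. \<not> f n \<subseteq> Z")
    case True
    then obtain n where n: "\<not> f n \<subseteq> Z" by blast
    have "f m = f n" if "n \<le> m" for m
      using full[OF n] full[of m] n lift_Suc_mono_le[of f, OF f(4) that] by blast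
    then show ?thesis by blast
  next
    case False
    then have "f n = Z" for n using f(2) by blast
    then show ?thesis by simp
  qed
qed

lemma gen_finite_support:
  assumes "x \<in> subring_gen (K \<union> H)"
  shows "\<exists>F. finite F \<and> F \<subseteq> K \<and> x \<in> subring_gen (F \<union> H)"
proof -
  let ?S = "{x. \<exists>F. finite F \<and> F \<subseteq> K \<and> x \<in> subring_gen (F \<union> H)}"
  have "is_subring ?S"
    unfolding is_subring_def
  proof (intro conjI ballI)
    show "1 \<in> ?S" using subring_1[OF gen_subring] by blast
  next
    fix x y assume "x \<in> ?S" "y \<in> ?S"
    then obtain F F' where F: "finite F" "F \<subseteq> K" "x \<in> subring_gen (F \<union> H)"
      "finite F'" "F' \<subseteq> K" "y \<in> subring_gen (F' \<union> H)" by blast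
    have "subring_gen (F \<union> H) \<subseteq> subring_gen ((F \<union> F') \<union> H)" "subring_gen (F' \<union> H) \<subseteq> subring_gen ((F \<union> F') \<union> H)"
      by (intro gen_mono; blast)+
    then have xy: "x \<in> subring_gen ((F \<union> F') \<union> H)" "y \<in> subring_gen ((F \<union> F') \<union> H)" using F by auto
    have FF: "finite (F \<union> F')" "F \<union> F' \<subseteq> K" using F by auto
    show "x - y \<in> ?S" using subring_diff[OF gen_subring xy] FF by blast
    show "x * y \<in> ?S" using subring_mult[OF gen_subring xy] FF by blast
  qed
  moreover have "K \<union> H \<subseteq> ?S"
  proof
    fix x assume "x \<in> K \<union> H"
    then have "x \<in> subring_gen ({x} \<inter> K \<union> H)" by (intro gen_base) auto
    then show "x \<in> ?S" by (intro CollectI exI[of _ "{x} \<inter> K"]) auto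
  qed
  ultimately show ?thesis using gen_least assms by blast
qed

text \<open>The automorphism acts on the ambient ring; the ring of interest is its quotient by the invariant
  ideal \<open>Z\<close>.\<close>
locale ring_automorphism =
  fixes \<sigma> :: "'r::rat_algebra \<Rightarrow> 'r" and Z :: "'r set"
  assumes bij: "bij \<sigma>"
    and add: "\<sigma> (x + y) = \<sigma> x + \<sigma> y" and mult: "\<sigma> (x * y) = \<sigma> x * \<sigma> y" and one: "\<sigma> 1 = 1"
    and Z: "is_ideal Z" "z \<in> Z \<Longrightarrow> \<sigma> z \<in> Z" "z \<in> Z \<Longrightarrow> inv_into UNIV \<sigma> z \<in> Z"
begin

abbreviation inv_\<sigma> :: "'r \<Rightarrow> 'r" where "inv_\<sigma> \<equiv> inv_into UNIV \<sigma>"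

abbreviation it :: "int \<Rightarrow> 'r \<Rightarrow> 'r" where "it \<equiv> int_iterate UNIV \<sigma>"

definition invariant :: "'r set \<Rightarrow> bool" where
  "invariant A \<longleftrightarrow> (\<forall>b\<in>A. \<sigma> b \<in> A \<and> inv_\<sigma> b \<in> A)"

lemma inverse_simps [simp]: "inv_\<sigma> (\<sigma> x) = x" "\<sigma> (inv_\<sigma> x) = x"
  using bij by (simp_all add: bij_is_inj bij_is_surj surj_f_inv_f)

lemma \<sigma>_inject: "\<sigma> x = \<sigma> y \<Longrightarrow> x = y"
  using bij by (simp add: bij_def inj_eq)

lemma inv_hom: "inv_\<sigma> (x + y) = inv_\<sigma> x + inv_\<sigma> y" "inv_\<sigma> (x * y) = inv_\<sigma> x * inv_\<sigma> y" "inv_\<sigma> 1 = 1"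
  by (rule \<sigma>_inject, simp add: add mult one)+

lemma diff: "\<sigma> (x - y) = \<sigma> x - \<sigma> y"
  using add[of "x - y" y] by (simp add: algebra_simps)

lemma inv_diff: "inv_\<sigma> (x - y) = inv_\<sigma> x - inv_\<sigma> y"
  by (rule \<sigma>_inject) (simp add: diff)

lemma funpow_hom:
  "(\<sigma> ^^ n) (x + y) = (\<sigma> ^^ n) x + (\<sigma> ^^ n) y" "(\<sigma> ^^ n) (x - y) = (\<sigma> ^^ n) x - (\<sigma> ^^ n) y"
  "(\<sigma> ^^ n) (x * y) = (\<sigma> ^^ n) x * (\<sigma> ^^ n) y" "(\<sigma> ^^ n) 1 = 1"
  by (induction n) (auto simp: add diff mult one)

lemma zero: "\<sigma> 0 = 0" using add[of 0 0] by simp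

lemma of_int: "\<sigma> (of_int k) = of_int k"
proof -
  have nat: "\<sigma> (of_nat n) = of_nat n" for n by (induction n) (auto simp: add one zero)
  show ?thesis by (cases k) (auto simp: nat diff zero one add diff[of 0, simplified zero, simplified] simp del: of_nat_Suc)
qed

lemma inv_of_int: "inv_\<sigma> (of_int k) = of_int k"
  by (rule \<sigma>_inject) (simp add: of_int)

lemma it_0 [simp]: "it 0 x = x"
  by (simp add: int_iterate_def)

lemma it_Suc: "it (n + 1) x = \<sigma> (it n x)"
proof (cases "0 \<le> n")
  case True
  then have "nat (n + 1) = Suc (nat n)" by simp
  then show ?thesis using True by (simp add: int_iterate_def)
next
  case False
  then have *: "nat (- n) = Suc (nat (- (n + 1)))" by simp
  have "it (n + 1) x = (inv_\<sigma> ^^ nat (- (n + 1))) x" using False by (auto simp: int_iterate_def)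
  then show ?thesis using False * by (simp add: int_iterate_def)
qed

lemma it_add: "it (m + n) x = it m (it n x)"
proof (induction m rule: int_induct[of _ 0])
  case base
  then show ?case by simp
next
  case (step1 i)
  have "it (i + 1 + n) x = \<sigma> (it (i + n) x)" using it_Suc[of "i + n" x] by (simp add: algebra_simps)
  then show ?case using step1 it_Suc by simp
next
  case (step2 i)
  have "\<sigma> (it (i - 1 + n) x) = it (i + n) x" using it_Suc[of "i - 1 + n" x] by (simp add: algebra_simps)
  also have "\<dots> = \<sigma> (it (i - 1) (it n x))" using step2 it_Suc[of "i - 1" "it n x"] by simp
  finally show ?case by (rule \<sigma>_inject)
qed

lemma it_nat: "it (int n) x = (\<sigma> ^^ n) x"
  by (simp add: int_iterate_def)

lemma it_invariant:
  assumes "\<And>a. a \<in> A \<Longrightarrow> \<sigma> a \<in> A" "\<And>a. a \<in> A \<Longrightarrow> inv_\<sigma> a \<in> A" "a \<in> A"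
  shows "it n a \<in> A"
proof -
  have "(\<sigma> ^^ k) a \<in> A" "(inv_\<sigma> ^^ k) a \<in> A" for k by (induction k) (use assms in auto)
  then show ?thesis by (simp add: int_iterate_def)
qed

lemma it_hom: "it n (x + y) = it n x + it n y" "it n (x * y) = it n x * it n y"
proof -
  have "(inv_\<sigma> ^^ k) (x + y) = (inv_\<sigma> ^^ k) x + (inv_\<sigma> ^^ k) y"
    "(inv_\<sigma> ^^ k) (x * y) = (inv_\<sigma> ^^ k) x * (inv_\<sigma> ^^ k) y" for k
    by (induction k) (auto simp: inv_hom)
  then show "it n (x + y) = it n x + it n y" "it n (x * y) = it n x * it n y"
    by (auto simp: int_iterate_def funpow_hom)
qed

text \<open>Modulo \<open>T\<close> there are only finitely many possibilities for the images of the generators \<open>G\<close> under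
  \<open>\<sigma>\<^sup>n\<close>, so two powers \<open>\<sigma>\<^sup>i\<close> and \<open>\<sigma>\<^sup>j\<close> agree modulo \<open>T\<close> on \<open>G\<close>, hence on \<open>A\<close>. Since \<open>\<sigma>\<^sup>i\<close> maps \<open>A\<close> onto itself,
  \<open>\<sigma>\<^sup>j\<^sup>-\<^sup>i\<close> is trivial modulo \<open>T\<close>.\<close>
lemma iterate_trivial_modulo:
  assumes A: "is_subring A" "A = subring_gen (ints_plus Z \<union> G)" "finite G"
    and \<sigma>A: "\<And>a. a \<in> A \<Longrightarrow> \<sigma> a \<in> A" "\<And>a. a \<in> A \<Longrightarrow> inv_\<sigma> a \<in> A"
    and T: "is_submodule A T" "Z \<subseteq> T" "finite_index A T"
  shows "\<exists>N>0. \<forall>a\<in>A. (\<sigma> ^^ N) a - a \<in> T"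
proof -
  have pow: "(\<sigma> ^^ n) a \<in> A" "(inv_\<sigma> ^^ n) a \<in> A" if "a \<in> A" for a n
    by (induction n) (use \<sigma>A that in auto)
  have powZ: "(\<sigma> ^^ n) z \<in> Z" if "z \<in> Z" for z n
    by (induction n) (use Z that in auto)
  have pow_int: "(\<sigma> ^^ n) (of_int k) = of_int k" for n k
    by (induction n) (auto simp: of_int)
  have GA: "G \<subseteq> A" unfolding A(2) by (auto intro: gen_base)
  obtain F where F: "finite F" "\<forall>a\<in>A. \<exists>f\<in>F. a - f \<in> T" using T(3) unfolding finite_index_def by blast
  then obtain \<rho> where \<rho>: "\<And>a. a \<in> A \<Longrightarrow> \<rho> a \<in> F" "\<And>a. a \<in> A \<Longrightarrow> a - \<rho> a \<in> T" by metis
  define \<phi> where "\<phi> n = restrict (\<lambda>x. \<rho> ((\<sigma> ^^ n) x)) G" for n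
  have "range \<phi> \<subseteq> PiE G (\<lambda>_. F)" unfolding \<phi>_def using \<rho>(1) pow GA by auto
  moreover have "finite (PiE G (\<lambda>_. F))" using A(3) F(1) by (intro finite_PiE) auto
  ultimately have "finite (range \<phi>)" by (rule finite_subset)
  then have "\<not> inj \<phi>" using finite_imageD[of \<phi> UNIV] by auto
  then obtain i j where ij: "i < j" "\<phi> i = \<phi> j"
    unfolding inj_def by (metis linorder_neqE_nat)
  let ?S = "{a \<in> A. (\<sigma> ^^ j) a - (\<sigma> ^^ i) a \<in> T}"
  have "is_subring ?S"
    unfolding is_subring_def
  proof (intro conjI ballI)
    show "1 \<in> ?S" using A(1) T(1) by (simp add: funpow_hom)
  next
    fix a b assume "a \<in> ?S" "b \<in> ?S"
    then have ab: "a \<in> A" "b \<in> A" "(\<sigma> ^^ j) a - (\<sigma> ^^ i) a \<in> T" "(\<sigma> ^^ j) b - (\<sigma> ^^ i) b \<in> T" by auto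
    have "(\<sigma> ^^ j) (a - b) - (\<sigma> ^^ i) (a - b) = ((\<sigma> ^^ j) a - (\<sigma> ^^ i) a) - ((\<sigma> ^^ j) b - (\<sigma> ^^ i) b)"
      by (simp add: funpow_hom)
    then show "a - b \<in> ?S" using submodule_diff[OF A(1) T(1) ab(3,4)] subring_diff[OF A(1) ab(1,2)] by simp
    have "(\<sigma> ^^ j) (a * b) - (\<sigma> ^^ i) (a * b)
        = (\<sigma> ^^ j) b * ((\<sigma> ^^ j) a - (\<sigma> ^^ i) a) + (\<sigma> ^^ i) a * ((\<sigma> ^^ j) b - (\<sigma> ^^ i) b)"
      by (simp add: funpow_hom algebra_simps)
    moreover have "\<dots> \<in> T"
      by (rule submodule_add[OF T(1) submodule_mult[OF T(1) pow(1)[OF ab(2)] ab(3)] submodule_mult[OF T(1) pow(1)[OF ab(1)] ab(4)]])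
    ultimately show "a * b \<in> ?S" using subring_mult[OF A(1) ab(1,2)] by simp
  qed
  moreover have "ints_plus Z \<subseteq> ?S"
  proof
    fix a assume a: "a \<in> ints_plus Z"
    then obtain k z where kz: "a = of_int k + z" "z \<in> Z" by (auto simp: ints_plus_def)
    have "(\<sigma> ^^ j) a - (\<sigma> ^^ i) a = (\<sigma> ^^ j) z - (\<sigma> ^^ i) z" unfolding kz(1) funpow_hom pow_int by simp
    also have "\<dots> \<in> Z" by (rule submodule_diff[OF is_subring_UNIV Z(1) powZ[OF kz(2)] powZ[OF kz(2)]])
    finally show "a \<in> ?S" using T(2) a unfolding A(2) by (auto intro: gen_base)
  qed
  moreover have "G \<subseteq> ?S"
  proof
    fix x assume x: "x \<in> G"
    then have xA: "x \<in> A" using GA by blast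
    have "\<rho> ((\<sigma> ^^ i) x) = \<rho> ((\<sigma> ^^ j) x)" using fun_cong[OF ij(2), of x] x unfolding \<phi>_def by simp
    then have "((\<sigma> ^^ j) x - \<rho> ((\<sigma> ^^ j) x)) - ((\<sigma> ^^ i) x - \<rho> ((\<sigma> ^^ i) x)) = (\<sigma> ^^ j) x - (\<sigma> ^^ i) x" by simp
    then show "x \<in> ?S" using submodule_diff[OF A(1) T(1) \<rho>(2)[OF pow(1)[OF xA, of j]] \<rho>(2)[OF pow(1)[OF xA, of i]]] xA
      by simp
  qed
  ultimately have "A \<subseteq> ?S" unfolding A(2) by (intro gen_least) auto
  have "(\<sigma> ^^ (j - i)) a - a \<in> T" if "a \<in> A" for a
  proof -
    have inv: "(\<sigma> ^^ i) ((inv_\<sigma> ^^ i) a) = a"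
    proof (induction i arbitrary: a)
      case (Suc i)
      have "(inv_\<sigma> ^^ Suc i) a = (inv_\<sigma> ^^ i) (inv_\<sigma> a)"
        by (simp only: funpow_Suc_right o_apply)
      then show ?case using Suc[of "inv_\<sigma> a"] by (simp only: funpow.simps(2) o_apply inverse_simps)
    qed simp
    have "(inv_\<sigma> ^^ i) a \<in> ?S" using \<open>A \<subseteq> ?S\<close> pow(2)[OF that] by blast
    moreover have "(\<sigma> ^^ j) b = (\<sigma> ^^ (j - i)) ((\<sigma> ^^ i) b)" for b
      using ij(1) by (metis add_diff_inverse_nat funpow_add less_imp_not_less add.commute o_apply)
    ultimately show ?thesis using inv by simp
  qed
  then show ?thesis using ij(1) by (intro exI[of _ "j - i"]) auto
qed

text \<open>The heart of the proof. In a class \<open>r + N k\<close> with infinitely many zeros, any prescribed number of them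
  together with a target index lies above some \<open>l\<close>; shifting the orbit by \<open>l\<close> makes all exponents
  nonnegative, and \<open>iterate_many_zeros\<close> puts the value at the target into \<open>I + p\<^sup>j B\<close> for every \<open>j\<close>.\<close>
theorem primary_eventually_periodic:
  assumes I: "is_ideal I" "Z \<subseteq> I" "1 \<notin> I"
    and primary: "\<And>x y. x * y \<in> I \<Longrightarrow> x \<in> I \<or> (\<exists>k. y ^ k \<in> I)"
    and G: "finite G" and A: "A = subring_gen (ints_plus Z \<union> G)"
    and \<sigma>A: "\<And>a. a \<in> A \<Longrightarrow> \<sigma> a \<in> A" "\<And>a. a \<in> A \<Longrightarrow> inv_\<sigma> a \<in> A" and a: "a \<in> A"
  shows "eventually_periodic {n. it n a \<in> I}"
proof -
  have subA: "is_subring A" unfolding A by (rule gen_subring)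
  obtain p :: nat and q where p: "prime p" "2 < p" and q: "is_submodule A q" "q \<subseteq> A" "I \<inter> A \<subseteq> q"
    and q_cancel: "\<And>n x. x \<in> A \<Longrightarrow> 0 < n \<Longrightarrow> of_nat n * x \<in> q \<Longrightarrow> x \<in> q"
    and p_nonunit: "\<And>v. v \<in> A \<Longrightarrow> 1 - of_nat p * v \<notin> q"
    and fi: "finite_index A {x + of_nat p * v | x v. x \<in> q \<and> v \<in> A}"
    using exists_finite_specialisation[OF Z(1) I G A] by (elim exE conjE, intro that) auto
  obtain u :: 'r where u: "of_nat p * u = 1" using of_nat_invertible[of p] p by auto
  have RA: "ints_plus Z \<subseteq> A" unfolding A by (auto intro: gen_base)
  have ZA: "Z \<subseteq> A" using RA ints_plus_base by blast
  have noethA: "noetherian_between A A Z" unfolding A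
    by (rule noetherian_between_gen[OF G ints_plus_subring[OF Z(1)] Z(1) ints_plus_base noetherian_between_ints_plus[OF Z(1)]])
  interpret ps: padic_scale A q Z I p u
    using subA q Z(1) I(1,2) q_cancel p_nonunit u p(2) noethA ZA by unfold_locales auto
  have "finite_index A ps.T" using ps.finite_index_T fi unfolding ps.m_def by blast
  from iterate_trivial_modulo[OF subA A G \<sigma>A ps.T_submodule ps.Z_T this]
  obtain N where N: "0 < N" "\<And>b. b \<in> A \<Longrightarrow> (\<sigma> ^^ N) b - b \<in> ps.T" by blast
  let ?\<tau> = "\<sigma> ^^ N" and ?B = ps.B
  have close: "\<exists>y\<in>?B. ?\<tau> x = x + of_nat p * y" if "x \<in> ?B" for x
    using ps.iterate_close[of ?\<tau>, OF _ _ _ N(2) that] by (simp add: funpow_hom)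
  have tau_it: "(?\<tau> ^^ s) b = it (int N * int s) b" for s b
    by (simp add: funpow_mult it_nat flip: of_nat_mult)
  have noethB: "noetherian_between ?B ?B (I \<inter> ?B)"
  proof (rule noetherian_between_anti[OF ps.noeth_B])
    show "Z \<subseteq> I \<inter> ?B" using I(2) ZA ps.B(2) by blast
  qed simp
  have all: "it (r + int N * k) a \<in> I" if inf: "infinite {k. it (r + int N * k) a \<in> I}" for r k
  proof -
    let ?f = "\<lambda>k. it (r + int N * k) a"
    have close_k: "\<exists>y\<in>?B. ?f k - of_nat p ^ j * y \<in> I" for j
    proof -
      \<comment> \<open>With \<open>2 j\<close> zeros the exponent \<open>2 j - 2 j div 2\<close> is \<open>j\<close>.\<close>
      obtain S where S: "S \<subseteq> {k. ?f k \<in> I}" "card S = 2 * j" "finite S"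
        using infinite_arbitrarily_large[OF inf] by metis
      define l where "l = Min (insert k S)"
      have l: "l \<le> k" "\<And>s. s \<in> S \<Longrightarrow> l \<le> s" unfolding l_def using S(3) by auto
      let ?b = "?f l" and ?S = "(\<lambda>s. nat (s - l)) ` S"
      have b: "?b \<in> ?B" using it_invariant[OF \<sigma>A a] ps.B(2) by blast
      have tau_f: "(?\<tau> ^^ nat (s - l)) ?b = ?f s" if "l \<le> s" for s
      proof -
        have "(?\<tau> ^^ nat (s - l)) ?b = it (int N * (s - l) + (r + int N * l)) a"
          unfolding tau_it it_add using that by simp
        also have "int N * (s - l) + (r + int N * l) = r + int N * s" by (simp add: algebra_simps)
        finally show ?thesis .
      qed
      have "inj_on (\<lambda>s. nat (s - l)) S"
      proof (rule inj_onI)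
        fix x y assume "x \<in> S" "y \<in> S" "nat (x - l) = nat (y - l)"
        then show "x = y" using l(2)[of x] l(2)[of y] by simp
      qed
      then have "card ?S = card S" by (rule card_image)
      then have "card ?S - card ?S div 2 = j" using S(2) by simp
      moreover have "\<exists>x\<in>?B. (?\<tau> ^^ nat (k - l)) ?b - of_nat p ^ (card ?S - card ?S div 2) * x \<in> I"
      proof (rule iterate_many_zeros[OF p ps.B(1) I(1) funpow_hom(1) funpow_hom(3) funpow_hom(4) close b])
        show "finite ?S" using S(3) by simp
        fix s assume "s \<in> ?S"
        then show "(?\<tau> ^^ s) ?b \<in> I" using tau_f l(2) S(1) by auto
      qed
      ultimately show ?thesis using tau_f[OF l(1)] by simp
    qed
    have "0 < p" using p by simp
    from krull_intersection[OF ps.B(1) noethB I(1) this close_k]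
    obtain s where s: "s \<in> ?B" "(1 - of_nat p * s) * ?f k \<in> I" by blast
    have not_nil: "(1 - of_nat p * s) ^ e \<notin> I" for e
    proof -
      have "\<exists>y\<in>?B. (1 - of_nat p * s) ^ e = 1 - of_nat p * y"
      proof (induction e)
        case 0
        then show ?case using ps.B(1) by (intro bexI[of _ 0]) auto
      next
        case (Suc e)
        then obtain y where y: "y \<in> ?B" "(1 - of_nat p * s) ^ e = 1 - of_nat p * y" by blast
        have "(1 - of_nat p * s) ^ Suc e = 1 - of_nat p * (s + y - of_nat p * (s * y))"
          unfolding power_Suc y(2) by (simp add: algebra_simps)
        moreover have "s + y - of_nat p * (s * y) \<in> ?B"
          by (intro subring_diff[OF ps.B(1)] subring_add[OF ps.B(1)] subring_mult[OF ps.B(1)]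
              subring_of_nat[OF ps.B(1)] s(1) y(1))
        ultimately show ?case by blast
      qed
      then show ?thesis using ps.p_nonunit_B by metis
    qed
    have "?f k * (1 - of_nat p * s) \<in> I" using s(2) by (simp add: mult.commute)
    from primary[OF this] show ?thesis using not_nil by auto
  qed
  have "finite {k. it (r + int N * k) a \<in> I} \<or> (\<forall>k. it (r + int N * k) a \<in> I)" for r
  proof (rule disjCI, rule ccontr)
    assume "\<not> (\<forall>k. it (r + int N * k) a \<in> I)" and inf: "infinite {k. it (r + int N * k) a \<in> I}"
    then show False using all[OF inf] by simp
  qed
  then show ?thesis unfolding eventually_periodic_def using N(1) by (intro exI[of _ "int N"]) simp
qed

text \<open>A maximal counterexample is primary. If \<open>x y \<in> M\<close>, take \<open>k\<close> so large that the ideals \<open>(M : y\<^sup>k)\<close> have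
  become stationary; then \<open>M = (M : y\<^sup>k) \<inter> (M + (y\<^sup>k))\<close>.\<close>
theorem element_eventually_periodic:
  assumes noeth: "noetherian_between UNIV UNIV Z"
    and fg: "\<And>a. \<exists>G. finite G \<and> a \<in> subring_gen (ints_plus Z \<union> G) \<and> invariant (subring_gen (ints_plus Z \<union> G))"
    and I: "is_ideal I" "Z \<subseteq> I"
  shows "eventually_periodic {n. it n a \<in> I}"
proof (rule ccontr)
  assume contra: "\<not> ?thesis"
  let ?\<F> = "{L. is_ideal L \<and> Z \<subseteq> L \<and> \<not> eventually_periodic {n. it n a \<in> L}}"
  have "I \<in> ?\<F>" using I contra by simp
  then have "?\<F> \<noteq> {}" by blast
  then have "\<exists>M\<in>?\<F>. \<forall>L\<in>?\<F>. M \<subseteq> L \<longrightarrow> L = M"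
    by (intro noetherian_between_maximal[OF noeth]) auto
  then obtain M where M: "is_ideal M" "Z \<subseteq> M" "\<not> eventually_periodic {n. it n a \<in> M}"
    and max: "\<And>L. is_ideal L \<Longrightarrow> Z \<subseteq> L \<Longrightarrow> \<not> eventually_periodic {n. it n a \<in> L} \<Longrightarrow> M \<subseteq> L \<Longrightarrow> L = M"
    by auto
  have one: "1 \<notin> M"
  proof
    assume "1 \<in> M"
    then have "x \<in> M" for x using submodule_mult[OF M(1) UNIV_I, of 1 x] by simp
    then have "{n. it n a \<in> M} = UNIV" by simp
    then show False using M(3) eventually_periodic_UNIV by simp
  qed
  obtain G where G: "finite G" "a \<in> subring_gen (ints_plus Z \<union> G)"
    "\<And>b. b \<in> subring_gen (ints_plus Z \<union> G) \<Longrightarrow> \<sigma> b \<in> subring_gen (ints_plus Z \<union> G)"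
    "\<And>b. b \<in> subring_gen (ints_plus Z \<union> G) \<Longrightarrow> inv_\<sigma> b \<in> subring_gen (ints_plus Z \<union> G)"
    using fg[of a] unfolding invariant_def by blast
  have "x \<in> M \<or> (\<exists>k. y ^ k \<in> M)" if xy: "x * y \<in> M" for x y
  proof (rule ccontr)
    assume neg: "\<not> ?thesis"
    define C where "C k = {z. y ^ k * z \<in> M}" for k
    have C: "is_ideal (C k)" "Z \<subseteq> C k" "M \<subseteq> C k" for k
    proof -
      show "is_ideal (C k)" unfolding C_def by (rule submodule_vimage_mult[OF M(1)])
      show "M \<subseteq> C k" unfolding C_def using submodule_mult[OF M(1) UNIV_I] by blast
      then show "Z \<subseteq> C k" using M(2) by blast
    qed
    have "C k \<subseteq> C (Suc k)" for k
      unfolding C_def using submodule_mult[OF M(1) UNIV_I, of _ y] by (auto simp: mult.assoc)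
    then obtain k where k: "\<And>l. k \<le> l \<Longrightarrow> C l = C k"
      using noetherian_betweenD[OF noeth, of C] C by (metis subset_UNIV)
    \<comment> \<open>A positive exponent, so that \<open>x y \<in> M\<close> puts \<open>x\<close> into \<open>C k'\<close>.\<close>
    define k' where "k' = Suc k"
    have k': "C (k' + k') = C k'" using k[of "k' + k'"] k[of k'] unfolding k'_def by simp
    let ?D = "span_over UNIV M [y ^ k']"
    have D: "is_ideal ?D" by (rule span_over_submodule[OF is_subring_UNIV M(1)])
    have D': "M \<subseteq> ?D" by (rule span_over_base[OF is_subring_UNIV])
    have yD: "y ^ k' \<in> ?D" by (rule span_over_mem[OF is_subring_UNIV M(1)]) simp
    have "?D \<noteq> M" using yD neg by blast
    then have ep1: "eventually_periodic {n. it n a \<in> ?D}" using max[OF D] D' M(2) by blast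
    have "x \<in> C k'" unfolding C_def k'_def
      using submodule_mult[OF M(1) UNIV_I xy, of "y ^ k"] by (simp add: ac_simps)
    then have "C k' \<noteq> M" using neg by blast
    then have ep2: "eventually_periodic {n. it n a \<in> C k'}" using max[OF C(1) C(2)] C(3) by blast
    have "z \<in> M" if z: "z \<in> ?D" "z \<in> C k'" for z
    proof -
      obtain i s where i_s: "z = i + s * y ^ k'" "i \<in> M" using z(1) by auto
      have "y ^ k' * z - y ^ k' * i \<in> M"
        using z(2) submodule_diff[OF is_subring_UNIV M(1) _ submodule_mult[OF M(1) UNIV_I i_s(2)]]
        unfolding C_def by blast
      then have "s \<in> C (k' + k')" unfolding i_s(1) C_def by (simp add: algebra_simps power_add)
      then have "y ^ k' * s \<in> M" unfolding k' by (simp add: C_def)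
      then show ?thesis using submodule_add[OF M(1) i_s(2)] unfolding i_s(1) by (simp add: mult.commute)
    qed
    then have "M = ?D \<inter> C k'" using D' C(3) by blast
    then have "{n. it n a \<in> M} = {n. it n a \<in> ?D} \<inter> {n. it n a \<in> C k'}" by auto
    then show False using eventually_periodic_Int[OF ep1 ep2] M(3) by simp
  qed
  from primary_eventually_periodic[OF M(1,2) one this G(1) refl G(3,4,2)] M(3) show False by simp
qed

theorem ideal_eventually_periodic:
  assumes noeth: "noetherian_between UNIV UNIV Z"
    and fg: "\<And>a. \<exists>G. finite G \<and> a \<in> subring_gen (ints_plus Z \<union> G) \<and> invariant (subring_gen (ints_plus Z \<union> G))"
    and I: "is_ideal I" "Z \<subseteq> I" and J: "is_ideal J" "Z \<subseteq> J"
  shows "eventually_periodic {n. \<forall>a\<in>J. it n a \<in> I}"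
proof -
  obtain ws where ws: "set ws \<subseteq> J" "J = span_over UNIV Z ws"
    by (rule noetherian_between_finitely_generated[OF is_subring_UNIV Z(1) noeth J subset_UNIV])
  have "(\<forall>a\<in>J. it n a \<in> I) \<longleftrightarrow> (\<forall>a\<in>set ws. it n a \<in> I)" for n
  proof
    assume *: "\<forall>a\<in>set ws. it n a \<in> I"
    have "is_ideal {a. it n a \<in> I}"
      unfolding is_submodule_def
    proof (intro conjI ballI)
      show "0 \<in> {a. it n a \<in> I}" using it_hom(1)[of n 0 0] submodule_0[OF I(1)] by simp
    qed (auto simp: it_hom intro: submodule_add[OF I(1)] submodule_mult[OF I(1)])
    moreover have "Z \<subseteq> {a. it n a \<in> I}" using it_invariant[OF Z(2) Z(3)] I(2) by blast
    ultimately have "J \<subseteq> {a. it n a \<in> I}" unfolding ws(2) using * by (intro span_over_least) auto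
    then show "\<forall>a\<in>J. it n a \<in> I" by blast
  qed (use ws(1) in blast)
  moreover have "eventually_periodic {n. \<forall>a\<in>set vs. it n a \<in> I}" for vs
  proof (induction vs)
    case Nil
    show ?case using eventually_periodic_UNIV by simp
  next
    case (Cons v vs)
    have "{n. \<forall>a\<in>set (v # vs). it n a \<in> I} = {n. it n v \<in> I} \<inter> {n. \<forall>a\<in>set vs. it n a \<in> I}" by auto
    then show ?case using eventually_periodic_Int[OF element_eventually_periodic[OF noeth fg I] Cons] by simp
  qed
  ultimately show ?thesis by simp
qed

text \<open>The element \<open>a\<close> and the images of the generators \<open>H\<close> under \<open>\<sigma>\<close> and its inverse are polynomial
  expressions with finitely many coefficients in \<open>K\<close>. These are fixed by \<open>\<sigma>\<close> modulo \<open>Z\<close>, so together with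
  \<open>H\<close> they generate an invariant subring.\<close>
lemma finitely_generated_invariant_subring:
  assumes H: "finite H" "subring_gen (K \<union> H) = UNIV" and K: "\<And>b. b \<in> K \<Longrightarrow> \<sigma> b - b \<in> Z"
  shows "\<exists>G. finite G \<and> a \<in> subring_gen (ints_plus Z \<union> G) \<and> invariant (subring_gen (ints_plus Z \<union> G))"
proof -
  let ?E = "insert a (\<sigma> ` H \<union> inv_\<sigma> ` H)"
  have "\<forall>x. \<exists>F. finite F \<and> F \<subseteq> K \<and> x \<in> subring_gen (F \<union> H)"
    using gen_finite_support[of _ K H] H(2) by blast
  then obtain F where F: "\<And>x. finite (F x)" "\<And>x. F x \<subseteq> K" "\<And>x. x \<in> subring_gen (F x \<union> H)" by metis
  define G where "G = (\<Union>x\<in>?E. F x) \<union> H"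
  let ?A = "subring_gen (ints_plus Z \<union> G)"
  have E: "x \<in> ?A" if "x \<in> ?E" for x
  proof -
    have "subring_gen (F x \<union> H) \<subseteq> ?A" by (intro gen_mono) (use that in \<open>auto simp: G_def\<close>)
    then show ?thesis using F(3)[of x] by blast
  qed
  have A: "is_subring ?A" "ints_plus Z \<subseteq> ?A" "G \<subseteq> ?A" by (auto intro: gen_subring gen_base)
  have ZA: "Z \<subseteq> ?A" using A(2) ints_plus_base by blast
  have closed: "?A \<subseteq> {b. \<phi> b \<in> ?A}"
    if \<phi>: "\<phi> 1 = 1" "\<And>x y. \<phi> (x - y) = \<phi> x - \<phi> y" "\<And>x y. \<phi> (x + y) = \<phi> x + \<phi> y"
      "\<And>x y. \<phi> (x * y) = \<phi> x * \<phi> y" "\<And>k. \<phi> (of_int k) = of_int k" "\<And>z. z \<in> Z \<Longrightarrow> \<phi> z \<in> Z"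
      and \<phi>K: "\<And>b. b \<in> K \<Longrightarrow> \<phi> b - b \<in> Z" and \<phi>H: "\<And>b. b \<in> H \<Longrightarrow> \<phi> b \<in> ?A" for \<phi>
  proof (rule gen_least)
    show "is_subring {b. \<phi> b \<in> ?A}" unfolding is_subring_def
      using A(1) by (auto simp: \<phi> intro: subring_diff subring_mult)
    show "ints_plus Z \<union> G \<subseteq> {b. \<phi> b \<in> ?A}"
    proof
      fix b assume "b \<in> ints_plus Z \<union> G"
      then consider k z where "b = of_int k + z" "z \<in> Z" | "b \<in> K" "b \<in> G" | "b \<in> H"
        using F(2) unfolding G_def ints_plus_def by blast
      then show "b \<in> {b. \<phi> b \<in> ?A}"
      proof cases
        case 1
        then show ?thesis using \<phi>(6) ZA A(1) by (auto simp: \<phi>(3,5) intro!: subring_add)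
      next
        case 2
        then have "(\<phi> b - b) + b \<in> ?A" using \<phi>K ZA A by (intro subring_add[OF A(1)]) auto
        then show ?thesis by simp
      qed (use \<phi>H in simp)
    qed
  qed
  have "?A \<subseteq> {b. \<sigma> b \<in> ?A}"
    by (rule closed) (use E K Z in \<open>auto simp: one diff add mult of_int\<close>)
  moreover have "?A \<subseteq> {b. inv_\<sigma> b \<in> ?A}"
  proof (rule closed)
    fix b assume "b \<in> K"
    then have "- inv_\<sigma> (\<sigma> b - b) \<in> Z"
      using K Z(3) submodule_uminus[OF is_subring_UNIV Z(1)] by blast
    then show "inv_\<sigma> b - b \<in> Z" by (simp add: inv_diff)
  qed (use E Z in \<open>auto simp: inv_hom inv_diff inv_of_int\<close>)
  moreover have "finite G" unfolding G_def using H(1) F(1) by simp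
  ultimately show ?thesis using E[of a] unfolding invariant_def by (intro exI[of _ G]) auto
qed

end

section \<open>The free commutative algebra over the rationals\<close>

text \<open>\<open>Recip n\<close> stands for the reciprocal of \<open>n + 1\<close>. The free algebra is obtained from terms modulo the
  axioms, so that a map out of it is defined by recursion on terms and respects equality by rule
  induction.\<close>
datatype 'a rat_term =
    Var 'a | Zero | One | Recip nat | Neg "'a rat_term"
  | Add "'a rat_term" "'a rat_term" | Mul "'a rat_term" "'a rat_term"

primrec nat_term :: "nat \<Rightarrow> 'a rat_term" where
  "nat_term 0 = Zero"
| "nat_term (Suc n) = Add One (nat_term n)"

inductive rat_term_eq :: "'a rat_term \<Rightarrow> 'a rat_term \<Rightarrow> bool" where
  refl: "rat_term_eq x x"
| sym: "rat_term_eq x y \<Longrightarrow> rat_term_eq y x"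
| trans: "rat_term_eq x y \<Longrightarrow> rat_term_eq y z \<Longrightarrow> rat_term_eq x z"
| neg: "rat_term_eq x y \<Longrightarrow> rat_term_eq (Neg x) (Neg y)"
| add: "rat_term_eq x y \<Longrightarrow> rat_term_eq x' y' \<Longrightarrow> rat_term_eq (Add x x') (Add y y')"
| mul: "rat_term_eq x y \<Longrightarrow> rat_term_eq x' y' \<Longrightarrow> rat_term_eq (Mul x x') (Mul y y')"
| add_assoc: "rat_term_eq (Add (Add x y) z) (Add x (Add y z))"
| add_comm: "rat_term_eq (Add x y) (Add y x)"
| add_zero: "rat_term_eq (Add Zero x) x"
| add_neg: "rat_term_eq (Add (Neg x) x) Zero"
| mul_assoc: "rat_term_eq (Mul (Mul x y) z) (Mul x (Mul y z))"
| mul_comm: "rat_term_eq (Mul x y) (Mul y x)"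
| mul_one: "rat_term_eq (Mul One x) x"
| distr: "rat_term_eq (Mul (Add x y) z) (Add (Mul x z) (Mul y z))"
| recip: "rat_term_eq (Mul (nat_term (Suc n)) (Recip n)) One"

quotient_type 'a free_algebra = "'a rat_term" / rat_term_eq
  by (rule equivpI) (auto simp: reflp_def symp_def transp_def intro: rat_term_eq.refl rat_term_eq.sym rat_term_eq.trans)

text \<open>A model in the rationals; it shows that zero and one are not identified.\<close>
primrec rat_value :: "'a rat_term \<Rightarrow> rat" where
  "rat_value (Var x) = 0"
| "rat_value Zero = 0"
| "rat_value One = 1"
| "rat_value (Recip n) = 1 / of_nat (Suc n)"
| "rat_value (Neg x) = - rat_value x"
| "rat_value (Add x y) = rat_value x + rat_value y"
| "rat_value (Mul x y) = rat_value x * rat_value y"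

lemma rat_value_nat_term: "rat_value (nat_term n) = of_nat n"
  by (induction n) auto

lemma rat_value_cong: "rat_term_eq x y \<Longrightarrow> rat_value x = rat_value y"
  by (induction rule: rat_term_eq.induct) (simp_all add: algebra_simps rat_value_nat_term del: nat_term.simps of_nat_Suc)

instantiation free_algebra :: (type) comm_ring_1
begin

lift_definition zero_free_algebra :: "'a free_algebra" is Zero .
lift_definition one_free_algebra :: "'a free_algebra" is One .
lift_definition uminus_free_algebra :: "'a free_algebra \<Rightarrow> 'a free_algebra" is Neg by (rule rat_term_eq.neg)
lift_definition plus_free_algebra :: "'a free_algebra \<Rightarrow> 'a free_algebra \<Rightarrow> 'a free_algebra" is Add by (rule rat_term_eq.add)
lift_definition times_free_algebra :: "'a free_algebra \<Rightarrow> 'a free_algebra \<Rightarrow> 'a free_algebra" is Mul by (rule rat_term_eq.mul)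
definition minus_free_algebra :: "'a free_algebra \<Rightarrow> 'a free_algebra \<Rightarrow> 'a free_algebra" where
  "minus_free_algebra x y = x + - y"

instance
proof
  fix a b c :: "'a free_algebra"
  show "a + b + c = a + (b + c)" by transfer (rule rat_term_eq.add_assoc)
  show "a + b = b + a" by transfer (rule rat_term_eq.add_comm)
  show "0 + a = a" by transfer (rule rat_term_eq.add_zero)
  show "- a + a = 0" by transfer (rule rat_term_eq.add_neg)
  show "a - b = a + - b" by (rule minus_free_algebra_def)
  show "a * b * c = a * (b * c)" by transfer (rule rat_term_eq.mul_assoc)
  show "a * b = b * a" by transfer (rule rat_term_eq.mul_comm)
  show "1 * a = a" by transfer (rule rat_term_eq.mul_one)
  show "(a + b) * c = a * c + b * c" by transfer (rule rat_term_eq.distr)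
  show "(0 :: 'a free_algebra) \<noteq> 1" by transfer (auto dest: rat_value_cong)
qed

end

lift_definition recip :: "nat \<Rightarrow> 'a free_algebra" is Recip .
lift_definition var :: "'a \<Rightarrow> 'a free_algebra" is Var .

lemma of_nat_eq_nat_term: "of_nat n = abs_free_algebra (nat_term n)"
  by (induction n) (auto simp: zero_free_algebra_def one_free_algebra_def plus_free_algebra.abs_eq)

instance free_algebra :: (type) rat_algebra
proof
  fix n
  have "of_nat (Suc n) * recip n = (1 :: 'a free_algebra)"
    unfolding of_nat_eq_nat_term recip_def one_free_algebra_def
    by (simp add: times_free_algebra.abs_eq free_algebra.abs_eq_iff rat_term_eq.recip del: nat_term.simps)
  then show "\<exists>u::'a free_algebra. of_nat (Suc n) * u = 1" by blast
qed

lemma map_nat_term: "map_rat_term f (nat_term n) = nat_term n"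
  by (induction n) auto

lift_definition map_vars :: "('a \<Rightarrow> 'b) \<Rightarrow> 'a free_algebra \<Rightarrow> 'b free_algebra" is map_rat_term
proof -
  fix f :: "'a \<Rightarrow> 'b" and x y :: "'a rat_term"
  assume "rat_term_eq x y"
  then show "rat_term_eq (map_rat_term f x) (map_rat_term f y)"
  proof (induction rule: rat_term_eq.induct)
    case (trans x y z)
    then show ?case by (blast intro: rat_term_eq.trans)
  next
    case (recip n)
    then show ?case using rat_term_eq.recip[of n]
      by (simp add: map_nat_term)
  qed (auto intro: rat_term_eq.intros)
qed

lemma map_vars_hom:
  "map_vars f (x + y) = map_vars f x + map_vars f y"
  "map_vars f (x * y) = map_vars f x * map_vars f y"
  "map_vars f 1 = 1"
  by (transfer, simp add: rat_term_eq.refl)+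

lemma map_vars_comp: "map_vars f (map_vars g x) = map_vars (f \<circ> g) x"
  by transfer (simp add: rat_term.map_comp rat_term_eq.refl)

lemma map_vars_id: "map_vars id x = x"
  by transfer (simp add: rat_term.map_id0 rat_term_eq.refl)

section \<open>Transfer from a carrier-based algebra\<close>

locale rat_cring = cring A for A (structure) +
  fixes \<iota> :: "nat \<Rightarrow> 'a"
  assumes \<iota>: "\<iota> n \<in> carrier A" "add_pow A (Suc n) \<one> \<otimes> \<iota> n = \<one>"
begin

text \<open>Variables outside the carrier are sent to zero, so that every term has a value in the carrier.\<close>
primrec term_value :: "'a rat_term \<Rightarrow> 'a" where
  "term_value (Var x) = (if x \<in> carrier A then x else \<zero>)"
| "term_value Zero = \<zero>"
| "term_value One = \<one>"
| "term_value (Recip n) = \<iota> n"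
| "term_value (Neg x) = \<ominus> term_value x"
| "term_value (Add x y) = term_value x \<oplus> term_value y"
| "term_value (Mul x y) = term_value x \<otimes> term_value y"

lemma term_value_closed [simp]: "term_value x \<in> carrier A"
  by (induction x) (auto simp: \<iota>)

lemma term_value_nat: "term_value (nat_term n) = add_pow A n \<one>"
  by (induction n) (auto simp: a_comm)

lemma term_value_cong: "rat_term_eq x y \<Longrightarrow> term_value x = term_value y"
proof (induction rule: rat_term_eq.induct)
  case (add_comm x y)
  then show ?case by (simp add: a_comm)
next
  case (mul_comm x y)
  then show ?case by (simp add: m_comm)
next
  case (recip n)
  then show ?case using \<iota>(2)[of n] term_value_nat[of "Suc n"] by (simp only: term_value.simps)
qed (simp_all add: a_assoc m_assoc l_neg l_distr)

definition ev :: "'a free_algebra \<Rightarrow> 'a" where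
  "ev x = term_value (rep_free_algebra x)"

lemma ev_abs: "ev (abs_free_algebra x) = term_value x"
  unfolding ev_def
  by (intro term_value_cong Quotient3_rep_abs[OF Quotient3_free_algebra] rat_term_eq.refl)

lemma ev_closed [simp]: "ev x \<in> carrier A"
  by (simp add: ev_def)

lemma free_cases: obtains t where "x = abs_free_algebra t"
  using Quotient3_abs_rep[OF Quotient3_free_algebra] by metis

lemma ev_simps [simp]:
  "ev 0 = \<zero>" "ev 1 = \<one>" "ev (- x) = \<ominus> ev x" "ev (x + y) = ev x \<oplus> ev y"
  "ev (x * y) = ev x \<otimes> ev y" "ev (x - y) = ev x \<ominus> ev y"
proof -
  obtain s t where st: "x = abs_free_algebra s" "y = abs_free_algebra t"
    by (metis free_cases)
  show "ev 0 = \<zero>" "ev 1 = \<one>"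
    by (simp_all add: zero_free_algebra_def one_free_algebra_def ev_abs)
  show "ev (- x) = \<ominus> ev x" "ev (x + y) = ev x \<oplus> ev y" "ev (x * y) = ev x \<otimes> ev y"
    unfolding st by (simp_all add: uminus_free_algebra.abs_eq plus_free_algebra.abs_eq times_free_algebra.abs_eq ev_abs)
  show "ev (x - y) = ev x \<ominus> ev y"
    unfolding st minus_free_algebra_def
    by (simp add: uminus_free_algebra.abs_eq plus_free_algebra.abs_eq ev_abs a_minus_def)
qed

lemma ev_var: "x \<in> carrier A \<Longrightarrow> ev (var x) = x"
  by (simp add: var_def ev_abs)

lemma ideal_preimage: "ideal I A \<Longrightarrow> is_ideal {x. ev x \<in> I}"
  unfolding is_submodule_def
  by (auto simp: additive_subgroup.zero_closed[OF ideal.axioms(1)] additive_subgroup.a_closed[OF ideal.axioms(1)]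
      ideal.I_l_closed)

end

locale rat_cring_automorphism = rat_cring +
  fixes \<sigma> :: "'a \<Rightarrow> 'a"
  assumes \<sigma>: "\<sigma> \<in> ring_iso A A"
begin

lemma \<sigma>_closed [simp]: "x \<in> carrier A \<Longrightarrow> \<sigma> x \<in> carrier A"
  and \<sigma>_add: "x \<in> carrier A \<Longrightarrow> y \<in> carrier A \<Longrightarrow> \<sigma> (x \<oplus> y) = \<sigma> x \<oplus> \<sigma> y"
  and \<sigma>_mult: "x \<in> carrier A \<Longrightarrow> y \<in> carrier A \<Longrightarrow> \<sigma> (x \<otimes> y) = \<sigma> x \<otimes> \<sigma> y"
  and \<sigma>_one: "\<sigma> \<one> = \<one>" and \<sigma>_bij: "bij_betw \<sigma> (carrier A) (carrier A)"
  using \<sigma> unfolding ring_iso_def by (auto dest: ring_hom_memE)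

lemma \<sigma>_zero: "\<sigma> \<zero> = \<zero>"
proof -
  have "\<sigma> \<zero> \<oplus> \<sigma> \<zero> = \<sigma> \<zero>" using \<sigma>_add[of \<zero> \<zero>] by simp
  then show ?thesis by (metis \<sigma>_closed add.r_cancel_one zero_closed)
qed

lemma \<sigma>_neg: assumes x: "x \<in> carrier A" shows "\<sigma> (\<ominus> x) = \<ominus> \<sigma> x"
proof -
  have "\<sigma> (\<ominus> x) \<oplus> \<sigma> x = \<zero>" using \<sigma>_add[of "\<ominus> x" x] x by (simp add: l_neg \<sigma>_zero)
  then show ?thesis using x by (simp add: minus_equality)
qed

lemma \<sigma>_nat: "\<sigma> (add_pow A (n::nat) \<one>) = add_pow A n \<one>"
  by (induction n) (auto simp: \<sigma>_zero \<sigma>_add \<sigma>_one)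

lemma \<sigma>_\<iota>: "\<sigma> (\<iota> n) = \<iota> n"
proof -
  let ?k = "add_pow A (Suc n) \<one>"
  have k: "?k \<in> carrier A" by simp
  have "?k \<otimes> \<sigma> (\<iota> n) = \<sigma> (?k \<otimes> \<iota> n)" by (simp only: \<sigma>_mult[OF k \<iota>(1)] \<sigma>_nat)
  then have *: "?k \<otimes> \<sigma> (\<iota> n) = \<one>" using \<iota>(2) \<sigma>_one by simp
  have "\<sigma> (\<iota> n) = (?k \<otimes> \<iota> n) \<otimes> \<sigma> (\<iota> n)" using \<iota> by simp
  also have "\<dots> = (?k \<otimes> \<sigma> (\<iota> n)) \<otimes> \<iota> n" using k \<iota>(1) by (simp add: m_assoc m_comm[of "\<iota> n"])
  finally show ?thesis using * \<iota>(1) by simp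
qed

text \<open>Extended by the identity to a bijection of the whole type, \<open>\<sigma>\<close> permutes the variables of the free
  algebra; this gives an automorphism with inverse without any choice of preimages.\<close>
definition s :: "'a \<Rightarrow> 'a" where "s x = (if x \<in> carrier A then \<sigma> x else x)"

definition \<Sigma> :: "'a free_algebra \<Rightarrow> 'a free_algebra" where "\<Sigma> = map_vars s"

definition Z :: "'a free_algebra set" where "Z = {x. ev x = \<zero>}"

lemma bij_s: "bij s"
proof -
  have "bij_betw s (carrier A) (carrier A)"
    using \<sigma>_bij by (rule bij_betw_cong[THEN iffD1, rotated]) (simp add: s_def)
  moreover have "bij_betw s (- carrier A) (- carrier A)"
    using bij_betw_id by (rule bij_betw_cong[THEN iffD1, rotated]) (simp add: s_def)
  ultimately have "bij_betw s (carrier A \<union> - carrier A) (carrier A \<union> - carrier A)"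
    by (rule bij_betw_combine) simp
  then show ?thesis by simp
qed

lemma \<Sigma>_inv: "map_vars (inv_into UNIV s) (\<Sigma> x) = x" "\<Sigma> (map_vars (inv_into UNIV s) x) = x"
proof -
  have "inv_into UNIV s \<circ> s = id" "s \<circ> inv_into UNIV s = id"
    using bij_s by (auto simp: bij_is_inj surj_iff[symmetric] bij_is_surj)
  then show "map_vars (inv_into UNIV s) (\<Sigma> x) = x" "\<Sigma> (map_vars (inv_into UNIV s) x) = x"
    unfolding \<Sigma>_def map_vars_comp by (simp_all add: map_vars_id)
qed

lemma bij_\<Sigma>: "bij \<Sigma>"
  using \<Sigma>_inv by (rule o_bij[OF ext ext, unfolded o_def id_def])

lemma inv_\<Sigma>: "inv_into UNIV \<Sigma> x = map_vars (inv_into UNIV s) x"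
  using \<Sigma>_inv(2) bij_\<Sigma> by (metis bij_is_inj inv_f_eq)

lemma ev_\<Sigma>: "ev (\<Sigma> x) = \<sigma> (ev x)"
proof -
  obtain t where t: "x = abs_free_algebra t" by (rule free_cases)
  have "term_value (map_rat_term s t) = \<sigma> (term_value t)"
    by (induction t) (auto simp: s_def \<sigma>_zero \<sigma>_one \<sigma>_add \<sigma>_mult \<sigma>_neg \<sigma>_\<iota>)
  then show ?thesis unfolding t \<Sigma>_def by (simp add: map_vars.abs_eq ev_abs)
qed

lemma ev_inv_\<Sigma>: "ev (inv_into UNIV \<Sigma> x) = inv_into (carrier A) \<sigma> (ev x)"
proof -
  have "ev x = \<sigma> (ev (inv_into UNIV \<Sigma> x))"
    unfolding ev_\<Sigma>[symmetric] using bij_\<Sigma> by (simp add: bij_is_surj surj_f_inv_f)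
  then show ?thesis using \<sigma>_bij by (metis bij_betw_def ev_closed inv_into_f_f)
qed

lemma ev_iterate: "ev (int_iterate UNIV \<Sigma> n x) = int_iterate (carrier A) \<sigma> n (ev x)"
proof -
  have "ev ((\<Sigma> ^^ k) x) = (\<sigma> ^^ k) (ev x)"
    "ev ((inv_into UNIV \<Sigma> ^^ k) x) = (inv_into (carrier A) \<sigma> ^^ k) (ev x)" for k
    by (induction k) (simp_all add: ev_\<Sigma> ev_inv_\<Sigma>)
  then show ?thesis by (simp add: int_iterate_def)
qed

lemma Z_ideal: "is_ideal Z"
  unfolding Z_def is_submodule_def by auto

sublocale free: ring_automorphism \<Sigma> Z
proof
  show "bij \<Sigma>" by (rule bij_\<Sigma>)
  show "\<Sigma> (x + y) = \<Sigma> x + \<Sigma> y" "\<Sigma> (x * y) = \<Sigma> x * \<Sigma> y" "\<Sigma> 1 = 1" for x y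
    by (simp_all add: \<Sigma>_def map_vars_hom)
  show "is_ideal Z" by (rule Z_ideal)
  show "\<Sigma> z \<in> Z" if "z \<in> Z" for z using that by (simp add: Z_def ev_\<Sigma> \<sigma>_zero)
  show "inv_into UNIV \<Sigma> z \<in> Z" if "z \<in> Z" for z
  proof -
    have "inv_into (carrier A) \<sigma> \<zero> = \<zero>"
      using \<sigma>_bij \<sigma>_zero by (metis bij_betw_def inv_into_f_f zero_closed)
    then show ?thesis using that by (simp add: Z_def ev_inv_\<Sigma>)
  qed
qed

lemma iterate_inverse:
  assumes x: "x \<in> carrier A"
  shows "int_iterate (carrier A) \<sigma> n (int_iterate (carrier A) \<sigma> (- n) x) = x"
    "int_iterate (carrier A) \<sigma> n x \<in> carrier A"
proof -
  have "int_iterate UNIV \<Sigma> n (int_iterate UNIV \<Sigma> (- n) (var x)) = var x"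
    using free.it_add[of n "- n" "var x"] by simp
  from arg_cong[OF this, of ev]
  show "int_iterate (carrier A) \<sigma> n (int_iterate (carrier A) \<sigma> (- n) x) = x"
    unfolding ev_iterate ev_var[OF x] .
  show "int_iterate (carrier A) \<sigma> n x \<in> carrier A"
    using ev_closed[of "int_iterate UNIV \<Sigma> n (var x)"] unfolding ev_iterate ev_var[OF x] .
qed

text \<open>This exchanges \<open>\<sigma>\<^sup>n(I) \<supseteq> J\<close> for a condition on elements, which also turns the sign of the exponent.\<close>
lemma subset_iterate_iff:
  assumes I: "ideal I A" and J: "ideal J A"
  shows "J \<subseteq> int_iterate (carrier A) \<sigma> n ` I \<longleftrightarrow>
    (\<forall>x\<in>{x. ev x \<in> J}. int_iterate UNIV \<Sigma> (- n) x \<in> {x. ev x \<in> I})"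
proof -
  have sub: "I \<subseteq> carrier A" "J \<subseteq> carrier A"
    using I J by (auto dest: additive_subgroup.a_subset[OF ideal.axioms(1)])
  have "J \<subseteq> int_iterate (carrier A) \<sigma> n ` I \<longleftrightarrow> (\<forall>a\<in>J. int_iterate (carrier A) \<sigma> (- n) a \<in> I)"
  proof
    assume *: "J \<subseteq> int_iterate (carrier A) \<sigma> n ` I"
    show "\<forall>a\<in>J. int_iterate (carrier A) \<sigma> (- n) a \<in> I"
    proof
      fix a assume "a \<in> J"
      then obtain i where "i \<in> I" "a = int_iterate (carrier A) \<sigma> n i" using * by blast
      then show "int_iterate (carrier A) \<sigma> (- n) a \<in> I" using iterate_inverse(1)[of i "- n"] sub by auto
    qed
  next
    assume *: "\<forall>a\<in>J. int_iterate (carrier A) \<sigma> (- n) a \<in> I"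
    show "J \<subseteq> int_iterate (carrier A) \<sigma> n ` I"
    proof
      fix a assume "a \<in> J"
      then show "a \<in> int_iterate (carrier A) \<sigma> n ` I"
        using * iterate_inverse(1)[of a n] sub by (intro image_eqI[of _ _ "int_iterate (carrier A) \<sigma> (- n) a"]) auto
    qed
  qed
  also have "\<dots> \<longleftrightarrow> (\<forall>x\<in>{x. ev x \<in> J}. int_iterate UNIV \<Sigma> (- n) x \<in> {x. ev x \<in> I})"
  proof
    assume *: "\<forall>x\<in>{x. ev x \<in> J}. int_iterate UNIV \<Sigma> (- n) x \<in> {x. ev x \<in> I}"
    show "\<forall>a\<in>J. int_iterate (carrier A) \<sigma> (- n) a \<in> I"
    proof
      fix a assume a: "a \<in> J"
      then have "ev (var a) = a" using sub ev_var by blast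
      then show "int_iterate (carrier A) \<sigma> (- n) a \<in> I" using *[rule_format, of "var a"] a by (simp add: ev_iterate)
    qed
  qed (simp add: ev_iterate)
  finally show ?thesis .
qed

end

theorem theorem1p7:
  fixes K :: "('k, 'm) ring_scheme"
    and A :: "('k, 'a, 'n) module_scheme"
    and \<sigma> :: "'a \<Rightarrow> 'a"
    and I J :: "'a set"
  assumes "field K"
    and "char_zero K"
    and "finitely_generated_algebra K A"
    and "algebra_automorphism K A \<sigma>"
    and "ideal I A"
    and "ideal J A"
  shows "two_sided_SML {n :: int. J \<subseteq> int_iterate (carrier A) \<sigma> n ` I}"
proof -
  interpret K: field K by fact
  interpret alg: algebra K A using assms(3) by (simp add: finitely_generated_algebra_def)
  obtain G where G: "finite G" "G \<subseteq> carrier A"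
    and gen: "generate_ring A ((\<lambda>c. c \<odot>\<^bsub>A\<^esub> \<one>\<^bsub>A\<^esub>) ` carrier K \<union> G) = carrier A"
    using assms(3) by (auto simp: finitely_generated_algebra_def)
  let ?S = "\<lambda>c. c \<odot>\<^bsub>A\<^esub> \<one>\<^bsub>A\<^esub>"
  have scalar_closed: "?S c \<in> carrier A" if "c \<in> carrier K" for c using that by simp
  have scalar_mult: "?S c \<otimes>\<^bsub>A\<^esub> ?S d = ?S (c \<otimes>\<^bsub>K\<^esub> d)" if "c \<in> carrier K" "d \<in> carrier K" for c d
    using that by (simp add: alg.smult_assoc2 alg.smult_assoc1)
  have scalar_add: "?S (c \<oplus>\<^bsub>K\<^esub> d) = ?S c \<oplus>\<^bsub>A\<^esub> ?S d" if "c \<in> carrier K" "d \<in> carrier K" for c d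
    using that by (simp add: alg.smult_l_distr)
  have scalar_neg: "?S (\<ominus>\<^bsub>K\<^esub> c) = \<ominus>\<^bsub>A\<^esub> ?S c" if "c \<in> carrier K" for c
    using that by (simp add: alg.smult_l_minus)
  have scalar_0: "?S \<zero>\<^bsub>K\<^esub> = \<zero>\<^bsub>A\<^esub>" by (simp add: alg.smult_l_null)
  have scalar_1: "?S \<one>\<^bsub>K\<^esub> = \<one>\<^bsub>A\<^esub>" by simp
  have scalar_nat: "?S (add_pow K (n::nat) \<one>\<^bsub>K\<^esub>) = add_pow A n \<one>\<^bsub>A\<^esub>" for n
    by (induction n) (auto simp: scalar_0 scalar_add scalar_1)
  define \<iota> where "\<iota> n = ?S (inv\<^bsub>K\<^esub> (add_pow K (Suc n) \<one>\<^bsub>K\<^esub>))" for n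
  interpret rat_cring_automorphism A \<iota> \<sigma>
  proof
    fix n
    have "add_pow K (Suc n) \<one>\<^bsub>K\<^esub> \<noteq> \<zero>\<^bsub>K\<^esub>" using assms(2) unfolding char_zero_def by blast
    then have unit: "add_pow K (Suc n) \<one>\<^bsub>K\<^esub> \<in> Units K" by (simp add: K.field_Units del: K.add.nat_pow_Suc)
    then show "\<iota> n \<in> carrier A" unfolding \<iota>_def by (intro scalar_closed K.Units_inv_closed)
    have "add_pow A (Suc n) \<one>\<^bsub>A\<^esub> \<otimes>\<^bsub>A\<^esub> \<iota> n
        = ?S (add_pow K (Suc n) \<one>\<^bsub>K\<^esub> \<otimes>\<^bsub>K\<^esub> inv\<^bsub>K\<^esub> (add_pow K (Suc n) \<one>\<^bsub>K\<^esub>))"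
      unfolding \<iota>_def scalar_nat[symmetric] using unit
      by (intro scalar_mult K.Units_inv_closed K.Units_closed)
    then show "add_pow A (Suc n) \<one>\<^bsub>A\<^esub> \<otimes>\<^bsub>A\<^esub> \<iota> n = \<one>\<^bsub>A\<^esub>"
      unfolding K.Units_r_inv[OF unit] scalar_1 .
    show "\<sigma> \<in> ring_iso A A" using assms(4) by (simp add: algebra_automorphism_def)
  qed
  have \<sigma>_scalar: "\<sigma> (?S c) = ?S c" if "c \<in> carrier K" for c
    using assms(4) that \<sigma>_one by (simp add: algebra_automorphism_def)
  \<comment> \<open>The preimage of the scalars plays the role of the ground field.\<close>
  define L where "L = {x. ev x \<in> ?S ` carrier K}"
  have L: "is_subring L"
    unfolding is_subring_def
  proof (intro conjI ballI)
    show "1 \<in> L" unfolding L_def by (simp add: image_iff) (metis K.one_closed scalar_1)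
  next
    fix x y assume "x \<in> L" "y \<in> L"
    then obtain c d where cd: "c \<in> carrier K" "d \<in> carrier K" "ev x = ?S c" "ev y = ?S d" unfolding L_def by blast
    have "ev (x - y) = ?S (c \<ominus>\<^bsub>K\<^esub> d)"
      using cd by (simp add: a_minus_def K.minus_eq scalar_add scalar_neg)
    then show "x - y \<in> L" unfolding L_def using cd by blast
    have "ev (x * y) = ?S (c \<otimes>\<^bsub>K\<^esub> d)" using cd scalar_mult by simp
    then show "x * y \<in> L" unfolding L_def using cd by blast
  qed
  have "\<zero>\<^bsub>A\<^esub> \<in> ?S ` carrier K" using scalar_0[symmetric] K.zero_closed by (rule image_eqI)
  then have ZL: "Z \<subseteq> L" unfolding Z_def L_def by auto
  have noethL: "noetherian_between L L Z"
  proof (rule noetherian_between_field[OF L Z_ideal])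
    fix b assume b: "b \<in> L" "b \<notin> Z"
    then obtain c where c: "c \<in> carrier K" "ev b = ?S c" unfolding L_def by blast
    then have "c \<noteq> \<zero>\<^bsub>K\<^esub>" using b(2) scalar_0 unfolding Z_def by auto
    then have unit: "c \<in> Units K" using c(1) by (simp add: K.field_Units)
    let ?d = "var (?S (inv\<^bsub>K\<^esub> c))"
    have ev_d: "ev ?d = ?S (inv\<^bsub>K\<^esub> c)" using unit by (intro ev_var scalar_closed K.Units_inv_closed)
    have "ev (b * ?d) = \<one>\<^bsub>A\<^esub>"
      using scalar_mult[OF c(1) K.Units_inv_closed[OF unit]] K.Units_r_inv[OF unit] scalar_1 by (simp add: c(2) ev_d)
    then have "b * ?d - 1 \<in> Z" unfolding Z_def by (simp add: a_minus_def alg.r_neg)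
    moreover have "?d \<in> L" unfolding L_def using ev_d K.Units_inv_closed[OF unit] by blast
    ultimately show "\<exists>d\<in>L. b * d - 1 \<in> Z" by blast
  qed
  let ?H = "var ` G"
  have gen_ring: "is_subring (subring_gen (L \<union> ?H))" by (rule gen_subring)
  have "\<exists>y\<in>subring_gen (L \<union> ?H). ev y = a" if "a \<in> carrier A" for a
  proof -
    have "a \<in> generate_ring A (?S ` carrier K \<union> G)" using that gen by simp
    then show ?thesis
    proof induction
      case one
      show ?case using gen_ring by (intro bexI[of _ 1]) auto
    next
      case (incl h)
      then have h: "h \<in> carrier A" using G(2) scalar_closed by auto
      have "var h \<in> L \<union> ?H" using incl ev_var[OF h] by (auto simp: L_def)
      then show ?case by (intro bexI[of _ "var h"] gen_base ev_var[OF h])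
    next
      case (a_inv h)
      then obtain y where "y \<in> subring_gen (L \<union> ?H)" "ev y = h" by blast
      then show ?case using subring_uminus[OF gen_ring] by (intro bexI[of _ "- y"]) auto
    next
      case (eng_add h k)
      then obtain x y where "x \<in> subring_gen (L \<union> ?H)" "ev x = h" "y \<in> subring_gen (L \<union> ?H)" "ev y = k" by blast
      then show ?case using subring_add[OF gen_ring] by (intro bexI[of _ "x + y"]) auto
    next
      case (eng_mult h k)
      then obtain x y where "x \<in> subring_gen (L \<union> ?H)" "ev x = h" "y \<in> subring_gen (L \<union> ?H)" "ev y = k" by blast
      then show ?case using subring_mult[OF gen_ring] by (intro bexI[of _ "x * y"]) auto
    qed
  qed
  then have "x \<in> subring_gen (L \<union> ?H)" for x
  proof -
    assume *: "\<And>a. a \<in> carrier A \<Longrightarrow> \<exists>y\<in>subring_gen (L \<union> ?H). ev y = a"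
    obtain y where y: "y \<in> subring_gen (L \<union> ?H)" "ev y = ev x" using *[of "ev x"] by auto
    have "x - y \<in> L \<union> ?H" using y(2) ZL unfolding Z_def by (auto simp: a_minus_def alg.r_neg)
    then have "(x - y) + y \<in> subring_gen (L \<union> ?H)" by (intro subring_add[OF gen_ring gen_base y(1)])
    then show ?thesis by simp
  qed
  then have gen_UNIV: "subring_gen (L \<union> ?H) = UNIV" by blast
  have noeth: "noetherian_between UNIV UNIV Z"
    using noetherian_between_gen[of ?H L Z] G(1) L Z_ideal ZL noethL unfolding gen_UNIV by blast
  have fixed: "\<Sigma> b - b \<in> Z" if "b \<in> L" for b
    using that \<sigma>_scalar unfolding L_def Z_def by (auto simp: ev_\<Sigma> a_minus_def alg.r_neg)
  have H: "finite ?H" using G(1) by simp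
  have ZI: "Z \<subseteq> {x. ev x \<in> M}" if "ideal M A" for M
    unfolding Z_def using additive_subgroup.zero_closed[OF ideal.axioms(1)[OF that]] by auto
  have "eventually_periodic {n. \<forall>x\<in>{x. ev x \<in> J}. int_iterate UNIV \<Sigma> n x \<in> {x. ev x \<in> I}}"
    using free.finitely_generated_invariant_subring[OF H gen_UNIV fixed]
    by (intro free.ideal_eventually_periodic[OF noeth] ideal_preimage ZI assms(5,6)) 
  then have "eventually_periodic {n. - n \<in> {n. \<forall>x\<in>{x. ev x \<in> J}. int_iterate UNIV \<Sigma> n x \<in> {x. ev x \<in> I}}}"
    by (rule eventually_periodic_uminus)
  also have "{n. - n \<in> {n. \<forall>x\<in>{x. ev x \<in> J}. int_iterate UNIV \<Sigma> n x \<in> {x. ev x \<in> I}}}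
      = {n. J \<subseteq> int_iterate (carrier A) \<sigma> n ` I}"
    using subset_iterate_iff[OF assms(5,6)] by simp
  finally show ?thesis by (rule eventually_periodic_SML)
qed

end
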